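(* Let $L(s,\pi)$ be an $L$-function of degree $m$ in the class described in the context, with constant $\vartheta\in[0,1]$, completed $L$-function $\Lambda(s,\pi)$, and analytic conductor $C(\pi)$. Assume the generalized Riemann hypothesis for $\Lambda(s,\pi)$. Then there is at least one zero $\rho_\pi=\frac12+i\gamma_\pi$ of $\Lambda(s,\pi)$ satisfying \[ |\gamma_\pi| \le \left(\frac12+\vartheta\right)\frac{\pi}{\log\log[C(\pi)^{3/m}]}+O\!\left(\frac{\log\log\log[C(\pi)^{3/m}]}{\big(\log\log[C(\pi)^{3/m}]\big)^2}\right) \] when $C(\pi)^{3/m}$ is sufficiently large (larger than an absolute constant), where the implied constant is universal (absolute: independent of $m$, $\vartheta$ and of the $L$-function). In the displayed numerator, $\pi$ is the usual number $3.14159\ldots$.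
   Context: Class of $L$-functions. Let $m$ be a natural number. For $\mathrm{Re}(s)>1$, $L(s,\pi)$ is given by an absolutely convergent Dirichlet series and Euler product \[ L(s,\pi)=\sum_{n=1}^\infty\frac{\lambda_\pi(n)}{n^s}=\prod_p\prod_{j=1}^m\left(1-\frac{\alpha_{j,\pi}(p)}{p^s}\right)^{-1}, \] with $\lambda_\pi(1)=1$, $\lambda_\pi(n)\in\mathbb{C}$, and $\alpha_{j,\pi}(p)\in\mathbb{C}$ satisfying $|\alpha_{j,\pi}(p)|\le p^{\vartheta}$ for a constant $0\le\vartheta\le1$. (In $L(s,\pi)$, $\Lambda(s,\pi)$, $C(\pi)$ and subscripts, $\pi$ is just a label for the $L$-function; inside $\Gamma_{\mathbb R}$ it is the usual number.) The completed $L$-function is \[ \Lambda(s,\pi)=L(s,\pi_\infty)L(s,\pi),\qquad L(s,\pi_\infty)=N^{s/2}\prod_{j=1}^m\Gamma_{\mathbb{R}}(s+\mu_j),\qquad \Gamma_{\mathbb{R}}(s)=\pi^{-s/2}\Gamma(s/2), \] where $N$ is a natural number (the conductor) and the spectral parameters $\mu_j$ are complex numbers which are either real or come in conjugate pairs and satisfy $\mathrm{Re}(\mu_j)>-1$. It is assumed that $\Lambda(s,\pi)$ extends to a meromorphic function of order $1$ in $\mathbb{C}$ with at most poles at $s=0$ and $s=1$, each of order at most $m$, and that it satisfies the functional equation \[ \Lambda(s,\pi)=\kappa\,\Lambda(1-s,\tilde\pi),\qquad \Lambda(s,\tilde\pi)=\overline{\Lambda(\bar s,\pi)}, \] where $\kappa\in\mathbb{C}$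 has $|\kappa|=1$. Generalized Riemann hypothesis for $\Lambda(s,\pi)$: all zeros of $\Lambda(s,\pi)$ have real part $\tfrac12$. The analytic conductor is $C(\pi)=N\prod_{j=1}^m(|\mu_j|+3)$. Convention: an inequality $A\le B+O(D)$ with $D>0$ means there is a constant $K>0$ with $A\le B+KD$. *)

theory Defs
  imports "HOL-Complex_Analysis.Complex_Analysis"
begin

definition Gamma_R :: "complex \<Rightarrow> complex" where
  "Gamma_R s = of_real pi powr (- s / 2) * Gamma (s / 2)"

text \<open>
  The order of growth: the infimum of all exponents \<open>\<rho>\<close> with \<open>norm (f s) \<le> exp (norm s powr \<rho>)\<close> near
  infinity.  It is meaningful for meromorphic functions with finitely many poles, for which it
  agrees with the order of the entire function obtained by multiplying with a polynomial that
  cancels the poles.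
\<close>

definition growth_order :: "(complex \<Rightarrow> complex) \<Rightarrow> ereal" where
  "growth_order f =
     Inf {ereal \<rho> | \<rho>. \<rho> \<ge> 0 \<and> (\<forall>\<^sub>F s in at_infinity. norm (f s) \<le> exp (norm s powr \<rho>))}"

text \<open>
  The data of an \<open>L\<close>-function.  Families indexed by \<open>j\<close> matter only for \<open>1 \<le> j \<le> deg_L\<close>;
  \<open>local_root L j p\<close> is \<open>\<alpha>\<^sub>j(p)\<close>.  The meromorphic continuation of the completed \<open>L\<close>-function
  is part of the data; it is determined by its values on \<open>Re s > 1\<close>.
\<close>

record lfun =
  deg_L :: nat
  dcoeff :: "nat \<Rightarrow> complex"
  local_root :: "nat \<Rightarrow> nat \<Rightarrow> complex"
  conductor :: nat
  spectral :: "nat \<Rightarrow> complex"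
  root_number :: complex
  completed :: "complex \<Rightarrow> complex"

definition L_series :: "lfun \<Rightarrow> complex \<Rightarrow> complex" where
  "L_series L s = (\<Sum>\<^sub>\<infinity>n\<in>{1..}. dcoeff L n / of_nat n powr s)"

definition euler_factor :: "lfun \<Rightarrow> nat \<Rightarrow> complex \<Rightarrow> complex" where
  "euler_factor L p s = (\<Prod>j=1..deg_L L. inverse (1 - local_root L j p / of_nat p powr s))"

definition L_infinity :: "lfun \<Rightarrow> complex \<Rightarrow> complex" where
  "L_infinity L s = of_nat (conductor L) powr (s / 2) * (\<Prod>j=1..deg_L L. Gamma_R (s + spectral L j))"

definition dual_completed :: "lfun \<Rightarrow> complex \<Rightarrow> complex" where
  "dual_completed L s = cnj (completed L (cnj s))"

text \<open>
  \<open>nicely_meromorphic_on\<close> only adds to meromorphy that removable singularities are filled in (and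
  that the value at a pole is \<open>0\<close>).  The functional equation is stated away from the possible
  poles \<open>0\<close> and \<open>1\<close>.
\<close>

definition L_function :: "real \<Rightarrow> lfun \<Rightarrow> bool" where
  "L_function \<theta> L \<longleftrightarrow>
     deg_L L \<ge> 1 \<and> conductor L \<ge> 1 \<and> 0 \<le> \<theta> \<and> \<theta> \<le> 1 \<and>
     dcoeff L 1 = 1 \<and>
     (\<forall>p. prime p \<longrightarrow> (\<forall>j\<in>{1..deg_L L}. norm (local_root L j p) \<le> real p powr \<theta>)) \<and>
     (\<forall>s. Re s > 1 \<longrightarrow>
        (\<lambda>n. norm (dcoeff L n / of_nat n powr s)) summable_on {1..} \<and>
        abs_convergent_prod (\<lambda>p. if prime p then euler_factor L p s else 1) \<and>
        (\<lambda>p. if prime p then euler_factor L p s else 1) has_prod (L_series L s)) \<and>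
     (\<forall>j\<in>{1..deg_L L}. Re (spectral L j) > -1) \<and>
     image_mset (\<lambda>j. cnj (spectral L j)) (mset_set {1..deg_L L}) =
       image_mset (spectral L) (mset_set {1..deg_L L}) \<and>
     completed L nicely_meromorphic_on UNIV \<and>
     (\<forall>s. Re s > 1 \<longrightarrow> completed L s = L_infinity L s * L_series L s) \<and>
     growth_order (completed L) = 1 \<and>
     (\<forall>z. is_pole (completed L) z \<longrightarrow>
        z \<in> {0, 1} \<and> zorder (completed L) z \<ge> - int (deg_L L)) \<and>
     norm (root_number L) = 1 \<and>
     (\<forall>s. s \<notin> {0, 1} \<longrightarrow> completed L s = root_number L * dual_completed L (1 - s))"

text \<open>
  Zeros are expressed by \<open>isolated_zero\<close> rather than by the value \<open>0\<close>, since the latter is also the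
  dummy value at a pole.
\<close>

definition GRH :: "lfun \<Rightarrow> bool" where
  "GRH L \<longleftrightarrow> (\<forall>\<rho>. isolated_zero (completed L) \<rho> \<longrightarrow> Re \<rho> = 1 / 2)"

definition analytic_conductor :: "lfun \<Rightarrow> real" where
  "analytic_conductor L = real (conductor L) * (\<Prod>j=1..deg_L L. (norm (spectral L j) + 3))"

end

theory Submission
  imports Defs "HOL-Real_Asymp.Real_Asymp"
begin

text \<open>
  Put \<open>z = s - 1/2\<close> and let \<open>f z\<close> be \<open>\<Lambda>\<close> made entire by the factor \<open>(s (s - 1)) ^ r\<close>.  Instead of an
  explicit formula over the zeros, the proof uses only that \<open>Re (f'/f)\<close> is nonnegative on
  \<open>Re z > 0\<close>.  This follows from a Phragmen-Lindelof argument for \<open>f (z - a) / f (z + a)\<close>, which is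
  unimodular on \<open>Re z = 0\<close> and at most \<open>1\<close> far to the right, letting \<open>a\<close> tend to \<open>0\<close>.

  Suppose that \<open>f\<close> has no zero \<open>i t\<close> with \<open>\<bar>t\<bar> \<le> T\<close>.  Integrate \<open>f'/f\<close> over \<open>Re z = u\<close> against a
  function \<open>h\<close> of exponential type \<open>V\<close> that is nonpositive for \<open>\<bar>t\<bar> \<ge> T\<close> and has positive integral,
  which is possible with \<open>T\<close> only slightly larger than \<open>\<pi> / V\<close>.  As \<open>u\<close> tends to \<open>0\<close> the integral
  becomes nonpositive up to an arbitrarily small error, because \<open>Re (f'/f)\<close> vanishes on the
  zero-free part of the imaginary axis.  On the other hand the Gamma factors and the conductor contribute
  \<open>log C(\<pi>)\<close> times a constant, and after moving the line to \<open>Re z = 4\<close> only prime powers below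
  \<open>exp V\<close> contribute, at most \<open>m V ^ 6 exp (V (1/2 + \<vartheta>))\<close> up to a constant.
  Choosing \<open>V (1/2 + \<vartheta>) = log log X - 7 log log log X\<close> gives a contradiction.
\<close>

section \<open>Complex analysis in half-planes and strips\<close>

text \<open>Positivity is what GRH suggests: a zero at \<open>\<i> g\<close> contributes
  \<open>Re (1 / (z - \<i> g)) > 0\<close> to \<open>Re (f'/f)\<close>; the argument gives this
  without any product formula. The line \<open>Re z = u\<close> replaces the imaginary axis because
  \<open>f'/f\<close> has poles there. The arithmetic estimates do not depend on \<open>u\<close>,
  so \<open>u\<close> may depend on the L-function although the final constants do not. The bound
  \<open>exp (V (1/2 + \<theta>))\<close> combines local roots, at most
  \<open>exp (V \<theta>)\<close> below the cutoff, with the sum of \<open>1 / sqrt p\<close> up to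
  \<open>exp V\<close>. The wasteful factor \<open>V ^ 6\<close> is harmless: it changes
  \<open>V\<close> only by a multiple of log log log X, which is the size of the error term. Of the
  7 in the choice of \<open>V\<close>, six cancel this factor and one beats all absolute constants.
  The degree drops out because \<open>log C(pi)\<close> is \<open>m / 3\<close> times
  \<open>log X\<close> while the arithmetic side is linear in \<open>m\<close>; this explains the
  power \<open>3/m\<close>. Allowing \<open>T\<^sup>2\<close> to exceed the critical value by the
  factor \<open>1 + 1/V\<close> changes the height of the zero by \<open>O(1 / V\<^sup>2)\<close>
  only.\<close>

lemma borel_caratheodory:
  assumes holo: "h holomorphic_on ball c R" and R: "0 < R" 
    and bd: "\<And>z. z \<in> ball c R \<Longrightarrow> Re (h z) < M" and z: "norm (z - c) \<le> r" "r < R"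
  shows "norm (h z - h c) \<le> 2 * r / (R - r) * (M - Re (h c))"
proof -
  define q where "q w = h (c + of_real R * w) - h c" for w
  define M' where "M' = M - Re (h c)"
  have M': "M' > 0" using bd[of c] R by (simp add: M'_def)
  have img: "c + of_real R * w \<in> ball c R" if "norm w < 1" for w
    using that R by (simp add: dist_norm norm_mult)
  have req: "Re (q w) < M'" if "norm w < 1" for w
    using bd[OF img[OF that]] by (simp add: q_def M'_def)
  have ne: "2 * of_real M' - q w \<noteq> 0" if "norm w < 1" for w
  proof
    assume "2 * of_real M' - q w = 0"
    hence "Re (2 * of_real M' - q w) = 0" by simp
    with req[OF that] M' show False by simp
  qed
  have hq: "q holomorphic_on ball 0 1"
    unfolding q_def using img
    by (intro holomorphic_intros holomorphic_on_compose_gen[OF _ holo, unfolded o_def]) auto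
  \<comment> \<open>A Moebius map takes the half-plane \<open>Re < M'\<close> to the unit disc and
    fixes 0, so the Schwarz lemma applies to \<open>\<phi>\<close>. Solving for \<open>q\<close> at
    the end turns \<open>norm (\<phi> w) \<le> r / R\<close> into the claim.\<close>
  define \<phi> where "\<phi> w = q w / (2 * of_real M' - q w)" for w
  have hphi: "\<phi> holomorphic_on ball 0 1"
    unfolding \<phi>_def using ne by (intro holomorphic_intros hq) auto
  have lt: "norm (\<phi> w) < 1" if "norm w < 1" for w
  proof -
    have "(norm (q w))\<^sup>2 < (norm (2 * of_real M' - q w))\<^sup>2"
    proof -
      have "(norm (2 * of_real M' - q w))\<^sup>2 - (norm (q w))\<^sup>2 = 4 * M' * (M' - Re (q w))"
        unfolding cmod_power2 by (simp add: power2_eq_square algebra_simps)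
      moreover have "4 * M' * (M' - Re (q w)) > 0" using M' req[OF that] by simp
      ultimately show ?thesis by linarith
    qed
    hence "norm (q w) < norm (2 * of_real M' - q w)"
      by (rule power2_less_imp_less) simp
    thus ?thesis using ne[OF that] by (simp add: \<phi>_def norm_divide divide_simps)
  qed
  define w where "w = (z - c) / of_real R"
  have nw: "norm w \<le> r / R" using z R by (simp add: w_def norm_divide divide_right_mono)
  have nw1: "norm w < 1" using z R by (simp add: w_def norm_divide)
  have r0: "r \<ge> 0" using z norm_ge_zero order_trans by blast
  have "norm (\<phi> w) \<le> norm w"
    using Schwarz_Lemma(1)[of \<phi> w] hphi lt nw1 by (simp add: \<phi>_def q_def)
  hence p: "norm (\<phi> w) \<le> r / R" using nw by linarith
  have p1: "1 + \<phi> w \<noteq> 0"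
    using lt[OF nw1] by (metis add.inverse_inverse add_eq_0_iff norm_minus_cancel norm_one less_irrefl)
  have "q w = 2 * of_real M' * \<phi> w / (1 + \<phi> w)"
    using ne[OF nw1] p1 by (simp add: \<phi>_def field_simps)
  hence "norm (q w) = 2 * M' * norm (\<phi> w) / norm (1 + \<phi> w)"
    using M' by (simp add: norm_mult norm_divide)
  also have "\<dots> \<le> 2 * M' * (r / R) / (1 - r / R)"
  proof (rule frac_le)
    show "1 - r / R \<le> norm (1 + \<phi> w)"
      using p norm_triangle_ineq2[of 1 "- \<phi> w"] by simp
  qed (use M' r0 R z in \<open>auto simp only: mult_nonneg_nonneg divide_nonneg_pos intro!: mult_left_mono p\<close>, simp_all add: p)
  also have "\<dots> = 2 * r / (R - r) * M'"
    using R z by (simp add: field_simps)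
  finally show ?thesis using R by (simp add: q_def w_def M'_def)
qed

text \<open>The multiplier needs a fourth power: a quadratic exponent decays only like
  \<open>exp (- \<epsilon> y\<^sup>2)\<close> and loses against \<open>exp (K y\<^sup>2)\<close>
  once \<open>\<epsilon>\<close> is small. In a strip \<open>Re (z ^ 4)\<close> is about
  \<open>y ^ 4\<close>, so the sign is right at both ends.\<close>

lemma phragmen_lindelof_strip:
  assumes holo: "\<phi> holomorphic_on S" and S: "open S" "{z. 0 \<le> Re z \<and> Re z \<le> R} \<subseteq> S"
    and left: "\<And>z. Re z = 0 \<Longrightarrow> norm (\<phi> z) \<le> 1" and right: "\<And>z. Re z = R \<Longrightarrow> norm (\<phi> z) \<le> 1"
    and growth: "\<And>z. 0 \<le> Re z \<Longrightarrow> Re z \<le> R \<Longrightarrow> norm (\<phi> z) \<le> exp (K * (1 + (Im z)\<^sup>2))"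
    and z0: "0 \<le> Re z0" "Re z0 \<le> R"
  shows "norm (\<phi> z0) \<le> 1"
proof -
  have nexp: "norm (exp (- of_real \<epsilon> * z ^ 4)) = exp (- \<epsilon> * ((Re z)^4 - 6 * (Re z)\<^sup>2 * (Im z)\<^sup>2 + (Im z)^4))" for \<epsilon> z
    by (simp add: power4_eq_xxxx power2_eq_square algebra_simps)
  have main: "norm (\<phi> z0 * exp (- of_real \<epsilon> * z0 ^ 4)) \<le> exp (9 * \<epsilon> * R ^ 4)" if e: "\<epsilon> > 0" for \<epsilon>
  proof -
    \<comment> \<open>Height of a box around \<open>z0\<close> on whose horizontal edges the
      multiplier beats the growth, because \<open>\<epsilon> Y\<^sup>2 \<ge> 2 \<bar>K\<bar> + 6
      \<epsilon> R\<^sup>2\<close>.\<close>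
    define Y where "Y = Max {1, \<bar>Im z0\<bar> + 1, (2 * \<bar>K\<bar> + 6 * \<epsilon> * R\<^sup>2) / \<epsilon>}"
    have Y: "Y \<ge> 1" "Y \<ge> \<bar>Im z0\<bar> + 1" "Y \<ge> (2 * \<bar>K\<bar> + 6 * \<epsilon> * R\<^sup>2) / \<epsilon>"
      by (simp_all add: Y_def)
    have YY: "Y \<le> Y\<^sup>2" using Y(1) by (simp add: power2_eq_square)
    have neg: "K * (1 + Y\<^sup>2) + \<epsilon> * (6 * R\<^sup>2 * Y\<^sup>2 - Y^4) \<le> 0"
    proof -
      have "(2 * \<bar>K\<bar> + 6 * \<epsilon> * R\<^sup>2) \<le> \<epsilon> * Y\<^sup>2"
        using Y(3) YY e by (smt (verit) divide_le_eq mult.commute mult_left_mono)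
      hence "(2 * \<bar>K\<bar> + 6 * \<epsilon> * R\<^sup>2) * Y\<^sup>2 \<le> \<epsilon> * Y\<^sup>2 * Y\<^sup>2"
        by (rule mult_right_mono) simp
      moreover have "K * (1 + Y\<^sup>2) \<le> \<bar>K\<bar> * (2 * Y\<^sup>2)"
        using Y(1) YY by (intro mult_mono) auto
      ultimately show ?thesis by (simp add: algebra_simps power2_eq_square power4_eq_xxxx)
    qed
    have R0: "0 \<le> R" using z0 by simp
    define B where "B = cbox (Complex 0 (-Y)) (Complex R Y)"
    have inB: "z \<in> B \<longleftrightarrow> 0 \<le> Re z \<and> Re z \<le> R \<and> \<bar>Im z\<bar> \<le> Y" for z
      by (auto simp: B_def in_cbox_complex_iff)
    have BS: "B \<subseteq> S" using S inB by blast
    have fr: "frontier B = B - box (Complex 0 (-Y)) (Complex R Y)"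
      unfolding B_def by (simp add: frontier_def closure_closed interior_cbox)
    have "norm (\<phi> z0 * exp (- of_real \<epsilon> * z0 ^ 4)) \<le> exp (9 * \<epsilon> * R ^ 4)"
    proof (rule maximum_modulus_frontier[where S = B and f = "\<lambda>z. \<phi> z * exp (- of_real \<epsilon> * z ^ 4)"])
      have h: "(\<lambda>z. \<phi> z * exp (- of_real \<epsilon> * z ^ 4)) holomorphic_on B"
        by (intro holomorphic_intros holomorphic_on_subset[OF holo BS])
      thus "(\<lambda>z. \<phi> z * exp (- of_real \<epsilon> * z ^ 4)) holomorphic_on interior B"
        using interior_subset holomorphic_on_subset by blast
      have "closure B = B" by (simp add: B_def)
      thus "continuous_on (closure B) (\<lambda>z. \<phi> z * exp (- of_real \<epsilon> * z ^ 4))"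
        using h by (simp add: holomorphic_on_imp_continuous_on)
      show "bounded B" by (simp add: B_def)
      show "z0 \<in> B" using z0 Y by (simp add: inB)
    next
      fix z assume "z \<in> frontier B"
      hence z: "z \<in> B" and "z \<notin> box (Complex 0 (-Y)) (Complex R Y)" by (auto simp: fr)
      hence cases: "Re z = 0 \<or> Re z = R \<or> \<bar>Im z\<bar> = Y"
        using inB[of z] by (auto simp: in_box_complex_iff)
      note zB = inB[THEN iffD1, OF z]
      have x2: "(Re z)\<^sup>2 \<le> R\<^sup>2" using zB by (intro power_mono) auto
      have ineq: "- \<epsilon> * ((Re z)^4 - 6 * (Re z)\<^sup>2 * (Im z)\<^sup>2 + (Im z)^4) \<le> \<epsilon> * (6 * R\<^sup>2 * (Im z)\<^sup>2 - (Im z)^4)"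
      proof -
        have "(Re z)\<^sup>2 * (Im z)\<^sup>2 \<le> R\<^sup>2 * (Im z)\<^sup>2" using x2 by (intro mult_right_mono) auto
        hence "-((Re z)^4 - 6 * (Re z)\<^sup>2 * (Im z)\<^sup>2 + (Im z)^4) \<le> 6 * R\<^sup>2 * (Im z)\<^sup>2 - (Im z)^4"
          using zero_le_power2[of "(Re z)\<^sup>2"] by (simp add: mult.assoc power4_eq_xxxx power2_eq_square)
        hence "\<epsilon> * -((Re z)^4 - 6 * (Re z)\<^sup>2 * (Im z)\<^sup>2 + (Im z)^4) \<le> \<epsilon> * (6 * R\<^sup>2 * (Im z)\<^sup>2 - (Im z)^4)"
          using e by (intro mult_left_mono) auto
        thus ?thesis by (simp only: mult_minus_right mult_minus_left)
      qed
      \<comment> \<open>Completing the square: with \<open>y = Im z\<close> the bracket is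
        \<open>9 R ^ 4 - (y\<^sup>2 - 3 R\<^sup>2)\<^sup>2\<close>.\<close>
      have sq: "\<epsilon> * (6 * R\<^sup>2 * (Im z)\<^sup>2 - (Im z)^4) \<le> 9 * \<epsilon> * R^4"
      proof -
        have "0 \<le> ((Im z)\<^sup>2 - 3 * R\<^sup>2)\<^sup>2" by simp
        hence "6 * R\<^sup>2 * (Im z)\<^sup>2 - (Im z)^4 \<le> 9 * R^4"
          by (simp add: power2_eq_square power4_eq_xxxx algebra_simps)
        from mult_left_mono[OF this, of \<epsilon>] e show ?thesis by simp
      qed
      show "norm (\<phi> z * exp (- of_real \<epsilon> * z ^ 4)) \<le> exp (9 * \<epsilon> * R ^ 4)"
      proof (cases "Re z = 0 \<or> Re z = R")
        case True
        hence "norm (\<phi> z) \<le> 1" using left right by auto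
        hence "norm (\<phi> z) * norm (exp (- of_real \<epsilon> * z ^ 4)) \<le> 1 * exp (9 * \<epsilon> * R ^ 4)"
          using order_trans[OF ineq sq] unfolding nexp by (intro mult_mono) simp_all
        thus ?thesis by (simp add: norm_mult)
      next
        case False
        hence Y2: "(Im z)\<^sup>2 = Y\<^sup>2" "(Im z)^4 = Y^4" using cases
          by (metis power2_abs, metis cases False power_even_abs even_numeral)
        have "norm (\<phi> z) * norm (exp (- of_real \<epsilon> * z ^ 4))
            \<le> exp (K * (1 + (Im z)\<^sup>2)) * exp (\<epsilon> * (6 * R\<^sup>2 * (Im z)\<^sup>2 - (Im z)^4))"
          using ineq growth[of z] zB unfolding nexp by (intro mult_mono) simp_all
        also have "\<dots> = exp (K * (1 + Y\<^sup>2) + \<epsilon> * (6 * R\<^sup>2 * Y\<^sup>2 - Y^4))"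
          by (simp add: exp_add Y2)
        also have "\<dots> \<le> 1" using neg by simp
        also have "\<dots> \<le> exp (9 * \<epsilon> * R ^ 4)" using e R0 by simp
        finally show ?thesis by (simp add: norm_mult)
      qed
    qed
    thus ?thesis .
  qed
  have "((\<lambda>\<epsilon>::real. norm (\<phi> z0 * exp (- of_real \<epsilon> * z0 ^ 4))) \<longlongrightarrow> norm (\<phi> z0 * exp (- of_real 0 * z0 ^ 4))) (at_right 0)"
    by (intro tendsto_intros)
  moreover have "((\<lambda>\<epsilon>::real. exp (9 * \<epsilon> * R ^ 4)) \<longlongrightarrow> exp (9 * 0 * R ^ 4)) (at_right 0)"
    by (intro tendsto_intros)
  moreover have "eventually (\<lambda>\<epsilon>::real. norm (\<phi> z0 * exp (- of_real \<epsilon> * z0 ^ 4)) \<le> exp (9 * \<epsilon> * R ^ 4)) (at_right 0)"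
    using main by (auto simp: eventually_at_right_field intro!: exI[of _ 1])
  ultimately show ?thesis
    using tendsto_le[OF trivial_limit_at_right_real] by fastforce
qed

text \<open>The factor \<open>\<i>\<close> of the contour integral is dropped, so that real parts
  can be compared pointwise under the integral.\<close>

definition vint :: "real \<Rightarrow> real \<Rightarrow> (complex \<Rightarrow> complex) \<Rightarrow> complex" where
  "vint c Y f = integral {-Y..Y} (\<lambda>t. f (Complex c t))"

lemma Complex_path_continuous: "continuous_on A (\<lambda>t. Complex c t)"
  unfolding Complex_eq by (intro continuous_intros)

lemma vint_integrable:
  fixes f :: "complex \<Rightarrow> complex"
  assumes "continuous_on S f" "\<And>t. Complex c t \<in> S"
  shows "(\<lambda>t. f (Complex c t)) integrable_on {-Y..Y}"
proof (rule integrable_continuous_real)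
  show "continuous_on {-Y..Y} (\<lambda>t. f (Complex c t))"
    using continuous_on_compose2[OF assms(1) Complex_path_continuous] assms(2) by blast
qed

text \<open>Cauchy's theorem through a primitive \<open>P\<close> on the half-plane: up to the
  factor \<open>\<i>\<close>, the difference of the vertical integrals is the difference of the
  increments of \<open>P\<close> along the two horizontal edges, each at most
  \<open>B (c2 - c1)\<close>.\<close>

lemma vint_shift_bound:
  assumes holo: "f holomorphic_on {z. Re z > d}" and c: "d < c1" "c1 \<le> c2" and Y: "Y > 0"
    and bd: "\<And>z. c1 \<le> Re z \<Longrightarrow> Re z \<le> c2 \<Longrightarrow> \<bar>Im z\<bar> = Y \<Longrightarrow> norm (f z) \<le> B"
  shows "norm (vint c1 Y f - vint c2 Y f) \<le> 2 * (c2 - c1) * B"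
proof -
  have op: "open {z. Re z > d}" by (simp add: open_halfspace_Re_gt)
  have "convex {z. Re z > d}" by (rule convex_halfspace_Re_gt)
  from holomorphic_convex_primitive'[OF this op holo]
  obtain P where P': "\<And>z. Re z > d \<Longrightarrow> (P has_field_derivative f z) (at z)"
    using op at_within_open by (metis mem_Collect_eq)
  have v: "vint c Y f = (P (Complex c Y) - P (Complex c (-Y))) / \<i>" if "c > d" for c
  proof -
    have "((\<lambda>t. f (Complex c t)) has_integral (P (Complex c Y) / \<i> - P (Complex c (-Y)) / \<i>)) {-Y..Y}"
    proof (rule fundamental_theorem_of_calculus)
      fix t :: real
      have "((\<lambda>t. Complex c t) has_vector_derivative \<i>) (at t within {-Y..Y})"
        unfolding Complex_eq by (auto intro!: derivative_eq_intros)
      from field_vector_diff_chain_within[OF this, of P "f (Complex c t)"]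
      have "((\<lambda>t. P (Complex c t)) has_vector_derivative \<i> * f (Complex c t)) (at t within {-Y..Y})"
        using P'[of "Complex c t"] that by (auto simp: o_def intro: has_field_derivative_at_within)
      from has_vector_derivative_mult_right[OF this, of "1 / \<i>"]
      show "((\<lambda>t. P (Complex c t) / \<i>) has_vector_derivative f (Complex c t)) (at t within {-Y..Y})"
        by (simp add: field_simps)
    qed (use Y in simp)
    thus ?thesis unfolding vint_def by (simp only: integral_unique diff_divide_distrib)
  qed
  have h: "norm (P (Complex c2 y) - P (Complex c1 y)) \<le> B * (c2 - c1)" if y: "\<bar>y\<bar> = Y" for y
  proof -
    have "norm (P (Complex c2 y) - P (Complex c1 y)) \<le> B * norm (Complex c2 y - Complex c1 y)"
    proof (rule field_differentiable_bound)
      show "convex (cbox (Complex c1 y) (Complex c2 y))" by (rule convex_box)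
      show "Complex c2 y \<in> cbox (Complex c1 y) (Complex c2 y)" "Complex c1 y \<in> cbox (Complex c1 y) (Complex c2 y)"
        using c by (auto simp: in_cbox_complex_iff)
      fix z assume "z \<in> cbox (Complex c1 y) (Complex c2 y)"
      hence z: "c1 \<le> Re z" "Re z \<le> c2" "Im z = y" by (auto simp: in_cbox_complex_iff)
      show "norm (f z) \<le> B" using z y by (intro bd) auto
      show "(P has_field_derivative f z) (at z within cbox (Complex c1 y) (Complex c2 y))"
        using has_field_derivative_at_within[OF P'[of z]] z c by simp
    qed
    also have "Complex c2 y - Complex c1 y = of_real (c2 - c1)" by (simp add: complex_eq_iff)
    also have "norm (of_real (c2 - c1) :: complex) = c2 - c1" using c by (simp only: norm_of_real)
    finally show ?thesis .
  qed
  have "vint c1 Y f - vint c2 Y f = ((P (Complex c2 (-Y)) - P (Complex c1 (-Y))) - (P (Complex c2 Y) - P (Complex c1 Y))) / \<i>"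
    using c by (simp add: v algebra_simps)
  also have "norm \<dots> = norm ((P (Complex c2 (-Y)) - P (Complex c1 (-Y))) - (P (Complex c2 Y) - P (Complex c1 Y)))"
    by (simp only: norm_divide norm_ii div_by_1)
  also have "\<dots> \<le> B * (c2 - c1) + B * (c2 - c1)"
    by (rule order_trans[OF norm_triangle_ineq4 add_mono]) (use h[of Y] h[of "-Y"] Y in simp_all)
  finally show ?thesis by (simp add: algebra_simps)
qed

lemma vint_norm_bound:
  assumes "continuous_on S f" "\<And>t. Complex c t \<in> S" and "Y > 0"
    and bd: "\<And>t. \<bar>t\<bar> \<le> Y \<Longrightarrow> norm (f (Complex c t)) \<le> b t" and b: "(b has_integral I) {-Y..Y}"
  shows "norm (vint c Y f) \<le> I"
proof -
  have "norm (vint c Y f) \<le> integral {-Y..Y} b"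
    unfolding vint_def using b bd
    by (intro integral_norm_bound_integral vint_integrable[OF assms(1,2)]) auto
  thus ?thesis using b by (simp add: integral_unique)
qed

text \<open>
  The line is closed by the three other sides of a box of side about \<open>Y\<close>, on which the integrand is
  \<open>O(1 / Y\<^sup>2)\<close>.
\<close>

lemma vint_right_box:
  assumes holo: "f holomorphic_on {z. Re z > d}" and c: "d < c" "0 \<le> c" and Y: "Y > 0"
    and bd: "\<And>z. c \<le> Re z \<Longrightarrow> norm z \<ge> Y \<Longrightarrow> norm (f z) \<le> C / (norm z)\<^sup>2"
  shows "norm (vint c Y f) \<le> 4 * C / Y"
proof -
  have C: "C \<ge> 0"
  proof -
    have "0 \<le> norm (f (of_real (c + Y)))" by simp
    also have "\<dots> \<le> C / (norm (of_real (c + Y) :: complex))\<^sup>2"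
      using c Y by (intro bd) (auto simp flip: of_real_add)
    finally show ?thesis using c Y by (simp add: zero_le_divide_iff del: of_real_add)
  qed
  have bd': "norm (f z) \<le> C / Y\<^sup>2" if "c \<le> Re z" "norm z \<ge> Y" for z
    using bd[OF that] Y C that
    by (elim order_trans) (auto intro!: divide_left_mono power_mono mult_pos_pos)
  have "norm (vint c Y f - vint (c + Y) Y f) \<le> 2 * ((c + Y) - c) * (C / Y\<^sup>2)"
  proof (rule vint_shift_bound[OF holo])
    fix z assume "c \<le> Re z" "Re z \<le> c + Y" "\<bar>Im z\<bar> = Y"
    thus "norm (f z) \<le> C / Y\<^sup>2" using abs_Im_le_cmod[of z] by (intro bd') auto
  qed (use c Y in auto)
  moreover have "norm (vint (c + Y) Y f) \<le> 2 * Y * (C / Y\<^sup>2)"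
  proof (rule vint_norm_bound[OF holomorphic_on_imp_continuous_on[OF holo]])
    show "((\<lambda>_. C / Y\<^sup>2) has_integral 2 * Y * (C / Y\<^sup>2)) {-Y..Y}"
      using has_integral_const_real[of "C / Y\<^sup>2" "-Y" Y] Y by simp
  next
    fix t
    show "norm (f (Complex (c + Y) t)) \<le> C / Y\<^sup>2"
      using complex_Re_le_cmod[of "Complex (c + Y) t"] c Y by (intro bd') auto
  qed (use c Y in auto)
  ultimately have "norm (vint c Y f) \<le> 2 * ((c + Y) - c) * (C / Y\<^sup>2) + 2 * Y * (C / Y\<^sup>2)"
    using norm_triangle_ineq2[of "vint c Y f" "vint (c + Y) Y f"] by linarith
  also have "\<dots> = 4 * C / Y" using Y by (simp add: field_simps power2_eq_square)
  finally show ?thesis .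
qed

text \<open>The exponent is \<open>1/2 - 2\<close>: the test function decays quadratically, and the
  absolute estimates pair it with functions growing at most like a square root, which leaves room
  for the logarithm from the Gamma factors. The value stays below 4 for all
  \<open>Y\<close>.\<close>

lemma has_integral_decay:
  assumes "Y \<ge> 0"
  shows "((\<lambda>t::real. (1 + \<bar>t\<bar>) powr (-3/2)) has_integral (4 - 4 * (1 + Y) powr (-1/2))) {-Y..Y}"
proof -
  have p: "((\<lambda>t::real. (1 + \<bar>t\<bar>) powr (-3/2)) has_integral (2 - 2 * (1 + Y) powr (-1/2))) {0..Y}"
  proof -
    have "((\<lambda>t::real. (1 + \<bar>t\<bar>) powr (-3/2)) has_integral 
       (- 2 * (1 + Y) powr (-1/2) - (- 2 * (1 + 0) powr (-1/2)))) {0..Y}"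
    proof (rule fundamental_theorem_of_calculus)
      fix x :: real assume "x \<in> {0..Y}"
      thus "((\<lambda>t. - 2 * (1 + t) powr (-1/2)) has_vector_derivative (1 + \<bar>x\<bar>) powr (-3/2)) (at x within {0..Y})"
        by (auto simp flip: has_real_derivative_iff_has_vector_derivative
                 intro!: derivative_eq_intros simp: powr_diff field_simps)
    qed (use assms in simp)
    thus ?thesis by simp
  qed
  have "((\<lambda>t::real. (1 + \<bar>-t\<bar>) powr (-3/2)) has_integral (2 - 2 * (1 + Y) powr (-1/2))) {-Y..-0}"
    using p by (subst has_integral_reflect_real) auto
  hence n: "((\<lambda>t::real. (1 + \<bar>t\<bar>) powr (-3/2)) has_integral (2 - 2 * (1 + Y) powr (-1/2))) {-Y..0}"
    by simp
  show ?thesis using has_integral_combine[OF _ _ n p] assms by simp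
qed

text \<open>\<open>Digamma w\<close> is the limit of \<open>ln m - (\<Sum>n<m. 1 / (w + n))\<close>.
  Each term is compared with the increment of \<open>Ln\<close> over a unit step; the increments
  telescope, and the errors are at most \<open>1 / (n + 1/2)\<^sup>2\<close>, uniformly in
  \<open>Re w \<ge> 1/2\<close>.\<close>

lemma Digamma_Ln_bound:
  obtains C where "C \<ge> 0" "\<And>w::complex. Re w \<ge> 1/2 \<Longrightarrow> norm (Digamma w - Ln w) \<le> C"
proof -
  define a where "a n = 1 / (real n + 1/2)\<^sup>2" for n
  have sa: "summable a"
  proof (rule summable_comparison_test'[where N = 1])
    show "summable (\<lambda>n. 1 / real n ^ 2)" by (rule inverse_power_summable[of 2, unfolded inverse_eq_divide]) simp
    show "norm (a n) \<le> 1 / real n ^ 2" if "n \<ge> 1" for n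
      using that by (auto simp: a_def intro!: divide_left_mono power_mono)
  qed
  have a0: "a n \<ge> 0" for n by (simp add: a_def)
  show ?thesis
  proof (rule that[of "suminf a"])
    show "suminf a \<ge> 0" using sa a0 by (rule suminf_nonneg)
    fix w :: complex assume w: "Re w \<ge> 1/2"
    have ne: "w + of_nat n \<noteq> 0" for n 
    proof
      assume "w + of_nat n = 0"
      hence "Re (w + of_nat n) = 0" by simp
      thus False using w by simp
    qed
    have step: "norm (inverse (w + of_nat n) - (Ln (w + of_nat (Suc n)) - Ln (w + of_nat n))) \<le> a n" for n
    proof -
      define u where "u = w + of_nat n"
      have u: "Re u \<ge> real n + 1/2" using w by (simp add: u_def)
      have upos: "Re u > 0" using u by (smt (verit) of_nat_0_le_iff half_gt_zero zero_less_one)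
      have nu: "norm u \<ge> real n + 1/2" using u complex_Re_le_cmod[of u] by linarith
      \<comment> \<open>The derivative is \<open>1/z - 1/u\<close>, and the increment from
        \<open>u\<close> to \<open>u + 1\<close> is minus the error in question. The box
        \<open>cbox u (u + 1)\<close> is a horizontal segment.\<close>
      define h where "h z = Ln z - z / u" for z
      have "norm (h (u + 1) - h u) \<le> a n * norm ((u + 1) - u)"
      proof (rule field_differentiable_bound)
        show "convex (cbox u (u + 1))" by (rule convex_box)
        fix z assume z: "z \<in> cbox u (u + 1)"
        hence zz: "Re u \<le> Re z" "Re z \<le> Re u + 1" "Im z = Im u" by (auto simp: in_cbox_complex_iff)
        have z0: "z \<noteq> 0" "z \<notin> \<real>\<^sub>\<le>\<^sub>0" using zz upos by (auto simp: complex_nonpos_Reals_iff)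
        show "(h has_field_derivative 1 / z - 1 / u) (at z within cbox u (u + 1))"
        proof -
          have "(h has_field_derivative inverse z - 1 / u) (at z within cbox u (u + 1))"
            unfolding h_def using z0 upos by (auto intro!: derivative_eq_intros)
          thus ?thesis by (simp only: inverse_eq_divide)
        qed
        have u0: "u \<noteq> 0" using upos by auto
        have eq: "1 / z - 1 / u = (u - z) / (z * u)" using z0 u0 by (simp add: diff_frac_eq)
        have "u - z = of_real (Re u - Re z)" using zz by (simp add: complex_eq_iff)
        hence n1: "norm (u - z) \<le> 1" using zz by (simp only: norm_of_real)
        have "norm z \<ge> norm u" using zz upos
          by (simp add: cmod_def power_mono)
        hence n2: "norm (z * u) \<ge> (real n + 1/2)\<^sup>2"
          using nu unfolding power2_eq_square norm_mult by (intro mult_mono) auto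
        show "norm (1 / z - 1 / u) \<le> a n"
          unfolding a_def eq norm_divide[of "u - z"] by (rule frac_le[OF _ n1 _ n2]) auto
      qed (auto simp: in_cbox_complex_iff)
      moreover have "h (u + 1) - h u = - (inverse u - (Ln (u + 1) - Ln u))"
        using upos by (auto simp: h_def field_simps)
      ultimately have "norm (- (inverse u - (Ln (u + 1) - Ln u))) \<le> a n" by simp
      thus ?thesis by (simp only: norm_minus_cancel u_def of_nat_Suc add_ac)
    qed
    have tele: "(\<Sum>n<m. Ln (w + of_nat (Suc n)) - Ln (w + of_nat n)) = Ln (w + of_nat m) - Ln w" for m
      using sum_lessThan_telescope[of "\<lambda>n. Ln (w + of_nat n)" m] by simp
    have part: "norm (Ln (w + of_nat m) - Ln w - (\<Sum>n<m. inverse (w + of_nat n))) \<le> suminf a" for m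
    proof -
      have "norm (\<Sum>n<m. inverse (w + of_nat n) - (Ln (w + of_nat (Suc n)) - Ln (w + of_nat n))) \<le> (\<Sum>n<m. a n)"
        by (rule sum_norm_le) (rule step)
      also have "\<dots> \<le> suminf a" by (rule sum_le_suminf[OF sa]) (auto simp: a0)
      finally have "norm ((\<Sum>n<m. inverse (w + of_nat n)) - (Ln (w + of_nat m) - Ln w)) \<le> suminf a"
        by (simp only: sum_subtractf[of "\<lambda>n. inverse (w + of_nat n)"] tele)
      thus ?thesis by (subst norm_minus_commute)
    qed
    have "(\<lambda>m. of_real (ln (real m)) - (\<Sum>n<m. inverse (w + of_nat n))) \<longlonglongrightarrow> Digamma w"
      using ne by (intro Digamma_LIMSEQ) (use w in auto)
    moreover have "(\<lambda>m. Ln (w + of_nat m) - of_real (ln (real m))) \<longlonglongrightarrow> 0"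
    proof -
      have "(\<lambda>m. Ln (1 + w / of_nat m)) \<longlonglongrightarrow> Ln (1 + 0)"
        by (intro tendsto_intros lim_1_over_n tendsto_divide_0[OF tendsto_const tendsto_of_nat]) auto
      moreover have "eventually (\<lambda>m. Ln (1 + w / of_nat m) = Ln (w + of_nat m) - of_real (ln (real m))) sequentially"
        using eventually_gt_at_top[of 0]
      proof eventually_elim
        case (elim m)
        have "1 + w / of_nat m = (w + of_nat m) / of_real (real m)" using elim by (simp add: field_simps)
        thus ?case using elim ne[of m] Ln_divide_of_real[of "real m" "w + of_nat m"] by simp
      qed
      ultimately show ?thesis by (simp add: tendsto_cong)
    qed
    ultimately have "(\<lambda>m. (of_real (ln (real m)) - (\<Sum>n<m. inverse (w + of_nat n))) + (Ln (w + of_nat m) - of_real (ln (real m)))) \<longlonglongrightarrow> Digamma w + 0"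
      by (rule tendsto_add)
    from tendsto_diff[OF this tendsto_const[of "Ln w"]]
    have "(\<lambda>m. Ln (w + of_nat m) - Ln w - (\<Sum>n<m. inverse (w + of_nat n))) \<longlonglongrightarrow> Digamma w - Ln w"
      by (simp add: add_ac diff_diff_eq)
    thus "norm (Digamma w - Ln w) \<le> suminf a"
      by (rule Lim_norm_ubound[OF trivial_limit_sequentially]) (simp add: part)
  qed
qed

section \<open>The test function\<close>

text \<open>Half the Laplace transform of the indicator function of \<open>[-V/2, V/2]\<close>, with
  the removable singularity at 0 filled in.\<close>

definition sinhc :: "real \<Rightarrow> complex \<Rightarrow> complex" where
  "sinhc V w = (if w = 0 then of_real (V / 2) else sinh (of_real (V / 2) * w) / w)"

lemma sinhc_holomorphic: "sinhc V holomorphic_on UNIV"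
proof (rule no_isolated_singularity)
  show "finite {0::complex}" by simp
  show "sinhc V holomorphic_on UNIV - {0}"
  proof (rule holomorphic_transform)
    show "(\<lambda>w. sinh (of_real (V / 2) * w) / w) holomorphic_on UNIV - {0}"
      unfolding sinh_field_def by (intro holomorphic_intros) auto
  qed (simp add: sinhc_def)
  have "((\<lambda>w. sinh (of_real (V / 2) * w)) has_field_derivative of_real (V / 2)) (at (0::complex))"
    by (auto intro!: derivative_eq_intros)
  hence "((\<lambda>w. sinh (of_real (V / 2) * w) / w) \<longlongrightarrow> of_real (V / 2)) (at (0::complex))"
    by (simp add: has_field_derivative_iff)
  hence "((\<lambda>w. sinhc V w) \<longlongrightarrow> of_real (V / 2)) (at (0::complex))"
    by (rule Lim_transform_eventually) (auto simp: eventually_at_filter sinhc_def)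
  moreover have "sinhc V 0 = of_real (V / 2)" by (simp add: sinhc_def)
  ultimately have z: "isCont (sinhc V) 0" by (simp only: isCont_def)
  have "isCont (sinhc V) w" for w
  proof (cases "w = 0")
    case False
    have "sinhc V analytic_on {w}"
      using \<open>sinhc V holomorphic_on UNIV - {0}\<close> False
      by (auto simp: analytic_at intro!: exI[of _ "UNIV - {0}"])
    thus ?thesis by (rule analytic_at_imp_isCont)
  qed (use z in simp)
  thus "continuous_on UNIV (sinhc V)" by (simp add: continuous_at_imp_continuous_on)
qed auto

lemma norm_cosh_le: "norm (cosh (z::complex)) \<le> exp \<bar>Re z\<bar>"
proof -
  have "norm (cosh z) = norm (exp z + exp (- z)) / 2"
    by (simp add: cosh_field_def norm_divide)
  also have "\<dots> \<le> (exp (Re z) + exp (- Re z)) / 2"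
    using norm_triangle_ineq[of "exp z" "exp (-z)"] by simp
  also have "\<dots> \<le> exp \<bar>Re z\<bar>"
    by (cases "Re z \<ge> 0") (simp_all add: field_simps)
  finally show ?thesis .
qed

text \<open>The mean value inequality for \<open>sinh (V z / 2)\<close> between 0 and
  \<open>w\<close>, in the convex strip \<open>\<bar>Re z\<bar> \<le> \<bar>Re w\<bar>\<close>,
  produces a factor \<open>norm w\<close> that cancels the denominator, so nothing is lost near
  0.\<close>

lemma norm_sinhc_le:
  assumes "V \<ge> 0"
  shows "norm (sinhc V w) \<le> V / 2 * exp (V / 2 * \<bar>Re w\<bar>)"
proof (cases "w = 0")
  case False
  have "norm (sinh (of_real (V / 2) * w) - sinh (of_real (V / 2) * 0)) \<le> (V / 2 * exp (V / 2 * \<bar>Re w\<bar>)) * norm (w - 0)"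
  proof (rule field_differentiable_bound)
    show "convex {z. \<bar>Re z\<bar> \<le> \<bar>Re w\<bar>}"
    proof -
      have "{z. \<bar>Re z\<bar> \<le> \<bar>Re w\<bar>} = {z. Re z \<le> \<bar>Re w\<bar>} \<inter> {z. Re z \<ge> - \<bar>Re w\<bar>}" by auto
      thus ?thesis by (simp add: convex_Int convex_halfspace_Re_le convex_halfspace_Re_ge)
    qed
    fix z assume z: "z \<in> {z. \<bar>Re z\<bar> \<le> \<bar>Re w\<bar>}"
    show "((\<lambda>w. sinh (of_real (V / 2) * w)) has_field_derivative of_real (V / 2) * cosh (of_real (V / 2) * z)) (at z within {z. \<bar>Re z\<bar> \<le> \<bar>Re w\<bar>})"
      by (auto intro!: derivative_eq_intros)
    have "norm (cosh (of_real (V / 2) * z)) \<le> exp \<bar>V / 2 * Re z\<bar>"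
      using norm_cosh_le[of "of_real (V / 2) * z"] by simp
    also have "\<dots> \<le> exp (V / 2 * \<bar>Re w\<bar>)"
      using assms z by (simp add: abs_mult mult_left_mono)
    finally show "norm (of_real (V / 2) * cosh (of_real (V / 2) * z)) \<le> V / 2 * exp (V / 2 * \<bar>Re w\<bar>)"
      using assms by (simp only: norm_mult norm_of_real) (simp add: mult_left_mono)
  qed auto
  thus ?thesis using False by (simp add: sinhc_def norm_divide field_simps)
qed (use assms in \<open>simp add: sinhc_def\<close>)

lemma sinhc_minus: "sinhc V (- w) = sinhc V w"
  by (simp add: sinhc_def)

lemma cnj_sinhc: "cnj (sinhc V w) = sinhc V (cnj w)"
  by (simp add: sinhc_def sinh_field_def exp_cnj)

text \<open>
  Up to scaling, \<open>ker V\<close> is \<open>cosh (V z / 2) / (a\<^sup>2 + z\<^sup>2)\<close> with \<open>a = \<pi> / V\<close>, the Fourier-Laplace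
  transform of the first Dirichlet eigenfunction \<open>cos (\<pi> v / V)\<close> of \<open>[-V/2, V/2]\<close>.  Writing it as a sum of
  two \<open>sinhc\<close> makes it visibly entire.
\<close>

definition ker :: "real \<Rightarrow> complex \<Rightarrow> complex" where
  "ker V z = of_real (V / (2 * pi)) * (sinhc V (z - \<i> * of_real (pi / V)) + sinhc V (z + \<i> * of_real (pi / V)))"

lemma ker_holomorphic: "ker V holomorphic_on A"
  unfolding ker_def using sinhc_holomorphic
  by (intro holomorphic_intros holomorphic_on_compose_gen[of _ A "sinhc V" UNIV, unfolded o_def])
     (auto intro!: holomorphic_intros)

text \<open>As \<open>V/2\<close> times \<open>\<i> pi / V\<close> is \<open>\<i> pi / 2\<close>,
  the two shifts turn \<open>sinh\<close> into \<open>- \<i> cosh\<close> and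
  \<open>\<i> cosh\<close>; the sum in \<open>ker\<close> is then a partial fraction decomposition.
  The product form covers the two zeros of the first factor as well.\<close>

lemma ker_eq:
  assumes V: "V > 0"
  shows "(of_real ((pi / V)\<^sup>2) + z\<^sup>2) * ker V z = cosh (of_real (V / 2) * z)"
proof -
  define a where "a = \<i> * of_real (pi / V)"
  have a2: "of_real ((pi / V)\<^sup>2) = - (a\<^sup>2)" by (simp add: a_def power_mult_distrib power_divide)
  have a0: "a \<noteq> 0" using V by (simp add: a_def)
  have Va: "of_real (V / 2) * a = \<i> * of_real (pi / 2)" using V by (simp add: a_def field_simps)
  define b where "b = \<i> * complex_of_real (pi / 2)"
  have eb: "exp b = \<i>" unfolding b_def by (metis cis_conv_exp cis_pi_half)
  have sm: "sinh (x - b) = - \<i> * cosh x" for x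
  proof -
    have "exp (x - b) = - \<i> * exp x" by (simp add: exp_diff eb)
    moreover have "exp (- (x - b)) = \<i> * exp (- x)" by (simp add: exp_diff exp_minus eb divide_inverse)
    ultimately show ?thesis unfolding sinh_field_def cosh_field_def by (simp add: field_simps)
  qed
  have sp: "sinh (x + b) = \<i> * cosh x" for x
  proof -
    have "x + b = - ((- x) - b)" by simp
    hence "sinh (x + b) = - sinh ((- x) - b)" by (simp only: sinh_minus)
    thus ?thesis by (simp only: sm cosh_minus) simp
  qed
  have s1: "sinhc V (z - a) * (z - a) = - \<i> * cosh (of_real (V / 2) * z)"
  proof -
    have "sinhc V (z - a) * (z - a) = sinh (of_real (V / 2) * (z - a))" by (simp add: sinhc_def)
    also have "of_real (V / 2) * (z - a) = of_real (V / 2) * z - b"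
      by (simp only: right_diff_distrib Va b_def)
    also have "sinh \<dots> = - \<i> * cosh (of_real (V / 2) * z)"
      by (rule sm)
    finally show ?thesis .
  qed
  have s2: "sinhc V (z + a) * (z + a) = \<i> * cosh (of_real (V / 2) * z)"
  proof -
    have "sinhc V (z + a) * (z + a) = sinh (of_real (V / 2) * (z + a))" by (simp add: sinhc_def)
    also have "of_real (V / 2) * (z + a) = of_real (V / 2) * z + b"
      by (simp only: distrib_left Va b_def)
    also have "sinh \<dots> = \<i> * cosh (of_real (V / 2) * z)"
      by (rule sp)
    finally show ?thesis .
  qed
  have ia: "\<i> * a = - of_real (pi / V)" by (simp add: a_def)
  have "(of_real ((pi / V)\<^sup>2) + z\<^sup>2) * ker V z =
     of_real (V / (2 * pi)) * ((sinhc V (z - a) * (z - a)) * (z + a) + (sinhc V (z + a) * (z + a)) * (z - a))"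
  proof -
    have "(- (a\<^sup>2) + z\<^sup>2) * (p * (x + y)) = p * ((x * (z - a)) * (z + a) + (y * (z + a)) * (z - a))" for p x y :: complex
      by (simp add: power2_eq_square algebra_simps)
    thus ?thesis unfolding ker_def a2 a_def[symmetric] .
  qed
  also have "\<dots> = of_real (V / (2 * pi)) * (- 2 * (\<i> * a)) * cosh (of_real (V / 2) * z)"
    unfolding s1 s2 by (simp add: algebra_simps)
  also have "of_real (V / (2 * pi)) * (- 2 * (\<i> * a)) = 1"
    unfolding ia using V by simp
  finally show ?thesis by simp
qed

lemma norm_ker_le:
  assumes "V > 0" "Re z \<ge> 0"
  shows "norm (ker V z) \<le> V\<^sup>2 / (2 * pi) * exp (V / 2 * Re z)"
proof -
  have "norm (ker V z) \<le> V / (2 * pi) * (V / 2 * exp (V / 2 * Re z) + V / 2 * exp (V / 2 * Re z))"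
    unfolding ker_def norm_mult norm_of_real
    using norm_sinhc_le[of V "z - \<i> * of_real (pi / V)"] norm_sinhc_le[of V "z + \<i> * of_real (pi / V)"] assms
    by (intro mult_mono order_trans[OF norm_triangle_ineq add_mono]) auto
  thus ?thesis by (simp add: power2_eq_square field_simps)
qed

text \<open>\<open>V \<ge> 2 pi\<close> means \<open>(pi / V)\<^sup>2 \<le> 1/4\<close>, so for
  \<open>norm z \<ge> 1\<close> the factor multiplying \<open>ker\<close> in \<open>ker_eq\<close>
  is at least \<open>3/4 (norm z)\<^sup>2\<close> and can be divided out.\<close>

lemma norm_ker_le':
  assumes V: "V \<ge> 2 * pi" and z: "Re z \<ge> 0" "norm z \<ge> 1"
  shows "norm (ker V z) \<le> 4 / 3 * exp (V / 2 * Re z) / (norm z)\<^sup>2"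
proof -
  have V0: "V > 0" using V pi_gt_zero by linarith
  have "pi / V \<le> 1 / 2" using V V0 by (simp add: field_simps)
  hence a: "(pi / V)\<^sup>2 \<le> 1 / 4" using V0 power_mono[of "pi / V" "1/2" 2] by (simp add: power2_eq_square)
  have z2: "(norm z)\<^sup>2 \<ge> 1" using z by simp
  have low: "norm (of_real ((pi / V)\<^sup>2) + z\<^sup>2) \<ge> 3 / 4 * (norm z)\<^sup>2"
  proof -
    have "norm (z\<^sup>2) - norm (of_real ((pi / V)\<^sup>2) :: complex) \<le> norm (of_real ((pi / V)\<^sup>2) + z\<^sup>2)"
      by (metis add.commute norm_diff_ineq)
    moreover have "norm (of_real ((pi / V)\<^sup>2) :: complex) = (pi / V)\<^sup>2"
      by (simp only: norm_of_real) simp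
    ultimately show ?thesis using a z2 by (simp add: norm_power)
  qed
  have "3 / 4 * (norm z)\<^sup>2 * norm (ker V z) \<le> norm (of_real ((pi / V)\<^sup>2) + z\<^sup>2) * norm (ker V z)"
    by (intro mult_right_mono low) auto
  also have "\<dots> = norm (cosh (of_real (V / 2) * z))" by (simp only: norm_mult[symmetric] ker_eq[OF V0])
  also have "\<dots> \<le> exp (V / 2 * Re z)" using norm_cosh_le[of "of_real (V / 2) * z"] V0 z by simp
  finally have "norm (ker V z) * (norm z)\<^sup>2 \<le> 4 / 3 * exp (V / 2 * Re z)" by (simp add: field_simps)
  thus ?thesis using z2 by (subst pos_le_divide_eq) auto
qed

text \<open>\<open>sinhc\<close> is even and commutes with conjugation, which acts on the imaginary
  axis as negation.\<close>

lemma ker_imaginary: "ker V (\<i> * of_real t) = of_real (Re (ker V (\<i> * of_real t)))"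
proof -
  have "cnj (ker V (\<i> * of_real t)) = ker V (\<i> * of_real t)"
  proof -
    define v w where "v = \<i> * of_real t - \<i> * of_real (pi / V)" and "w = \<i> * of_real t + \<i> * of_real (pi / V)"
    have vw: "cnj v = - v" "cnj w = - w" by (simp_all add: v_def w_def)
    show ?thesis unfolding ker_def v_def[symmetric] w_def[symmetric] complex_cnj_mult complex_cnj_add cnj_sinhc
        complex_cnj_complex_of_real vw sinhc_minus ..
  qed
  thus ?thesis by (simp add: complex_eq_iff)
qed

text \<open>
  On the imaginary axis this is \<open>(a\<^sup>2 (1 + 1/V) - t\<^sup>2) k(t)\<^sup>2\<close>.  Without the term \<open>1/V\<close> its integral
  would be \<open>0\<close>, so \<open>T = a\<close> is the critical value.
\<close>

definition testfun :: "real \<Rightarrow> complex \<Rightarrow> complex" where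
  "testfun V z = (of_real ((pi / V)\<^sup>2 * (1 + 1 / V)) + z\<^sup>2) * (ker V z)\<^sup>2"

lemma testfun_holomorphic: "testfun V holomorphic_on A"
  unfolding testfun_def by (intro holomorphic_intros ker_holomorphic)

lemma testfun_imaginary:
  "testfun V (\<i> * of_real t) = of_real (((pi / V)\<^sup>2 * (1 + 1 / V) - t\<^sup>2) * (Re (ker V (\<i> * of_real t)))\<^sup>2)"
  unfolding testfun_def by (subst ker_imaginary) (simp add: power_mult_distrib)

lemma testfun_coefficient_bound:
  assumes V: "V \<ge> 2 * pi"
  shows "norm (of_real ((pi / V)\<^sup>2 * (1 + 1 / V)) + z\<^sup>2 :: complex) \<le> 1 / 2 + (norm z)\<^sup>2"
proof -
  have V1: "V \<ge> 1" using V pi_gt3 by linarith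
  have "pi / V \<le> 1 / 2" using V V1 by (simp add: field_simps)
  hence "(pi / V)\<^sup>2 \<le> 1 / 4" using V1 power_mono[of "pi / V" "1/2" 2] by (simp add: power2_eq_square)
  hence "(pi / V)\<^sup>2 * (1 + 1 / V) \<le> 1 / 4 * 2" using V1 by (intro mult_mono) auto
  moreover have "norm (of_real ((pi / V)\<^sup>2 * (1 + 1 / V)) :: complex) = (pi / V)\<^sup>2 * (1 + 1 / V)"
    using V1 by (simp only: norm_of_real) simp
  ultimately show ?thesis using norm_triangle_ineq[of "of_real ((pi / V)\<^sup>2 * (1 + 1 / V))" "z\<^sup>2"]
    unfolding norm_power by linarith
qed

text \<open>The square of \<open>ker\<close> decays like the inverse fourth power and the quadratic
  factor gives two powers back. Squaring also doubles the exponential type from \<open>V/2\<close>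
  to \<open>V\<close>, the logarithm of the cutoff for prime powers.\<close>

lemma norm_testfun_le':
  assumes V: "V \<ge> 2 * pi" and z: "Re z \<ge> 0" "norm z \<ge> 1"
  shows "norm (testfun V z) \<le> 4 * exp (V * Re z) / (norm z)\<^sup>2"
proof -
  have z2: "(norm z)\<^sup>2 \<ge> 1" using z by simp
  have up: "norm (of_real ((pi / V)\<^sup>2 * (1 + 1 / V)) + z\<^sup>2) \<le> 3 / 2 * (norm z)\<^sup>2"
    using testfun_coefficient_bound[OF V, of z] z2 by argo
  have k: "(norm (ker V z))\<^sup>2 \<le> (4 / 3 * exp (V / 2 * Re z) / (norm z)\<^sup>2)\<^sup>2"
    using norm_ker_le'[OF V z] by (intro power_mono) auto
  have "norm (testfun V z) \<le> 3 / 2 * (norm z)\<^sup>2 * (4 / 3 * exp (V / 2 * Re z) / (norm z)\<^sup>2)\<^sup>2"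
    unfolding testfun_def norm_mult norm_power by (intro mult_mono up k) auto
  also have "\<dots> = 3 / 2 * 16 / 9 * (exp (V / 2 * Re z))\<^sup>2 / (norm z)\<^sup>2"
    using z by (simp add: field_simps power2_eq_square)
  also have "(exp (V / 2 * Re z))\<^sup>2 = exp (V * Re z)" by (simp add: exp_double[symmetric])
  also have "3 / 2 * 16 / 9 * exp (V * Re z) / (norm z)\<^sup>2 \<le> 4 * exp (V * Re z) / (norm z)\<^sup>2"
    by (intro divide_right_mono mult_right_mono) auto
  finally show ?thesis .
qed

text \<open>Inside the unit disc the decay is replaced by \<open>norm_ker_le\<close>, whose square
  is the source of \<open>V ^ 4\<close>, and thus of four of the six powers of \<open>V\<close> in
  the prime sum.\<close>

lemma norm_testfun_le:
  assumes V: "V \<ge> 2 * pi" and z: "Re z \<ge> 0"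
  shows "norm (testfun V z) \<le> 16 * V ^ 4 * exp (V * Re z) / (1 + \<bar>Im z\<bar>)\<^sup>2"
proof -
  have V0: "V > 0" using V pi_gt_zero by linarith
  have V1: "V \<ge> 1" using V pi_gt3 by linarith
  have V4: "V ^ 4 \<ge> 1" using V1 by simp
  show ?thesis
  proof (cases "norm z \<ge> 1")
    case True
    have "norm z \<ge> \<bar>Im z\<bar>" by (rule abs_Im_le_cmod)
    hence "1 + \<bar>Im z\<bar> \<le> 2 * norm z" using True by linarith
    hence "(1 + \<bar>Im z\<bar>)\<^sup>2 \<le> (2 * norm z)\<^sup>2" by (intro power_mono) auto
    hence le: "(1 + \<bar>Im z\<bar>)\<^sup>2 \<le> 4 * (norm z)\<^sup>2" by (simp add: power_mult_distrib)
    have "norm (testfun V z) \<le> 4 * exp (V * Re z) / (norm z)\<^sup>2"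
      by (rule norm_testfun_le'[OF V z True])
    also have "\<dots> = 16 * 1 * exp (V * Re z) / (4 * (norm z)\<^sup>2)" by simp
    also have "\<dots> \<le> 16 * V ^ 4 * exp (V * Re z) / (1 + \<bar>Im z\<bar>)\<^sup>2"
      using V4 le by (intro frac_le mult_right_mono mult_left_mono) auto
    finally show ?thesis .
  next
    case False
    have "(norm z)\<^sup>2 \<le> 1" using False by (simp add: power_le_one)
    hence up: "norm (of_real ((pi / V)\<^sup>2 * (1 + 1 / V)) + z\<^sup>2) \<le> 2"
      using testfun_coefficient_bound[OF V, of z] by argo
    have "norm (ker V z) \<le> V\<^sup>2 / (2 * pi) * exp (V / 2 * Re z)"
      by (rule norm_ker_le[OF V0 z])
    also have "\<dots> \<le> V\<^sup>2 * exp (V / 2 * Re z)"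
    proof (rule mult_right_mono)
      have "V\<^sup>2 / (2 * pi) \<le> V\<^sup>2 / 1" using pi_gt3 by (intro divide_left_mono) auto
      thus "V\<^sup>2 / (2 * pi) \<le> V\<^sup>2" by simp
    qed simp
    finally have k: "(norm (ker V z))\<^sup>2 \<le> (V\<^sup>2 * exp (V / 2 * Re z))\<^sup>2"
      by (intro power_mono) auto
    have "norm (testfun V z) \<le> 2 * (V\<^sup>2 * exp (V / 2 * Re z))\<^sup>2"
      unfolding testfun_def norm_mult norm_power by (intro mult_mono up k) auto
    also have "\<dots> = 2 * V ^ 4 * exp (V * Re z)"
      by (simp add: power_mult_distrib exp_double[symmetric] power_mult[symmetric])
    also have "\<dots> = 16 * V ^ 4 * exp (V * Re z) / 8" by simp
    also have "\<dots> \<le> 16 * V ^ 4 * exp (V * Re z) / (1 + \<bar>Im z\<bar>)\<^sup>2"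
    proof (rule divide_left_mono)
      have "1 + \<bar>Im z\<bar> \<le> 2" using False abs_Im_le_cmod[of z] by linarith
      hence "(1 + \<bar>Im z\<bar>)\<^sup>2 \<le> 2\<^sup>2" by (intro power_mono) auto
      thus "(1 + \<bar>Im z\<bar>)\<^sup>2 \<le> 8" by simp
    qed auto
    finally show ?thesis .
  qed
qed

text \<open>By \<open>ker_eq\<close> the part without \<open>1/V\<close> is
  \<open>cosh (V z / 2)\<close> times \<open>ker\<close>. On the imaginary axis \<open>ker\<close>
  is real, and \<open>cosh (V z / 2)\<close> and \<open>exp (- V z / 2)\<close> have the same real
  part; with the latter the product is small to the right, so its integral is
  \<open>O(1 / Y)\<close>. What remains is \<open>a\<^sup>2 / V\<close> times the integral of
  \<open>\<kappa>\<^sup>2\<close>.\<close>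

lemma testfun_integral_lower_bound:
  assumes V: "V \<ge> 2 * pi" and Y: "Y \<ge> 1"
  shows "Re (vint 0 Y (testfun V)) \<ge> 1 / (2 * pi) - 6 / Y"
proof -
  have V0: "V > 0" using V pi_gt_zero by linarith
  define a where "a = pi / V"
  have a0: "a > 0" using V0 by (simp add: a_def)
  have a1: "a \<le> 1 / 2" using V V0 by (simp add: a_def field_simps)
  define \<kappa> where "\<kappa> t = Re (ker V (\<i> * of_real t))" for t
  define q where "q z = exp (- of_real (V / 2) * z) * ker V z" for z
  have C: "Complex 0 t = \<i> * of_real t" for t by (simp add: complex_eq_iff)
  have k: "ker V (Complex 0 t) = of_real (\<kappa> t)" for t
    using ker_imaginary[of V t] by (simp add: \<kappa>_def C)
  have contk: "continuous_on UNIV (ker V)" by (intro holomorphic_on_imp_continuous_on ker_holomorphic)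
  have cont\<kappa>: "continuous_on A \<kappa>" for A
    unfolding \<kappa>_def by (intro continuous_intros continuous_on_compose2[OF contk]) auto
  have pt: "Re (testfun V (Complex 0 t)) = Re (q (Complex 0 t)) + a\<^sup>2 / V * (\<kappa> t)\<^sup>2" for t
  proof -
    have "testfun V (Complex 0 t) = ((of_real (a\<^sup>2) + (Complex 0 t)\<^sup>2) * ker V (Complex 0 t)) * ker V (Complex 0 t)
       + of_real (a\<^sup>2 / V) * (ker V (Complex 0 t))\<^sup>2"
      unfolding testfun_def a_def[symmetric] by (simp add: algebra_simps power2_eq_square)
    also have "(of_real (a\<^sup>2) + (Complex 0 t)\<^sup>2) * ker V (Complex 0 t) = cosh (of_real (V / 2) * Complex 0 t)"
      unfolding a_def by (rule ker_eq[OF V0])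
    also have "Re (cosh (of_real (V / 2) * Complex 0 t) * ker V (Complex 0 t) + of_real (a\<^sup>2 / V) * (ker V (Complex 0 t))\<^sup>2)
       = Re (cosh (of_real (V / 2) * Complex 0 t)) * \<kappa> t + a\<^sup>2 / V * (\<kappa> t)\<^sup>2"
      unfolding k by (simp flip: of_real_power of_real_mult of_real_divide)
    also have "Re (cosh (of_real (V / 2) * Complex 0 t)) = Re (exp (- of_real (V / 2) * Complex 0 t))"
      by (simp add: cosh_field_def Re_exp)
    finally show ?thesis unfolding q_def k by simp
  qed
  have qh: "q holomorphic_on A" for A unfolding q_def by (intro holomorphic_intros ker_holomorphic)
  have qc: "continuous_on UNIV q" by (intro holomorphic_on_imp_continuous_on qh)
  have hc: "continuous_on UNIV (testfun V)" by (intro holomorphic_on_imp_continuous_on testfun_holomorphic)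
  have iq: "(\<lambda>t. q (Complex 0 t)) integrable_on {-Y..Y}" by (rule vint_integrable[OF qc]) auto
  have ih: "(\<lambda>t. testfun V (Complex 0 t)) integrable_on {-Y..Y}" by (rule vint_integrable[OF hc]) auto
  have ik: "(\<lambda>t. a\<^sup>2 / V * (\<kappa> t)\<^sup>2) integrable_on {c..d}" for c d
    by (intro integrable_continuous_real continuous_intros cont\<kappa>)
  have "Re (vint 0 Y (testfun V)) = integral {-Y..Y} (\<lambda>t. Re (testfun V (Complex 0 t)))"
    unfolding vint_def using integral_linear[OF ih bounded_linear_Re] by (simp add: o_def)
  also have "\<dots> = integral {-Y..Y} (\<lambda>t. Re (q (Complex 0 t))) + integral {-Y..Y} (\<lambda>t. a\<^sup>2 / V * (\<kappa> t)\<^sup>2)"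
    unfolding pt using integrable_linear[OF iq bounded_linear_Re] ik
    by (intro integral_add) (auto simp: o_def)
  also have "integral {-Y..Y} (\<lambda>t. Re (q (Complex 0 t))) = Re (vint 0 Y q)"
    unfolding vint_def using integral_linear[OF iq bounded_linear_Re] by (simp add: o_def)
  finally have eq: "Re (vint 0 Y (testfun V)) = Re (vint 0 Y q) + integral {-Y..Y} (\<lambda>t. a\<^sup>2 / V * (\<kappa> t)\<^sup>2)" .
  have "norm (vint 0 Y q) \<le> 4 * (4 / 3) / Y"
  proof (rule vint_right_box[OF qh, where d = "-1"])
    fix z assume z: "0 \<le> Re z" "Y \<le> norm z"
    have "norm (q z) = exp (- (V / 2 * Re z)) * norm (ker V z)" by (simp add: q_def norm_mult)
    also have "\<dots> \<le> exp (- (V / 2 * Re z)) * (4 / 3 * exp (V / 2 * Re z) / (norm z)\<^sup>2)"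
      using norm_ker_le'[OF V] z Y by (intro mult_left_mono) auto
    also have "\<dots> = 4 / 3 / (norm z)\<^sup>2" by (simp add: exp_minus field_simps)
    finally show "norm (q z) \<le> 4 / 3 / (norm z)\<^sup>2" .
  qed (use Y in auto)
  also have "\<dots> \<le> 6 / Y" using Y by (intro divide_right_mono) auto
  finally have q6: "Re (vint 0 Y q) \<ge> - 6 / Y" using abs_Re_le_cmod[of "vint 0 Y q"] by simp
  \<comment> \<open>Only \<open>\<bar>t\<bar> \<le> a/2\<close> is kept. There
    \<open>cos (V t / 2) \<ge> cos (pi / 4)\<close>, hence
    \<open>\<kappa> t \<ge> (sqrt 2 / 2) / a\<^sup>2\<close>; the length \<open>a\<close> of the
    interval and \<open>a V = pi\<close> give the constant.\<close>
  have "1 / (2 * pi) = integral {-a/2..a/2} (\<lambda>t. a\<^sup>2 / V * (1 / (2 * a ^ 4)))"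
  proof -
    have "integral {-a/2..a/2} (\<lambda>t. a\<^sup>2 / V * (1 / (2 * a ^ 4))) = (a/2 - (-a/2)) * (a\<^sup>2 / V * (1 / (2 * a ^ 4)))"
      using a0 by (simp only: integral_const_real measure_lborel_Icc) simp
    also have "\<dots> = 1 / (2 * (a * V))"
      using a0 V0 by (simp add: field_simps power2_eq_square power4_eq_xxxx)
    also have "a * V = pi" using V0 by (simp add: a_def)
    finally show ?thesis by simp
  qed
  also have "\<dots> \<le> integral {-a/2..a/2} (\<lambda>t. a\<^sup>2 / V * (\<kappa> t)\<^sup>2)"
  proof (rule integral_le[OF integrable_const_ivl ik])
    fix t assume "t \<in> {-a/2..a/2}"
    hence t: "\<bar>t\<bar> \<le> a / 2" by auto
    have c: "cos (V / 2 * t) \<ge> cos (pi / 4)"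
    proof -
      have "\<bar>V / 2 * t\<bar> \<le> pi / 4"
        using mult_left_mono[OF t, of "V / 2"] V0 by (simp add: a_def abs_mult field_simps)
      moreover have "cos \<bar>V / 2 * t\<bar> = cos (V / 2 * t)" by (rule cos_abs_real)
      ultimately show ?thesis using cos_monotone_0_pi_le[of "\<bar>V / 2 * t\<bar>" "pi / 4"] pi_gt_zero by auto
    qed
    have "t\<^sup>2 \<le> (a / 2)\<^sup>2" using t by (simp add: abs_le_square_iff[symmetric])
    hence t2: "t\<^sup>2 < a\<^sup>2" using a0 by (simp add: power_divide) (smt (verit) zero_less_power)
    have "(of_real (a\<^sup>2) + (Complex 0 t)\<^sup>2) * ker V (Complex 0 t) = cosh (of_real (V / 2) * Complex 0 t)"
      unfolding a_def by (rule ker_eq[OF V0])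
    hence "Re ((of_real (a\<^sup>2) + (Complex 0 t)\<^sup>2) * ker V (Complex 0 t)) = Re (cosh (of_real (V / 2) * Complex 0 t))"
      by simp
    hence kk: "(a\<^sup>2 - t\<^sup>2) * \<kappa> t = cos (V / 2 * t)"
      unfolding k by (simp add: cosh_field_def Re_exp Re_power2)
    have "sqrt 2 / 2 \<le> (a\<^sup>2 - t\<^sup>2) * \<kappa> t" using c by (simp add: kk cos_45)
    moreover have "\<kappa> t \<ge> 0"
    proof (rule ccontr)
      assume "\<not> \<kappa> t \<ge> 0"
      hence "(a\<^sup>2 - t\<^sup>2) * \<kappa> t \<le> 0" using t2 by (intro mult_nonneg_nonpos) auto
      moreover have "sqrt 2 / 2 > 0" by simp
      ultimately show False using \<open>sqrt 2 / 2 \<le> (a\<^sup>2 - t\<^sup>2) * \<kappa> t\<close> by linarith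
    qed
    moreover have "(a\<^sup>2 - t\<^sup>2) * \<kappa> t \<le> a\<^sup>2 * \<kappa> t" using \<open>\<kappa> t \<ge> 0\<close> by (intro mult_right_mono) auto
    ultimately have "sqrt 2 / 2 \<le> a\<^sup>2 * \<kappa> t" by linarith
    hence "(sqrt 2 / 2)\<^sup>2 \<le> (a\<^sup>2 * \<kappa> t)\<^sup>2" by (intro power_mono) auto
    hence "1 / 2 \<le> a ^ 4 * (\<kappa> t)\<^sup>2" by (simp add: power_mult_distrib power_divide power_mult[symmetric])
    hence "1 / (2 * a ^ 4) \<le> (\<kappa> t)\<^sup>2" using a0 by (simp add: field_simps)
    thus "a\<^sup>2 / V * (1 / (2 * a ^ 4)) \<le> a\<^sup>2 / V * (\<kappa> t)\<^sup>2" using V0 by (intro mult_left_mono) auto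
  qed
  also have "\<dots> \<le> integral {-Y..Y} (\<lambda>t. a\<^sup>2 / V * (\<kappa> t)\<^sup>2)"
    using a1 a0 Y V0 by (intro integral_subset_le ik) auto
  finally show ?thesis using eq q6 by linarith
qed

section \<open>Positivity of the logarithmic derivative\<close>

text \<open>The disc is centred on \<open>Re z = R\<close> at the height of \<open>w\<close>. Its
  radius \<open>R - a/2\<close> keeps it in the half-plane and keeps \<open>w\<close> at distance at
  least \<open>a/2\<close> from its boundary, so a bound on the line is carried to the left.\<close>

lemma halfplane_borel_caratheodory:
  assumes holo: "h holomorphic_on {z. Re z > 0}" and w: "0 < a" "a \<le> Re w" "Re w \<le> R"
    and bd: "\<And>z. 0 < Re z \<Longrightarrow> norm (z - Complex R (Im w)) < R \<Longrightarrow> Re (h z) < M"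
  shows "norm (h w) \<le> norm (h (Complex R (Im w))) + 4 * R / a * (M + norm (h (Complex R (Im w))))"
proof -
  define p where "p = Complex R (Im w)"
  define \<rho> where "\<rho> = R - a / 2"
  have sub: "0 < Re z \<and> norm (z - p) < R" if "z \<in> ball p \<rho>" for z
  proof -
    have n: "norm (z - p) < \<rho>" using that by (simp add: dist_norm norm_minus_commute)
    moreover have "\<bar>Re (z - p)\<bar> \<le> norm (z - p)" by (rule abs_Re_le_cmod)
    ultimately show ?thesis using w by (auto simp: \<rho>_def p_def)
  qed
  have bdp: "Re (h z) < M" if "z \<in> ball p \<rho>" for z
    using bd[of z] sub[OF that] by (simp add: p_def)
  have "w - p = of_real (Re w - R)" by (simp add: p_def complex_eq_iff)
  hence "norm (w - p) = \<bar>Re w - R\<bar>" by (simp only: norm_of_real)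
  hence wp: "norm (w - p) \<le> R - a" using w by simp
  have "norm (h w - h p) \<le> 2 * (R - a) / (\<rho> - (R - a)) * (M - Re (h p))"
  proof (rule borel_caratheodory[of h p \<rho> M])
    show "h holomorphic_on ball p \<rho>"
      by (rule holomorphic_on_subset[OF holo]) (use sub in auto)
  qed (use bdp wp w in \<open>auto simp: \<rho>_def\<close>)
  also have "\<dots> = 4 * (R - a) / a * (M - Re (h p))" using w by (simp add: \<rho>_def field_simps)
  also have "\<dots> \<le> 4 * R / a * (M + norm (h p))"
  proof (rule mult_mono)
    show "4 * (R - a) / a \<le> 4 * R / a" using w by (intro divide_right_mono) auto
    show "M - Re (h p) \<le> M + norm (h p)" using abs_Re_le_cmod[of "h p"] by linarith
    show "0 \<le> M - Re (h p)" using bdp[of p] w by (simp add: \<rho>_def)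
  qed (use w in auto)
  finally have "norm (h w - h p) \<le> 4 * R / a * (M + norm (h p))" .
  moreover have "norm (h w) \<le> norm (h p) + norm (h w - h p)"
    using norm_triangle_ineq[of "h p" "h w - h p"] by simp
  ultimately show ?thesis by (simp add: p_def)
qed

locale halfplane_nonvanishing =
  fixes f :: "complex \<Rightarrow> complex"
  assumes entire: "f holomorphic_on UNIV"
    and nonzero: "\<And>z. Re z > 0 \<Longrightarrow> f z \<noteq> 0"
begin

definition logd :: "complex \<Rightarrow> complex" where "logd z = deriv f z / f z"

lemma logd_holomorphic:
  assumes "\<And>z. z \<in> A \<Longrightarrow> f z \<noteq> 0"
  shows "logd holomorphic_on A"
proof -
  have "deriv f holomorphic_on UNIV" by (rule holomorphic_deriv[OF entire]) simp
  thus ?thesis unfolding logd_def using entire assms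
    by (intro holomorphic_on_divide holomorphic_on_subset[of _ UNIV A]) auto
qed

lemma logarithm:
  obtains l where "l holomorphic_on {z. Re z > 0}" "\<And>z. Re z > 0 \<Longrightarrow> f z = exp (l z)"
    "\<And>z. Re z > 0 \<Longrightarrow> (l has_field_derivative logd z) (at z)"
proof -
  have op: "open {z. Re z > 0}" by (simp add: open_halfspace_Re_gt)
  have "simply_connected {z. Re z > 0}"
    by (intro convex_imp_simply_connected convex_halfspace_Re_gt)
  moreover have "f holomorphic_on {z. Re z > 0}" using entire by (rule holomorphic_on_subset) simp
  ultimately obtain l where l: "l holomorphic_on {z. Re z > 0}" "\<And>z. Re z > 0 \<Longrightarrow> f z = exp (l z)"
    using simply_connected_eq_holomorphic_log[OF op] nonzero by auto
  have "(l has_field_derivative logd z) (at z)" if z: "Re z > 0" for z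
  proof -
    have d: "(l has_field_derivative deriv l z) (at z)"
      using l(1) op z by (auto intro: holomorphic_derivI)
    hence "((\<lambda>w. exp (l w)) has_field_derivative exp (l z) * deriv l z) (at z)"
      by (auto intro!: derivative_eq_intros)
    moreover have "(f has_field_derivative deriv f z) (at z)"
      using entire by (auto intro: holomorphic_derivI)
    hence "((\<lambda>w. exp (l w)) has_field_derivative deriv f z) (at z)"
      by (rule DERIV_cong_ev[THEN iffD1, rotated -1])
         (use l(2) eventually_nhds_in_open[OF op, of z] z in \<open>auto elim!: eventually_mono\<close>)
    ultimately have "deriv f z = exp (l z) * deriv l z" by (rule DERIV_unique[symmetric])
    hence "deriv l z = logd z" using z by (simp add: logd_def l(2))
    thus ?thesis using d by simp
  qed
  thus ?thesis using that l by blast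
qed

end

text \<open>The input of the Phragmen-Lindelof argument: \<open>sym\<close> is the functional
  equation seen as a reflection in the imaginary axis and serves the left edge of a strip, the two
  conditions beyond \<open>R0\<close> serve the right edge, and \<open>growth\<close> serves the
  interior.\<close>

locale symmetric_halfplane = halfplane_nonvanishing +
  fixes \<kappa> :: complex and C R0 :: real
  assumes sym: "\<And>z. f z = \<kappa> * cnj (f (- cnj z))" and norm_\<kappa>: "norm \<kappa> = 1"
    and C_nonneg: "0 \<le> C"
    and growth: "\<And>z. norm (f z) \<le> exp (C * (1 + (norm z)\<^sup>2))"
    and right_nonneg: "\<And>z. Re z \<ge> R0 \<Longrightarrow> Re (logd z) \<ge> 0"
    and right_bound: "\<And>c. c \<ge> R0 \<Longrightarrow> \<exists>M. \<forall>t. norm (logd (Complex c t)) \<le> M * (1 + \<bar>t\<bar>)"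
begin

text \<open>The reflection \<open>z \<mapsto> - cnj z\<close> fixes the imaginary axis. There the
  symmetry and its derivative read \<open>f = \<kappa> cnj f\<close> and
  \<open>f' = - \<kappa> cnj f'\<close>, so the quotient is purely imaginary.\<close>

lemma logd_imaginary:
  assumes "f (Complex 0 t) \<noteq> 0"
  shows "Re (logd (Complex 0 t)) = 0"
proof -
  define z where "z = Complex 0 t"
  have zz: "- cnj z = z" by (simp add: z_def complex_eq_iff)
  have "(f has_field_derivative deriv f z) (at (- cnj z))"
    unfolding zz using entire by (auto intro: holomorphic_derivI)
  hence "((\<lambda>w. f (- w)) has_field_derivative deriv f z * (-1)) (at (cnj z))"
    by (intro DERIV_chain2[of f _ uminus]) (auto intro!: derivative_eq_intros)
  from has_field_derivative_cnj_cnj[OF this]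
  have "((\<lambda>w. \<kappa> * cnj (f (- cnj w))) has_field_derivative \<kappa> * cnj (deriv f z * (-1))) (at z)"
    by (intro DERIV_cmult) (simp add: o_def)
  hence "(f has_field_derivative \<kappa> * cnj (deriv f z * (-1))) (at z)"
    by (subst (asm) sym[symmetric])
  moreover have "(f has_field_derivative deriv f z) (at z)"
    using entire by (auto intro: holomorphic_derivI)
  ultimately have d: "deriv f z = - (\<kappa> * cnj (deriv f z))" using DERIV_unique by fastforce
  have s: "f z = \<kappa> * cnj (f z)" using sym[of z] by (simp add: zz)
  have k: "\<kappa> \<noteq> 0" using norm_\<kappa> by auto
  have "logd z = - (\<kappa> * cnj (deriv f z)) / (\<kappa> * cnj (f z))"
    unfolding logd_def using d s by simp
  also have "\<dots> = - cnj (logd z)" using k by (simp add: logd_def)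
  finally have "Re (logd z) = Re (- cnj (logd z))" by (rule arg_cong)
  thus ?thesis by (simp add: z_def)
qed

text \<open>On \<open>Re z = R\<close> the bound for \<open>logd\<close> is integrated upwards from
  height 0. Borel-Caratheodory carries the result to the left, since \<open>growth\<close> bounds
  \<open>Re l = ln (norm f)\<close> from above.\<close>

lemma log_strip_bound:
  assumes l: "l holomorphic_on {z. Re z > 0}" "\<And>z. Re z > 0 \<Longrightarrow> f z = exp (l z)"
    "\<And>z. Re z > 0 \<Longrightarrow> (l has_field_derivative logd z) (at z)" 
    and R: "R \<ge> R0" "a > 0" "R \<ge> a"
  shows "\<exists>K. \<forall>w. a \<le> Re w \<and> Re w \<le> R \<longrightarrow> norm (l w) \<le> K * (1 + (Im w)\<^sup>2)"
proof -
  obtain M where M: "\<And>t. norm (logd (Complex R t)) \<le> M * (1 + \<bar>t\<bar>)" using right_bound R(1) by blast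
  have M0: "M \<ge> 0" using order_trans[OF norm_ge_zero M[of 0]] by simp
  define K1 where "K1 = norm (l (Complex R 0)) + 2 * M"
  have lp: "norm (l (Complex R t)) \<le> K1 * (1 + t\<^sup>2)" for t
  proof -
    have "norm (l (Complex R t) - l (Complex R 0)) \<le> (M * (1 + \<bar>t\<bar>)) * norm (Complex R t - Complex R 0)"
    proof (rule field_differentiable_bound)
      show "convex (closed_segment (Complex R 0) (Complex R t))" by (rule convex_closed_segment)
      fix z assume "z \<in> closed_segment (Complex R 0) (Complex R t)"
      then obtain u where u: "0 \<le> u" "u \<le> 1" "z = (1 - u) *\<^sub>R Complex R 0 + u *\<^sub>R Complex R t"
        by (auto simp: closed_segment_def)
      have z: "z = Complex R (u * t)" unfolding u(3) by (simp add: complex_eq_iff algebra_simps)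
      have ut: "\<bar>u * t\<bar> \<le> \<bar>t\<bar>" using u(1,2) by (simp add: abs_mult mult_left_le_one_le)
      show "(l has_field_derivative logd z) (at z within closed_segment (Complex R 0) (Complex R t))"
        using has_field_derivative_at_within[OF l(3)[of z]] R by (simp add: z)
      have "norm (logd z) \<le> M * (1 + \<bar>u * t\<bar>)" unfolding z by (rule M)
      also have "\<dots> \<le> M * (1 + \<bar>t\<bar>)" using ut M0 by (intro mult_left_mono) auto
      finally show "norm (logd z) \<le> M * (1 + \<bar>t\<bar>)" .
    qed auto
    also have "Complex R t - Complex R 0 = \<i> * of_real t" by (simp add: complex_eq_iff)
    also have "norm (\<i> * of_real t) = \<bar>t\<bar>" by (simp add: norm_mult)
    also have "(M * (1 + \<bar>t\<bar>)) * \<bar>t\<bar> \<le> M * (2 * (1 + t\<^sup>2))"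
    proof -
      have "0 \<le> (\<bar>t\<bar> - 1)\<^sup>2" by simp
      hence "(1 + \<bar>t\<bar>) * \<bar>t\<bar> \<le> 2 * (1 + t\<^sup>2)" by (simp add: power2_eq_square algebra_simps)
      thus ?thesis unfolding mult.assoc using M0 by (rule mult_left_mono)
    qed
    finally have "norm (l (Complex R t) - l (Complex R 0)) \<le> M * (2 * (1 + t\<^sup>2))" .
    moreover have "norm (l (Complex R t)) \<le> norm (l (Complex R 0)) + norm (l (Complex R t) - l (Complex R 0))"
      using norm_triangle_ineq[of "l (Complex R 0)" "l (Complex R t) - l (Complex R 0)"] by simp
    moreover have "norm (l (Complex R 0)) * 1 \<le> norm (l (Complex R 0)) * (1 + t\<^sup>2)"
      by (intro mult_left_mono) auto
    ultimately show ?thesis unfolding K1_def distrib_right by (simp only: mult_ac)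
  qed
  \<comment> \<open>On the disc \<open>(norm z)\<^sup>2 \<le> 2 (2 R)\<^sup>2 + 2 t\<^sup>2\<close>;
    the last 1 makes the bound for \<open>Re l\<close> strict.\<close>
  define K2 where "K2 = C * (1 + 2 * (2 * R)\<^sup>2 + 2) + 1"
  have K20: "K2 \<ge> 0" using C_nonneg by (simp add: K2_def)
  show ?thesis
  proof (intro exI allI impI, elim conjE)
    fix w assume w: "a \<le> Re w" "Re w \<le> R"
    define t where "t = Im w"
    have "norm (l w) \<le> norm (l (Complex R t)) + 4 * R / a * (K2 * (1 + t\<^sup>2) + norm (l (Complex R t)))"
      unfolding t_def
    proof (rule halfplane_borel_caratheodory[OF l(1) R(2) w])
      fix z assume z: "0 < Re z" "norm (z - Complex R (Im w)) < R"
      have "norm z \<le> norm (z - Complex R t) + norm (of_real R :: complex) + norm (\<i> * of_real t)"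
      proof -
        have "z = (z - Complex R t) + of_real R + \<i> * of_real t" by (simp add: complex_eq_iff)
        thus ?thesis by (metis norm_triangle_ineq norm_triangle_mono order_refl)
      qed
      hence "norm z \<le> 2 * R + \<bar>t\<bar>" using z R by (simp add: t_def norm_mult)
      hence "(norm z)\<^sup>2 \<le> (2 * R + \<bar>t\<bar>)\<^sup>2" by (intro power_mono) auto
      also have "\<dots> \<le> 2 * (2 * R)\<^sup>2 + 2 * t\<^sup>2"
        using zero_le_power2[of "2 * R - \<bar>t\<bar>"] by (simp add: power2_eq_square algebra_simps)
      finally have "C * (1 + (norm z)\<^sup>2) \<le> C * (1 + (2 * (2 * R)\<^sup>2 + 2 * t\<^sup>2))"
        using C_nonneg by (intro mult_left_mono) auto
      also have "\<dots> \<le> C * ((1 + 2 * (2 * R)\<^sup>2 + 2) * (1 + t\<^sup>2))"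
        using C_nonneg by (intro mult_left_mono) (auto simp: algebra_simps)
      also have "\<dots> < K2 * (1 + t\<^sup>2)"
      proof -
        have "K2 * (1 + t\<^sup>2) = C * ((1 + 2 * (2 * R)\<^sup>2 + 2) * (1 + t\<^sup>2)) + (1 + t\<^sup>2)"
          unfolding K2_def by (simp only: distrib_right mult.assoc mult_1)
        moreover have "0 < 1 + t\<^sup>2" using zero_le_power2[of t] by linarith
        ultimately show ?thesis by linarith
      qed
      finally have "C * (1 + (norm z)\<^sup>2) < K2 * (1 + t\<^sup>2)" .
      moreover have "exp (Re (l z)) \<le> exp (C * (1 + (norm z)\<^sup>2))"
        using growth[of z] l(2)[of z] z by simp
      ultimately show "Re (l z) < K2 * (1 + (Im w)\<^sup>2)" by (simp add: t_def)
    qed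
    also have "\<dots> \<le> K1 * (1 + t\<^sup>2) + 4 * R / a * (K2 * (1 + t\<^sup>2) + K1 * (1 + t\<^sup>2))"
      using lp[of t] R K20 by (intro add_mono mult_left_mono) auto
    also have "\<dots> = (K1 + 4 * R / a * (K2 + K1)) * (1 + (Im w)\<^sup>2)"
    proof -
      have "K1 * u + q * (K2 * u + K1 * u) = (K1 + q * (K2 + K1)) * u" for q u :: real by (simp add: algebra_simps)
      thus ?thesis unfolding t_def .
    qed
    finally show "norm (l w) \<le> (K1 + 4 * R / a * (K2 + K1)) * (1 + (Im w)\<^sup>2)" .
  qed
qed

text \<open>
  The multiplier \<open>exp (- \<epsilon> z ^ 4)\<close> of the Phragmen-Lindelof lemma beats a growth of \<open>exp (K (1 + t\<^sup>2))\<close>; the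
  lower bound for \<open>f (z + a)\<close> needed for this comes from Borel-Caratheodory applied to \<open>log f\<close>.
\<close>

lemma norm_shift_le:
  assumes a: "0 < a" "a < 1" and z0: "0 \<le> Re z0"
  shows "norm (f (z0 - of_real a)) \<le> norm (f (z0 + of_real a))"
proof -
  obtain l where l: "l holomorphic_on {z. Re z > 0}" "\<And>z. Re z > 0 \<Longrightarrow> f z = exp (l z)"
    "\<And>z. Re z > 0 \<Longrightarrow> (l has_field_derivative logd z) (at z)" by (metis logarithm)
  \<comment> \<open>The margin 2 exceeds \<open>a\<close>, so a shift by at most \<open>a\<close>
    from the right edge stays in the region beyond \<open>R0\<close>.\<close>
  define R where "R = max (max R0 0 + 2) (Re z0)"
  have R: "R \<ge> 2" "R \<ge> R0 + 2" "Re z0 \<le> R" by (auto simp: R_def)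
  define \<phi> where "\<phi> z = f (z - of_real a) / f (z + of_real a)" for z
  obtain K where K: "\<And>w. a \<le> Re w \<Longrightarrow> Re w \<le> R + 1 \<Longrightarrow> norm (l w) \<le> K * (1 + (Im w)\<^sup>2)"
    using log_strip_bound[OF l, of "R + 1" a] R a by auto
  have "norm (\<phi> z0) \<le> 1"
  proof (rule phragmen_lindelof_strip[where \<phi> = \<phi> and ?z0.0 = z0 and S = "{z. Re z > - a}" and R = R
        and K = "C * (1 + (R + 2)\<^sup>2 * 2 + 2) + K"])
    show "open {z. Re z > - a}" by (simp add: open_halfspace_Re_gt)
    show "{z. 0 \<le> Re z \<and> Re z \<le> R} \<subseteq> {z. Re z > - a}" using a by auto
    have comp: "(\<lambda>z. f (z + c)) holomorphic_on A" for c A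
      by (intro holomorphic_on_compose_gen[OF _ entire, unfolded o_def] holomorphic_intros) auto
    show "\<phi> holomorphic_on {z. Re z > - a}"
      unfolding \<phi>_def using comp[of "- of_real a"] comp[of "of_real a"] nonzero
      by (intro holomorphic_on_divide) auto
    \<comment> \<open>The symmetry exchanges \<open>z - a\<close> and \<open>z + a\<close>.\<close>
    show "norm (\<phi> z) \<le> 1" if "Re z = 0" for z
    proof -
      have "f (z + of_real a) = \<kappa> * cnj (f (- cnj (z + of_real a)))" by (rule sym)
      also have "- cnj (z + of_real a) = z - of_real a" using that by (simp add: complex_eq_iff)
      finally have "norm (f (z + of_real a)) = norm (f (z - of_real a))" by (simp add: norm_mult norm_\<kappa>)
      thus ?thesis by (simp add: \<phi>_def norm_divide)
    qed
    \<comment> \<open>From \<open>z - a\<close> to \<open>z + a\<close> the function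
      \<open>ln (norm f)\<close> increases, its derivative being \<open>Re logd\<close>.\<close>
    show "norm (\<phi> z) \<le> 1" if z: "Re z = R" for z
    proof -
      have "Re (l (z + of_real (- a))) \<le> Re (l (z + of_real a))"
      proof (rule DERIV_nonneg_imp_nondecreasing[of "- a" a "\<lambda>x. Re (l (z + of_real x))"])
        fix y assume y: "- a \<le> y" "y \<le> a"
        have "((\<lambda>w. l (z + w)) has_field_derivative logd (z + of_real y) * 1) (at (of_real y))"
          using y z a R by (intro DERIV_chain2[of l] l(3)) (auto intro!: derivative_eq_intros)
        from has_vector_derivative_real_field[OF this]
        have "((\<lambda>x. Re (l (z + of_real x))) has_real_derivative Re (logd (z + of_real y))) (at y)"
          by (auto simp: has_real_derivative_iff_has_vector_derivative intro!: bounded_linear.has_vector_derivative[OF bounded_linear_Re])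
        thus "\<exists>D. ((\<lambda>x. Re (l (z + of_real x))) has_real_derivative D) (at y) \<and> 0 \<le> D"
          using right_nonneg[of "z + of_real y"] y z a R by auto
      qed (use a in auto)
      hence "norm (f (z - of_real a)) \<le> norm (f (z + of_real a))"
        using z R a by (simp add: l(2))
      thus ?thesis using nonzero[of "z + of_real a"] z R a by (simp add: \<phi>_def norm_divide)
    qed
    show "norm (\<phi> z) \<le> exp ((C * (1 + (R + 2)\<^sup>2 * 2 + 2) + K) * (1 + (Im z)\<^sup>2))"
      if z: "0 \<le> Re z" "Re z \<le> R" for z
    proof -
      have "norm (f (z + of_real a)) = exp (Re (l (z + of_real a)))" using z a by (simp add: l(2))
      moreover have "- Re (l (z + of_real a)) \<le> K * (1 + (Im z)\<^sup>2)"
        using K[of "z + of_real a"] abs_Re_le_cmod[of "l (z + of_real a)"] z a by auto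
      ultimately have low: "norm (f (z + of_real a)) \<ge> exp (- (K * (1 + (Im z)\<^sup>2)))" by simp
      have "norm (z - of_real a) \<le> \<bar>Re (z - of_real a)\<bar> + \<bar>Im (z - of_real a)\<bar>" by (rule cmod_le)
      also have "\<dots> \<le> (R + 2) + \<bar>Im z\<bar>" using z a by auto
      finally have "(norm (z - of_real a))\<^sup>2 \<le> (R + 2 + \<bar>Im z\<bar>)\<^sup>2" by (intro power_mono) auto
      also have "\<dots> \<le> (R + 2)\<^sup>2 * 2 + 2 * (Im z)\<^sup>2"
        using zero_le_power2[of "R + 2 - \<bar>Im z\<bar>"] by (simp add: power2_eq_square algebra_simps)
      finally have "C * (1 + (norm (z - of_real a))\<^sup>2) \<le> C * (1 + ((R + 2)\<^sup>2 * 2 + 2 * (Im z)\<^sup>2))"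
        using C_nonneg by (intro mult_left_mono) auto
      also have "\<dots> \<le> C * ((1 + (R + 2)\<^sup>2 * 2 + 2) * (1 + (Im z)\<^sup>2))"
        using C_nonneg by (intro mult_left_mono) (auto simp: algebra_simps)
      finally have up: "norm (f (z - of_real a)) \<le> exp (C * ((1 + (R + 2)\<^sup>2 * 2 + 2) * (1 + (Im z)\<^sup>2)))"
        using growth[of "z - of_real a"] by (meson exp_le_cancel_iff order_trans)
      have "norm (\<phi> z) \<le> exp (C * ((1 + (R + 2)\<^sup>2 * 2 + 2) * (1 + (Im z)\<^sup>2))) / exp (- (K * (1 + (Im z)\<^sup>2)))"
        unfolding \<phi>_def norm_divide using up low by (intro frac_le) auto
      also have "\<dots> = exp ((C * (1 + (R + 2)\<^sup>2 * 2 + 2) + K) * (1 + (Im z)\<^sup>2))"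
        by (simp add: exp_diff[symmetric] algebra_simps)
      finally show ?thesis .
    qed
  qed (use z0 R in auto)
  thus ?thesis using nonzero[of "z0 + of_real a"] z0 a by (simp add: \<phi>_def norm_divide)
qed

text \<open>The symmetric difference \<open>D\<close> of \<open>ln (norm f)\<close> has derivative
  \<open>2 Re (logd z)\<close> at 0. Were this negative, \<open>D\<close> would be negative for
  small positive shifts, against \<open>norm_shift_le\<close>.\<close>

theorem logd_nonneg:
  assumes z: "Re z > 0"
  shows "Re (logd z) \<ge> 0"
proof (rule ccontr)
  assume neg: "\<not> Re (logd z) \<ge> 0"
  obtain l where l: "l holomorphic_on {z. Re z > 0}" "\<And>z. Re z > 0 \<Longrightarrow> f z = exp (l z)"
    "\<And>z. Re z > 0 \<Longrightarrow> (l has_field_derivative logd z) (at z)" by (metis logarithm)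
  define D where "D x = Re (l (z + of_real x)) - Re (l (z - of_real x))" for x
  have "((\<lambda>w. l (z + w) - l (z - w)) has_field_derivative (logd z * 1 - logd z * (-1))) (at (of_real 0))"
  proof (rule DERIV_diff)
    show "((\<lambda>w. l (z + w)) has_field_derivative logd z * 1) (at (of_real 0))"
      using z by (intro DERIV_chain2[of l]) (auto intro!: derivative_eq_intros l(3))
    show "((\<lambda>w. l (z - w)) has_field_derivative logd z * (-1)) (at (of_real 0))"
      using z by (intro DERIV_chain2[of l]) (auto intro!: derivative_eq_intros l(3))
  qed
  from has_vector_derivative_real_field[OF this]
  have "((\<lambda>x. Re (l (z + of_real x) - l (z - of_real x))) has_real_derivative Re (logd z * 1 - logd z * (-1))) (at 0)"
    unfolding has_real_derivative_iff_has_vector_derivative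
    by (intro bounded_linear.has_vector_derivative[OF bounded_linear_Re]) auto
  hence "(D has_real_derivative 2 * Re (logd z)) (at 0)"
    by (simp add: D_def[abs_def])
  from DERIV_neg_dec_right[OF this] neg
  obtain d where d: "d > 0" "\<And>h. h > 0 \<Longrightarrow> h < d \<Longrightarrow> D h < D 0" by auto
  define h where "h = min (d / 2) (min (1 / 2) (Re z / 2))"
  have h: "0 < h" "h < d" "h < 1" "h < Re z" using d z by (auto simp: h_def min_def)
  have "D h < 0" using d(2)[OF h(1,2)] by (simp add: D_def)
  moreover have "norm (f (z - of_real h)) \<le> norm (f (z + of_real h))"
    by (rule norm_shift_le) (use h z in auto)
  hence "Re (l (z - of_real h)) \<le> Re (l (z + of_real h))" using h z by (simp add: l(2))
  ultimately show False by (simp add: D_def)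
qed

text \<open>Borel-Caratheodory again, now using that \<open>- logd\<close> has nonpositive real part.\<close>

lemma logd_strip_bound:
  assumes x: "0 < x" and c: "c \<ge> R0" "c \<ge> x"
  shows "\<exists>K. \<forall>w. x \<le> Re w \<and> Re w \<le> c \<longrightarrow> norm (logd w) \<le> K * (1 + \<bar>Im w\<bar>)"
proof -
  obtain M where M: "\<And>t. norm (logd (Complex c t)) \<le> M * (1 + \<bar>t\<bar>)" using right_bound c by blast
  have hol: "(\<lambda>z. - logd z) holomorphic_on {z. Re z > 0}"
    using nonzero by (intro holomorphic_intros logd_holomorphic) auto
  show ?thesis
  proof (intro exI allI impI, elim conjE)
    fix w assume w: "x \<le> Re w" "Re w \<le> c"
    define t where "t = Im w"
    have "norm (- logd w) \<le> norm (- logd (Complex c (Im w))) + 4 * c / x * (1 + norm (- logd (Complex c (Im w))))"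
    proof (rule halfplane_borel_caratheodory[OF hol x w])
      fix z assume "0 < Re z"
      thus "Re (- logd z) < 1" using logd_nonneg[of z] by simp
    qed
    also have "\<dots> \<le> M * (1 + \<bar>t\<bar>) + 4 * c / x * ((1 + \<bar>t\<bar>) + M * (1 + \<bar>t\<bar>))"
      using M[of t] x c by (intro add_mono mult_left_mono) (auto simp: t_def)
    also have "\<dots> = (M + 4 * c / x * (1 + M)) * (1 + \<bar>t\<bar>)"
    proof -
      have "M * u + q * (u + M * u) = (M + q * (1 + M)) * u" for q u :: real by (simp add: algebra_simps)
      thus ?thesis .
    qed
    finally show "norm (logd w) \<le> (M + 4 * c / x * (1 + M)) * (1 + \<bar>Im w\<bar>)" by (simp add: t_def)
  qed
qed

end

section \<open>The Dirichlet series\<close>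

text \<open>The logarithmic derivative written without division, so that products add up without
  side conditions on zeros.\<close>

definition logderiv_at :: "(complex \<Rightarrow> complex) \<Rightarrow> complex \<Rightarrow> complex \<Rightarrow> bool" where
  "logderiv_at f s G \<longleftrightarrow> (f has_field_derivative f s * G) (at s)"

lemma logderiv_at_mult:
  "logderiv_at f s F \<Longrightarrow> logderiv_at g s G \<Longrightarrow> logderiv_at (\<lambda>z. f z * g z) s (F + G)"
  unfolding logderiv_at_def by (drule (1) DERIV_mult) (simp add: algebra_simps)

lemma logderiv_at_const: "logderiv_at (\<lambda>_. c) s 0"
  by (simp add: logderiv_at_def)

lemma logderiv_at_prod:
  assumes "\<And>i. i \<in> I \<Longrightarrow> logderiv_at (f i) s (F i)"
  shows "logderiv_at (\<lambda>z. \<Prod>i\<in>I. f i z) s (\<Sum>i\<in>I. F i)"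
  using assms by (induction I rule: infinite_finite_induct) (auto intro: logderiv_at_mult logderiv_at_const)

lemma logderiv_at_power:
  "logderiv_at f s F \<Longrightarrow> logderiv_at (\<lambda>z. f z ^ n) s (of_nat n * F)"
  using logderiv_at_prod[of "{..<n}" "\<lambda>_. f" s "\<lambda>_. F"] by simp

lemma logderiv_at_exp:
  "(h has_field_derivative H) (at s) \<Longrightarrow> logderiv_at (\<lambda>z. exp (h z)) s H"
  unfolding logderiv_at_def by (auto intro!: derivative_eq_intros)

lemma logderiv_at_cong:
  assumes "logderiv_at f s F" "eventually (\<lambda>z. g z = f z) (nhds s)" 
  shows "logderiv_at g s F"
proof -
  have "(g has_field_derivative f s * F) (at s)"
    using assms DERIV_cong_ev[OF refl _ refl, of g f s "f s * F"] by (simp add: logderiv_at_def)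
  moreover have "g s = f s" using assms(2) by (rule eventually_nhds_x_imp_x)
  ultimately show ?thesis by (simp add: logderiv_at_def)
qed

lemma logderiv_at_Gamma_R:
  assumes "Re (s + \<mu>) > 0"
  shows "logderiv_at (\<lambda>z. Gamma_R (z + \<mu>)) s (- of_real (ln pi / 2) + Digamma ((s + \<mu>) / 2) / 2)"
  unfolding Gamma_R_def
proof (rule logderiv_at_mult)
  have "((\<lambda>z. (- (z + \<mu>) / 2) * of_real (ln pi)) has_field_derivative (- of_real (ln pi / 2))) (at s)"
    by (auto intro!: derivative_eq_intros)
  from logderiv_at_exp[OF this]
  show "logderiv_at (\<lambda>z. of_real pi powr (- (z + \<mu>) / 2)) s (- of_real (ln pi / 2))"
    by (simp add: powr_def Ln_of_real)
  have "(s + \<mu>) / 2 \<notin> \<int>\<^sub>\<le>\<^sub>0"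
    using assms by (auto elim!: nonpos_Ints_cases simp: complex_eq_iff)
  thus "logderiv_at (\<lambda>z. Gamma ((z + \<mu>) / 2)) s (Digamma ((s + \<mu>) / 2) / 2)"
    unfolding logderiv_at_def by (auto intro!: derivative_eq_intros)
qed

lemma summable_inverse_square: "summable (\<lambda>n. 1 / (real n)\<^sup>2)"
  by (rule inverse_power_summable[of 2, unfolded inverse_eq_divide]) simp

locale L_fun =
  fixes \<theta> :: real and L :: lfun
  assumes L_function: "L_function \<theta> L" and GRH: "GRH L"
begin

abbreviation "m \<equiv> deg_L L"
abbreviation "\<mu> \<equiv> spectral L"
abbreviation "N \<equiv> conductor L"

lemma m_pos: "m \<ge> 1" and N_pos: "N \<ge> 1" and theta: "0 \<le> \<theta>" "\<theta> \<le> 1"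
  and root_bound: "prime p \<Longrightarrow> j \<in> {1..m} \<Longrightarrow> norm (local_root L j p) \<le> real p powr \<theta>"
  and Re_spectral: "j \<in> {1..m} \<Longrightarrow> Re (\<mu> j) > - 1"
  using L_function by (auto simp: L_function_def)

lemma euler_product: "Re s > 1 \<Longrightarrow> (\<lambda>p. if prime p then euler_factor L p s else 1) has_prod L_series L s"
  using L_function by (auto simp: L_function_def)

definition euler_root :: "nat \<Rightarrow> nat \<Rightarrow> complex \<Rightarrow> complex" where
  "euler_root p j s = local_root L j p / of_nat p powr s"

lemma norm_euler_root_le:
  assumes "prime p" "j \<in> {1..m}"
  shows "norm (euler_root p j s) \<le> real p powr (\<theta> - Re s)"
proof -
  have "p > 0" using assms(1) prime_gt_0_nat by blast
  hence "norm (of_nat p powr s) = real p powr Re s"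
    using norm_powr_real_powr[of "of_nat p" s] by simp
  thus ?thesis using root_bound[OF assms] \<open>p > 0\<close>
    by (simp add: euler_root_def norm_divide powr_diff divide_right_mono)
qed

text \<open>As \<open>\<theta> \<le> 1\<close>, the abscissa 4 leaves three powers of
  \<open>p\<close>: one pays for \<open>ln p\<close>, and two make the sum over all integers
  converge.\<close>

lemma norm_euler_root_le_cube:
  assumes "prime p" "j \<in> {1..m}" "Re s \<ge> 4"
  shows "norm (euler_root p j s) \<le> 1 / real p ^ 3"
proof -
  have p: "p \<ge> 2" using assms(1) prime_ge_2_nat by blast
  have "norm (euler_root p j s) \<le> real p powr (\<theta> - Re s)" by (rule norm_euler_root_le) fact+
  also have "\<dots> \<le> real p powr (- 3)" using p theta assms by (intro powr_mono) auto
  also have "\<dots> = 1 / real p ^ 3" using p by (simp add: powr_minus powr_numeral divide_inverse)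
  finally show ?thesis .
qed

lemma norm_euler_root_le_eighth:
  assumes "prime p" "j \<in> {1..m}" "Re s \<ge> 4"
  shows "norm (euler_root p j s) \<le> 1 / 8"
proof -
  have p: "real p \<ge> 2" using assms(1) prime_ge_2_nat by auto
  have "2 ^ 3 \<le> real p ^ 3" using p by (intro power_mono) auto
  hence "1 / real p ^ 3 \<le> 1 / 8" using p by (intro divide_left_mono) auto
  thus ?thesis using norm_euler_root_le_cube[OF assms] by linarith
qed

text \<open>The principal branch is safe for \<open>Re s \<ge> 4\<close>, where the Euler roots have
  norm at most 1/8. Non-primes get 0 so that the series runs over all of \<open>nat\<close>.\<close>

definition log_factor :: "nat \<Rightarrow> complex \<Rightarrow> complex" where
  "log_factor p s = (if prime p then \<Sum>j=1..m. - Ln (1 - euler_root p j s) else 0)"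

definition prime_logd :: "nat \<Rightarrow> complex \<Rightarrow> complex" where
  "prime_logd p s = (if prime p then - of_real (ln (real p)) * (\<Sum>j=1..m. euler_root p j s / (1 - euler_root p j s)) else 0)"

definition L_logd :: "complex \<Rightarrow> complex" where "L_logd s = (\<Sum>p. prime_logd p s)"

lemma log_factor_deriv:
  assumes s: "Re s > 4"
  shows "(log_factor p has_field_derivative prime_logd p s) (at s)"
proof (cases "prime p")
  case True
  hence p: "p > 0" using prime_gt_0_nat by blast
  have dx: "(euler_root p j has_field_derivative - of_real (ln (real p)) * euler_root p j s) (at s)" for j
  proof -
    have e: "euler_root p j = (\<lambda>z. local_root L j p * exp (- z * of_real (ln (real p))))"
      using p by (auto simp: euler_root_def powr_def fun_eq_iff exp_minus divide_inverse Ln_of_nat)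
    show ?thesis unfolding e by (auto intro!: derivative_eq_intros)
  qed
  have nz: "1 - euler_root p j s \<notin> \<real>\<^sub>\<le>\<^sub>0" if "j \<in> {1..m}" for j
  proof -
    have "Re (euler_root p j s) \<le> 1 / 8" 
      using norm_euler_root_le_eighth[OF True that, of s] s complex_Re_le_cmod[of "euler_root p j s"] by linarith
    thus ?thesis by (auto simp: complex_nonpos_Reals_iff)
  qed
  have "((\<lambda>s. - Ln (1 - euler_root p j s)) has_field_derivative
       - (inverse (1 - euler_root p j s) * (0 - - of_real (ln (real p)) * euler_root p j s))) (at s)" if "j \<in> {1..m}" for j
    by (intro DERIV_minus DERIV_chain2[where f = Ln and g = "\<lambda>s. 1 - euler_root p j s"] has_field_derivative_Ln nz[OF that] DERIV_diff DERIV_const dx)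
  hence "((\<lambda>s. \<Sum>j=1..m. - Ln (1 - euler_root p j s)) has_field_derivative
       (\<Sum>j=1..m. - (inverse (1 - euler_root p j s) * (0 - - of_real (ln (real p)) * euler_root p j s)))) (at s)"
    by (intro DERIV_sum) auto
  moreover have "(\<Sum>j=1..m. - (inverse (1 - euler_root p j s) * (0 - - of_real (ln (real p)) * euler_root p j s))) = prime_logd p s"
    using True by (simp add: prime_logd_def sum_distrib_left sum_negf divide_inverse mult_ac)
  moreover have "log_factor p = (\<lambda>s. \<Sum>j=1..m. - Ln (1 - euler_root p j s))" using True by (auto simp: log_factor_def fun_eq_iff)
  ultimately show ?thesis by simp
next
  case False
  thus ?thesis by (simp add: log_factor_def[abs_def] prime_logd_def)
qed

lemma norm_log_factor_le:
  assumes "Re s \<ge> 4"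
  shows "norm (log_factor p s) \<le> 2 * real m * (1 / (real p)\<^sup>2)"
proof (cases "prime p")
  case True
  hence p: "real p \<ge> 2" using prime_ge_2_nat by auto
  have "norm (log_factor p s) \<le> (\<Sum>j=1..m. 2 * (1 / (real p)\<^sup>2))"
    unfolding log_factor_def using True
  proof (simp only: if_True, intro sum_norm_le)
    fix j assume j: "j \<in> {1..m}"
    have "norm (Ln (1 + - euler_root p j s)) \<le> 2 * norm (- euler_root p j s)"
      using norm_euler_root_le_eighth[OF True j assms] by (intro norm_Ln_le) auto
    also have "\<dots> \<le> 2 * (1 / real p ^ 3)" using norm_euler_root_le_cube[OF True j assms] by simp
    also have "\<dots> \<le> 2 * (1 / (real p)\<^sup>2)"
      using p by (intro mult_left_mono divide_left_mono power_increasing) auto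
    finally show "norm (- Ln (1 - euler_root p j s)) \<le> 2 * (1 / (real p)\<^sup>2)" by simp
  qed
  thus ?thesis by (simp add: mult.commute)
qed (simp add: log_factor_def)

lemma norm_prime_logd_le:
  assumes "Re s \<ge> 4"
  shows "norm (prime_logd p s) \<le> 2 * real m * (1 / (real p)\<^sup>2)"
proof (cases "prime p")
  case True
  hence p: "real p \<ge> 2" using prime_ge_2_nat by auto
  have "norm (\<Sum>j=1..m. euler_root p j s / (1 - euler_root p j s)) \<le> (\<Sum>j=1..m. 2 * (1 / real p ^ 3))"
  proof (rule sum_norm_le)
    fix j assume j: "j \<in> {1..m}"
    have "norm (1 - euler_root p j s) \<ge> 1 / 2"
      using norm_euler_root_le_eighth[OF True j assms] norm_triangle_ineq2[of 1 "euler_root p j s"] by simp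
    hence "norm (euler_root p j s) / norm (1 - euler_root p j s) \<le> (1 / real p ^ 3) / (1 / 2)"
      using norm_euler_root_le_cube[OF True j assms] by (intro frac_le) auto
    thus "norm (euler_root p j s / (1 - euler_root p j s)) \<le> 2 * (1 / real p ^ 3)" by (simp add: norm_divide)
  qed
  hence a: "norm (\<Sum>j=1..m. euler_root p j s / (1 - euler_root p j s)) \<le> real m * (2 * (1 / real p ^ 3))" by simp
  have b: "\<bar>ln (real p)\<bar> \<le> real p" using p ln_bound[of "real p"] by simp
  have "norm (prime_logd p s) = \<bar>ln (real p)\<bar> * norm (\<Sum>j=1..m. euler_root p j s / (1 - euler_root p j s))"
    using True by (simp add: prime_logd_def norm_mult)
  also have "\<dots> \<le> real p * (real m * (2 * (1 / real p ^ 3)))"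
    by (intro mult_mono a b) auto
  also have "\<dots> = 2 * real m * (1 / (real p)\<^sup>2)" using p by (simp add: power2_eq_square power3_eq_cube)
  finally show ?thesis .
qed (simp add: prime_logd_def)

lemma summable_prime_logd_bound: "summable (\<lambda>p. 2 * real m * (1 / (real p)\<^sup>2))"
  by (intro summable_mult summable_inverse_square)

lemma norm_L_logd_tail:
  assumes "Re s \<ge> 4"
  shows "norm (L_logd s - (\<Sum>p<M. prime_logd p s)) \<le> (\<Sum>p. 2 * real m * (1 / (real (p + M))\<^sup>2))"
proof -
  have sm: "summable (\<lambda>p. norm (prime_logd p s))"
    by (rule summable_comparison_test'[OF summable_prime_logd_bound]) (use norm_prime_logd_le[OF assms] in auto)
  have "L_logd s = (\<Sum>p. prime_logd (p + M) s) + (\<Sum>p<M. prime_logd p s)"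
    unfolding L_logd_def by (rule suminf_split_initial_segment[OF summable_norm_cancel[OF sm]])
  hence "norm (L_logd s - (\<Sum>p<M. prime_logd p s)) = norm (\<Sum>p. prime_logd (p + M) s)" by simp
  also have "\<dots> \<le> (\<Sum>p. norm (prime_logd (p + M) s))"
    using sm by (intro summable_norm) (simp add: summable_iff_shift[of "\<lambda>p. norm (prime_logd p s)"])
  also have "\<dots> \<le> (\<Sum>p. 2 * real m * (1 / (real (p + M))\<^sup>2))"
    using sm summable_prime_logd_bound norm_prime_logd_le[OF assms]
    by (intro suminf_le) (simp_all only: summable_iff_shift[of "\<lambda>p. norm (prime_logd p s)"] summable_iff_shift[of "\<lambda>p. 2 * real m * (1 / (real p)\<^sup>2)"])
  finally show ?thesis .
qed

lemma norm_L_logd_le: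
  assumes "Re s \<ge> 4"
  shows "norm (L_logd s) \<le> 2 * real m * (\<Sum>p. 1 / (real p)\<^sup>2)"
  using norm_L_logd_tail[OF assms, of 0] suminf_mult[OF summable_inverse_square, of "2 * real m"] by simp

text \<open>The series of \<open>log_factor\<close> is differentiated termwise under a majorant
  independent of \<open>s\<close>. The exponential of its sum \<open>q\<close> is the limit of the
  partial Euler products, so \<open>L_series L = exp q\<close>.\<close>

lemma L_series_logderiv:
  assumes s: "Re s > 4"
  shows "L_series L s \<noteq> 0" "logderiv_at (L_series L) s (L_logd s)"
proof -
  define S where "S = {s. Re s > 4}"
  have op: "open S" by (simp add: S_def open_halfspace_Re_gt)
  obtain q q' where q: "\<And>s. s \<in> S \<Longrightarrow> (\<lambda>n. log_factor n s) sums q s" "\<And>s. s \<in> S \<Longrightarrow> (\<lambda>n. prime_logd n s) sums q' s"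
     "\<And>s. s \<in> S \<Longrightarrow> (q has_field_derivative q' s) (at s)"
  proof -
    have "\<exists>d (h :: nat \<Rightarrow> complex). 0 < d \<and> summable h \<and> range h \<subseteq> \<real>\<^sub>\<ge>\<^sub>0 \<and> (\<forall>\<^sub>F n in sequentially. \<forall>y\<in>ball s d \<inter> S. norm (log_factor n y) \<le> norm (h n))" for s
    proof (rule exI[of _ 1], rule exI[of _ "\<lambda>p. complex_of_real (2 * real m * (1 / (real p)\<^sup>2))"], intro conjI)
      show "0 < (1 :: real)" by simp
      show "summable (\<lambda>p. complex_of_real (2 * real m * (1 / (real p)\<^sup>2)))"
        using summable_prime_logd_bound by (rule summable_of_real)
      show "\<forall>\<^sub>F n in sequentially. \<forall>y\<in>ball s 1 \<inter> S. norm (log_factor n y) \<le> norm (complex_of_real (2 * real m * (1 / (real n)\<^sup>2)))"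
      proof (intro always_eventually allI ballI)
        fix n y assume "y \<in> ball s 1 \<inter> S"
        hence "norm (log_factor n y) \<le> 2 * real m * (1 / (real n)\<^sup>2)" by (intro norm_log_factor_le) (simp add: S_def)
        thus "norm (log_factor n y) \<le> norm (complex_of_real (2 * real m * (1 / (real n)\<^sup>2)))"
          unfolding norm_of_real by linarith
      qed
    qed (auto simp: nonneg_Reals_of_real_iff simp del: of_real_mult of_real_divide)
    from series_and_derivative_comparison_complex[OF op, of log_factor prime_logd, OF log_factor_deriv this]
    show ?thesis using that by (auto simp: S_def)
  qed
  have qD: "q' s = L_logd s" if "s \<in> S" for s using q(2)[OF that] by (simp add: L_logd_def sums_iff)
  have L: "L_series L s = exp (q s)" if "s \<in> S" for s
  proof (rule LIMSEQ_unique)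
    show "(\<lambda>n. \<Prod>p<n. if prime p then euler_factor L p s else 1) \<longlonglongrightarrow> L_series L s"
      using that by (intro has_prod_imp_tendsto' euler_product) (simp add: S_def)
    have "(\<lambda>n. exp (\<Sum>p<n. log_factor p s)) \<longlonglongrightarrow> exp (q s)"
      using q(1)[OF that] by (intro tendsto_exp) (simp add: sums_def)
    moreover have "exp (log_factor p s) = (if prime p then euler_factor L p s else 1)" for p
    proof (cases "prime p")
      case True
      have "1 - euler_root p j s \<noteq> 0" if "j \<in> {1..m}" for j
        using norm_euler_root_le_eighth[OF True that, of s] \<open>s \<in> S\<close> by (auto simp: S_def)
      hence "exp (- Ln (1 - euler_root p j s)) = inverse (1 - euler_root p j s)" if "j \<in> {1..m}" for j
        using that by (simp add: exp_minus)
      hence "(\<Prod>j=1..m. exp (- Ln (1 - euler_root p j s))) = (\<Prod>j=1..m. inverse (1 - euler_root p j s))"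
        by (intro prod.cong) auto
      thus ?thesis using True by (simp add: log_factor_def euler_factor_def exp_sum euler_root_def)
    qed (simp add: log_factor_def)
    ultimately show "(\<lambda>n. \<Prod>p<n. if prime p then euler_factor L p s else 1) \<longlonglongrightarrow> exp (q s)"
      by (simp add: exp_sum)
  qed
  show "L_series L s \<noteq> 0" using L[of s] s by (simp add: S_def)
  have sS: "s \<in> S" using s by (simp add: S_def)
  have "logderiv_at (\<lambda>z. exp (q z)) s (q' s)" by (intro logderiv_at_exp q(3) sS)
  hence "logderiv_at (L_series L) s (q' s)"
    by (rule logderiv_at_cong) (use eventually_nhds_in_open[OF op sS] L in \<open>auto elim: eventually_mono\<close>)
  thus "logderiv_at (L_series L) s (L_logd s)" by (simp add: qD[OF sS])
qed

end

section \<open>The completed function\<close>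

text \<open>Fixed once, outside the locale of L-functions, so that everything built from it is an
  absolute constant.\<close>

definition digamma_bound :: real where
  "digamma_bound = (SOME C. C \<ge> 0 \<and> (\<forall>w::complex. Re w \<ge> 1/2 \<longrightarrow> norm (Digamma w - Ln w) \<le> C))"

lemma digamma_bound_nonneg: "digamma_bound \<ge> 0"
  and norm_Digamma_Ln_le: "Re w \<ge> 1/2 \<Longrightarrow> norm (Digamma w - Ln w) \<le> digamma_bound"
proof -
  have "\<exists>C. C \<ge> 0 \<and> (\<forall>w::complex. Re w \<ge> 1/2 \<longrightarrow> norm (Digamma w - Ln w) \<le> C)"
    by (metis Digamma_Ln_bound)
  from someI_ex[OF this] show "digamma_bound \<ge> 0" "Re w \<ge> 1/2 \<Longrightarrow> norm (Digamma w - Ln w) \<le> digamma_bound"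
    by (auto simp: digamma_bound_def)
qed

lemma Re_Digamma_bounds:
  assumes "Re w \<ge> 1/2"
  shows "\<bar>Re (Digamma w) - ln (norm w)\<bar> \<le> digamma_bound"
proof -
  have "w \<noteq> 0" using assms by auto
  hence "Re (Digamma w) - ln (norm w) = Re (Digamma w - Ln w)" by simp
  thus ?thesis using norm_Digamma_Ln_le[OF assms] abs_Re_le_cmod[of "Digamma w - Ln w"] by linarith
qed

lemma norm_Digamma_le:
  assumes "Re w \<ge> 1/2"
  shows "norm (Digamma w) \<le> digamma_bound + norm w + 6"
proof -
  have w0: "w \<noteq> 0" using assms by auto
  have w: "norm w \<ge> 1/2" using assms complex_Re_le_cmod[of w] by linarith
  have "norm (Ln w) \<le> \<bar>Re (Ln w)\<bar> + \<bar>Im (Ln w)\<bar>" by (rule cmod_le)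
  moreover have "\<bar>Im (Ln w)\<bar> \<le> 4"
    using Im_Ln_le_pi[OF w0] mpi_less_Im_Ln[OF w0] pi_less_4 by linarith
  moreover have "\<bar>Re (Ln w)\<bar> \<le> norm w + 2"
  proof -
    have "ln (norm w) \<le> norm w" using w by (intro ln_bound) auto
    moreover have "ln (inverse (norm w)) \<le> inverse (norm w)" using w by (intro ln_bound) auto
    moreover have "inverse (norm w) \<le> 2" using w le_imp_inverse_le[of "1/2" "norm w"] by simp
    moreover have "ln (inverse (norm w)) = - ln (norm w)" using w by (simp add: ln_inverse)
    ultimately show ?thesis using w w0 by (simp add: abs_le_iff)
  qed
  moreover have "norm (Digamma w) \<le> norm (Digamma w - Ln w) + norm (Ln w)"
    using norm_triangle_ineq[of "Digamma w - Ln w" "Ln w"] by simp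
  ultimately show ?thesis using norm_Digamma_Ln_le[OF assms] by linarith
qed

lemma ln_le_sqrt: "ln (1 + \<bar>t\<bar>) \<le> 2 * (1 + \<bar>t\<bar>) powr (1/2)" for t :: real
proof -
  have "ln ((1 + \<bar>t\<bar>) powr (1/2)) \<le> (1 + \<bar>t\<bar>) powr (1/2)" by (rule ln_bound) auto
  thus ?thesis by (simp add: ln_powr)
qed

lemma pole_factorisation:
  fixes f :: "complex \<Rightarrow> complex"
  assumes "f holomorphic_on - {0,1}" "is_pole f 1"
  obtains r where "zor_poly f 1 1 \<noteq> 0" "r > 0" "zor_poly f 1 holomorphic_on cball 1 r"
    "\<And>w. w \<in> cball 1 r \<Longrightarrow> w \<noteq> 1 \<Longrightarrow> f w  = zor_poly f 1 w / (w-1) ^ nat (- zorder f 1)"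
proof -
  have "f holomorphic_on - {0} - {1}" using assms(1) by (rule holomorphic_on_subset) auto
  from zorder_exist_pole[OF this _ _ assms(2)] show ?thesis by (auto intro: that)
qed

context L_fun
begin

abbreviation "\<Lambda> \<equiv> completed L"

lemma nicely: "\<Lambda> nicely_meromorphic_on UNIV"
  using L_function unfolding L_function_def by (elim conjE)

lemma norm_root_number: "norm (root_number L) = 1"
  using L_function unfolding L_function_def by (elim conjE)

lemma growth_1: "growth_order \<Lambda> = 1"
  using L_function unfolding L_function_def by (elim conjE)

lemma completed_eq:
  assumes "Re s > 1"
  shows "\<Lambda> s = L_infinity L s * L_series L s"
proof -
  have "\<forall>s. Re s > 1 \<longrightarrow> \<Lambda> s = L_infinity L s * L_series L s"
    using L_function unfolding L_function_def by (elim conjE)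
  thus ?thesis using assms by blast
qed

lemma pole:
  assumes "is_pole \<Lambda> z"
  shows "z \<in> {0, 1}" "zorder \<Lambda> z \<ge> - int m"
proof -
  have "\<forall>z. is_pole \<Lambda> z \<longrightarrow> z \<in> {0, 1} \<and> zorder \<Lambda> z \<ge> - int m"
    using L_function unfolding L_function_def by (elim conjE)
  thus "z \<in> {0, 1}" "zorder \<Lambda> z \<ge> - int m" using assms by blast+
qed

lemma functional_equation:
  assumes "s \<notin> {0, 1}"
  shows "\<Lambda> s = root_number L * cnj (\<Lambda> (1 - cnj s))"
proof -
  have "\<forall>s. s \<notin> {0, 1} \<longrightarrow> \<Lambda> s = root_number L * dual_completed L (1 - s)"
    using L_function unfolding L_function_def by (elim conjE)
  hence "\<Lambda> s = root_number L * dual_completed L (1 - s)" using assms by blast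
  thus ?thesis by (simp add: dual_completed_def)
qed

lemma zero_line: "isolated_zero \<Lambda> s \<Longrightarrow> Re s = 1/2"
  using GRH unfolding GRH_def by blast

lemma analytic:
  assumes "s \<notin> {0, 1}"
  shows "\<Lambda> analytic_on {s}"
proof (rule nicely_meromorphic_on_imp_analytic_at[OF nicely UNIV_I])
  show "\<not> is_pole \<Lambda> s" using pole(1) assms by blast
qed

lemma holomorphic: "\<Lambda> holomorphic_on - {0, 1}"
proof -
  have "\<Lambda> analytic_on - {0, 1}"
    unfolding analytic_on_analytic_at[of _ "- {0, 1}"] using analytic by auto
  thus ?thesis by (rule analytic_imp_holomorphic)
qed

lemma L_infinity_nonzero:
  assumes "Re s > 1"
  shows "L_infinity L s \<noteq> 0"
proof -
  have "Gamma_R (s + \<mu> j) \<noteq> 0" if "j \<in> {1..m}" for j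
  proof -
    have "Re (s + \<mu> j) > 0" using Re_spectral[OF that] assms by simp
    hence "(s + \<mu> j) / 2 \<notin> \<int>\<^sub>\<le>\<^sub>0" by (auto elim!: nonpos_Ints_cases simp: complex_eq_iff)
    thus ?thesis by (simp add: Gamma_R_def Gamma_eq_zero_iff)
  qed
  thus ?thesis using N_pos by (simp add: L_infinity_def)
qed

text \<open>Zeros accumulating at \<open>z\<close> would force \<open>\<Lambda>\<close> to vanish
  identically; but both factors are nonzero at 5, a point with \<open>Re s > 4\<close> as
  \<open>L_series_logderiv\<close> requires.\<close>

lemma eventually_nonzero: "eventually (\<lambda>s. \<Lambda> s \<noteq> 0) (at z)"
proof (rule ccontr)
  assume "\<not> ?thesis"
  hence "frequently (\<lambda>s. \<Lambda> s = 0) (at z)" by (simp add: frequently_def)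
  from frequently_eq_meromorphic_imp_constant[OF this nicely open_UNIV connected_UNIV UNIV_I UNIV_I]
  have "\<Lambda> 5 = 0" .
  moreover have "\<Lambda> 5 = L_infinity L 5 * L_series L 5" by (rule completed_eq) simp
  moreover have "L_infinity L 5 \<noteq> 0" by (rule L_infinity_nonzero) simp
  moreover have "L_series L 5 \<noteq> 0" by (rule L_series_logderiv(1)) simp
  ultimately show False by simp
qed

lemma zero_imp_isolated_zero:
  assumes "\<Lambda> analytic_on {s}" "\<Lambda> s = 0"
  shows "isolated_zero \<Lambda> s"
  using isolated_zero_analytic_iff[OF assms(1)] assms(2) eventually_nonzero by auto

text \<open>Without a pole the exponent 0 works, since GRH excludes a zero at 1.\<close>

lemma order_at_1_ex: "\<exists>r c. r \<le> m \<and> c \<noteq> 0 \<and> ((\<lambda>s. (s - 1) ^ r * \<Lambda> s) \<longlongrightarrow> c) (at 1)"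
proof (cases "is_pole \<Lambda> 1")
  case True
  define n g where "n = zorder \<Lambda> 1" and "g = zor_poly \<Lambda> 1"
  obtain r where r: "g 1 \<noteq> 0" "r > 0" "g holomorphic_on cball 1 r"
    "\<And>w. w \<in> cball 1 r \<Longrightarrow> w \<noteq> 1 \<Longrightarrow> \<Lambda> w = g w / (w-1) ^ nat (- n)"
    unfolding n_def g_def using pole_factorisation[OF holomorphic True] by blast
  have "continuous_on (cball 1 r) g" using r(3) by (rule holomorphic_on_imp_continuous_on)
  hence "isCont g 1" using r(2) by (intro continuous_on_interior) auto
  hence "(g \<longlongrightarrow> g 1) (at 1)" by (simp add: isCont_def)
  moreover have "eventually (\<lambda>w. g w = (w - 1) ^ nat (- n) * \<Lambda> w) (at 1)"
  proof -
    have "eventually (\<lambda>w. w \<in> ball 1 r - {1}) (at 1)" using r(2) by (intro eventually_at_in_open) auto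
    thus ?thesis by eventually_elim (use r(4) in auto)
  qed
  ultimately have "((\<lambda>w. (w - 1) ^ nat (- n) * \<Lambda> w) \<longlongrightarrow> g 1) (at 1)"
    by (rule Lim_transform_eventually)
  moreover have "nat (- n) \<le> m" using pole(2)[OF True] by (simp add: n_def)
  ultimately show ?thesis using r(1) by blast
next
  case False
  hence an: "\<Lambda> analytic_on {1}" using nicely_meromorphic_on_imp_analytic_at[OF nicely, of 1] by auto
  have "\<Lambda> 1 \<noteq> 0" using zero_imp_isolated_zero[OF an] zero_line[of 1] by auto
  moreover have "(\<Lambda> \<longlongrightarrow> \<Lambda> 1) (at 1)" using analytic_at_imp_isCont[OF an] by (simp add: isCont_def)
  ultimately show ?thesis by (intro exI[of _ 0] exI[of _ "\<Lambda> 1"]) auto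
qed

definition r :: nat where "r = (SOME r. r \<le> m \<and> (\<exists>c. c \<noteq> 0 \<and> ((\<lambda>s. (s - 1) ^ r * \<Lambda> s) \<longlongrightarrow> c) (at 1)))"
definition c1 :: complex where "c1 = (SOME c. c \<noteq> 0 \<and> ((\<lambda>s. (s - 1) ^ r * \<Lambda> s) \<longlongrightarrow> c) (at 1))"

lemma r_le: "r \<le> m" and c1: "c1 \<noteq> 0" "((\<lambda>s. (s - 1) ^ r * \<Lambda> s) \<longlongrightarrow> c1) (at 1)"
proof -
  have "\<exists>r. r \<le> m \<and> (\<exists>c. c \<noteq> 0 \<and> ((\<lambda>s. (s - 1) ^ r * \<Lambda> s) \<longlongrightarrow> c) (at 1))" using order_at_1_ex by blast
  from someI_ex[OF this] have 1: "r \<le> m" "\<exists>c. c \<noteq> 0 \<and> ((\<lambda>s. (s - 1) ^ r * \<Lambda> s) \<longlongrightarrow> c) (at 1)"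
    by (auto simp: r_def)
  from someI_ex[OF this(2)] show "c1 \<noteq> 0" "((\<lambda>s. (s - 1) ^ r * \<Lambda> s) \<longlongrightarrow> c1) (at 1)" "r \<le> m"
    using 1(1) by (auto simp: c1_def)
qed

text \<open>One exponent serves 0 and 1, because the functional equation exchanges these points. The
  values there are limits, the one at 0 being the one that the symmetry forces.\<close>

definition F :: "complex \<Rightarrow> complex" where
  "F s = (if s = 1 then c1 else if s = 0 then root_number L * cnj c1 else (s * (s - 1)) ^ r * \<Lambda> s)"

lemma kk: "root_number L * cnj (root_number L) = 1"
  using norm_root_number complex_norm_square[of "root_number L"] by simp

lemma F_sym: "F s = root_number L * cnj (F (1 - cnj s))"
proof -
  consider "s = 0" | "s = 1" | "s \<notin> {0, 1}" by auto
  thus ?thesis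
  proof cases
    case 2
    have "root_number L * cnj (F (1 - cnj s)) = (root_number L * cnj (root_number L)) * c1"
      using 2 by (simp add: F_def)
    thus ?thesis using 2 by (simp only: kk) (simp add: F_def)
  next
    case 3
    hence "1 - cnj s \<noteq> 0" "1 - cnj s \<noteq> 1" by (auto simp: complex_eq_iff)
    moreover have "cnj ((1 - cnj s) * ((1 - cnj s) - 1)) = s * (s - 1)" by (simp add: algebra_simps)
    ultimately have "root_number L * cnj (F (1 - cnj s)) = (s * (s - 1)) ^ r * (root_number L * cnj (\<Lambda> (1 - cnj s)))"
      by (simp add: F_def del: complex_cnj_mult complex_cnj_diff flip: complex_cnj_mult) (simp add: mult_ac)
    also have "root_number L * cnj (\<Lambda> (1 - cnj s)) = \<Lambda> s" using functional_equation[OF 3] by simp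
    finally show ?thesis using 3 by (simp add: F_def)
  qed (simp add: F_def)
qed

lemma F_lim_1: "(F \<longlongrightarrow> F 1) (at 1)"
proof -
  have "((\<lambda>s. s ^ r * ((s - 1) ^ r * \<Lambda> s)) \<longlongrightarrow> 1 ^ r * c1) (at 1)"
    by (intro tendsto_mult tendsto_power tendsto_ident_at c1)
  moreover have "eventually (\<lambda>s. s \<in> - {0} - {1}) (at (1::complex))"
    by (intro eventually_at_in_open) auto
  hence "eventually (\<lambda>s. s ^ r * ((s - 1) ^ r * \<Lambda> s) = F s) (at 1)"
    by eventually_elim (auto simp: F_def power_mult_distrib)
  ultimately have "(F \<longlongrightarrow> 1 ^ r * c1) (at 1)" by (rule Lim_transform_eventually)
  thus ?thesis by (simp add: F_def)
qed

lemma F_lim_0: "(F \<longlongrightarrow> F 0) (at 0)"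
proof -
  have "filterlim (\<lambda>s. 1 - cnj s) (at 1) (at 0)"
    unfolding filterlim_at by (auto intro!: tendsto_eq_intros simp: eventually_at_filter)
  hence "((\<lambda>s. F (1 - cnj s)) \<longlongrightarrow> F 1) (at 0)" by (rule filterlim_compose[OF F_lim_1])
  hence "((\<lambda>s. root_number L * cnj (F (1 - cnj s))) \<longlongrightarrow> root_number L * cnj (F 1)) (at 0)"
    by (intro tendsto_intros)
  moreover have "root_number L * cnj (F 1) = F 0" by (simp add: F_def)
  ultimately show ?thesis by (simp only: F_sym[symmetric])
qed

lemma F_entire: "F holomorphic_on UNIV"
proof (rule no_isolated_singularity')
  show "F holomorphic_on UNIV - {0, 1}"
  proof (rule holomorphic_transform)
    show "(\<lambda>s. (s * (s - 1)) ^ r * \<Lambda> s) holomorphic_on UNIV - {0, 1}"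
      using holomorphic by (intro holomorphic_intros) (simp add: Compl_eq_Diff_UNIV)
  qed (simp add: F_def)
  show "finite {0, 1 :: complex}" by simp
qed (use F_lim_0 F_lim_1 in auto)

lemma F_zero_imp:
  assumes "F s = 0"
  shows "isolated_zero \<Lambda> s" "Re s = 1/2"
proof -
  have s: "s \<notin> {0, 1}" using assms c1(1) norm_root_number by (auto simp: F_def split: if_splits)
  hence "\<Lambda> s = 0" using assms by (auto simp: F_def)
  thus "isolated_zero \<Lambda> s" by (intro zero_imp_isolated_zero analytic s)
  thus "Re s = 1/2" by (rule zero_line)
qed

definition f :: "complex \<Rightarrow> complex" where "f z = F (1/2 + z)"

text \<open>Order 1 provides an exponent \<open>\<rho> < 2\<close>, so \<open>\<Lambda>\<close> is
  at most \<open>exp ((norm s)\<^sup>2)\<close> far out. The polynomial factor is absorbed by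
  \<open>1 + x \<le> exp x\<close>, the compact rest by \<open>\<bar>M\<bar>\<close>.\<close>

lemma f_growth: "\<exists>C\<ge>0. \<forall>z. norm (f z) \<le> exp (C * (1 + (norm z)\<^sup>2))"
proof -
  have "Inf {ereal \<rho> | \<rho>. \<rho> \<ge> 0 \<and> (\<forall>\<^sub>F s in at_infinity. norm (\<Lambda> s) \<le> exp (norm s powr \<rho>))} < ereal 2"
  proof -
    have "growth_order \<Lambda> < ereal 2" unfolding growth_1 one_ereal_def ereal_less by simp
    thus ?thesis unfolding growth_order_def .
  qed
  then obtain \<rho> where \<rho>: "\<rho> < 2" "\<forall>\<^sub>F s in at_infinity. norm (\<Lambda> s) \<le> exp (norm s powr \<rho>)"
    unfolding Inf_less_iff by auto
  then obtain b where b: "\<And>s. norm s \<ge> b \<Longrightarrow> norm (\<Lambda> s) \<le> exp (norm s powr \<rho>)"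
    by (auto simp: eventually_at_infinity)
  define b' where "b' = max b 2"
  have big: "norm (F s) \<le> exp ((2 * real r + 1) * (1 + (norm s)\<^sup>2))" if s: "norm s \<ge> b'" for s
  proof -
    have s2: "norm s \<ge> 2" and sb: "norm s \<ge> b" using s by (auto simp: b'_def)
    have ne: "s \<noteq> 0" "s \<noteq> 1" using s2 by auto
    have "norm s powr \<rho> \<le> norm s powr 2" using s2 \<rho>(1) by (intro powr_mono) auto
    also have "\<dots> = (norm s)\<^sup>2" using s2 by (simp add: powr_numeral)
    finally have "exp (norm s powr \<rho>) \<le> exp (1 + (norm s)\<^sup>2)" by simp
    hence L1: "norm (\<Lambda> s) \<le> exp (1 + (norm s)\<^sup>2)" using b[OF sb] by linarith
    have "norm (s * (s - 1)) \<le> norm s * (norm s + 1)"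
      using norm_triangle_ineq4[of s 1] unfolding norm_mult by (intro mult_left_mono) auto
    also have "\<dots> \<le> 1 + 2 * (1 + (norm s)\<^sup>2)"
    proof -
      have "2 * norm s \<le> 1 + (norm s)\<^sup>2"
        using zero_le_power2[of "norm s - 1"] by (simp add: power2_eq_square algebra_simps)
      moreover have eq: "norm s * (norm s + 1) = (norm s)\<^sup>2 + norm s" by (simp add: power2_eq_square algebra_simps)
      ultimately show ?thesis using zero_le_power2[of "norm s"] unfolding eq by argo
    qed
    also have "\<dots> \<le> exp (2 * (1 + (norm s)\<^sup>2))" by (rule exp_ge_add_one_self)
    finally have "norm (s * (s - 1)) ^ r \<le> exp (2 * (1 + (norm s)\<^sup>2)) ^ r" by (intro power_mono) auto
    hence "norm (F s) \<le> exp (2 * (1 + (norm s)\<^sup>2)) ^ r * exp (1 + (norm s)\<^sup>2)"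
      using ne L1 by (simp only: F_def if_False norm_mult norm_power) (intro mult_mono, auto)
    also have "\<dots> = exp ((2 * real r + 1) * (1 + (norm s)\<^sup>2))"
      by (simp add: exp_of_nat_mult[symmetric] exp_add[symmetric] algebra_simps)
    finally show ?thesis .
  qed
  have "compact (F ` cball 0 b')"
    using F_entire by (intro compact_continuous_image holomorphic_on_imp_continuous_on) (auto intro: holomorphic_on_subset)
  hence "bounded (F ` cball 0 b')" by (rule compact_imp_bounded)
  then obtain M where "\<forall>w \<in> F ` cball 0 b'. norm w \<le> M" unfolding bounded_iff by blast
  hence M: "norm (F s) \<le> M" if "norm s \<le> b'" for s using that by simp
  have all: "norm (F s) \<le> exp ((2 * real r + 1 + \<bar>M\<bar>) * (1 + (norm s)\<^sup>2))" for s
  proof (cases "norm s \<le> b'")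
    case True
    have "norm (F s) \<le> \<bar>M\<bar>" using M[OF True] by linarith
    also have "\<dots> \<le> exp \<bar>M\<bar>" using exp_ge_add_one_self[of "\<bar>M\<bar>"] by linarith
    also have "\<bar>M\<bar> * 1 \<le> (2 * real r + 1 + \<bar>M\<bar>) * (1 + (norm s)\<^sup>2)" by (intro mult_mono) auto
    hence "exp \<bar>M\<bar> \<le> exp ((2 * real r + 1 + \<bar>M\<bar>) * (1 + (norm s)\<^sup>2))" by simp
    finally show ?thesis .
  next
    case False
    have "(2 * real r + 1) * (1 + (norm s)\<^sup>2) \<le> (2 * real r + 1 + \<bar>M\<bar>) * (1 + (norm s)\<^sup>2)"
      by (intro mult_right_mono) auto
    thus ?thesis by (intro order_trans[OF big[of s]]) (use False in auto)
  qed
  show ?thesis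
  proof (intro exI[of _ "(2 * real r + 1 + \<bar>M\<bar>) * 2"] conjI allI)
    fix z :: complex
    have "norm (1/2 + z) \<le> 1/2 + norm z" using norm_triangle_ineq[of "1/2" z] by simp
    hence "(norm (1/2 + z))\<^sup>2 \<le> (1/2 + norm z)\<^sup>2" by (intro power_mono) auto
    also have "\<dots> \<le> 1 + 2 * (norm z)\<^sup>2"
      using zero_le_power2[of "1/2 - norm z"] by (simp add: power2_eq_square algebra_simps)
    finally have "(2 * real r + 1 + \<bar>M\<bar>) * (1 + (norm (1/2 + z))\<^sup>2) \<le> (2 * real r + 1 + \<bar>M\<bar>) * (2 * (1 + (norm z)\<^sup>2))"
      by (intro mult_left_mono) auto
    thus "norm (f z) \<le> exp ((2 * real r + 1 + \<bar>M\<bar>) * 2 * (1 + (norm z)\<^sup>2))"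
      using all[of "1/2 + z"] unfolding f_def mult.assoc by (meson exp_le_cancel_iff order_trans)
  qed auto
qed

lemma f_entire: "f holomorphic_on UNIV"
  unfolding f_def[abs_def] by (intro holomorphic_on_compose_gen[OF _ F_entire, unfolded o_def] holomorphic_intros) auto

lemma f_nonzero: "Re z > 0 \<Longrightarrow> f z \<noteq> 0"
  using F_zero_imp(2)[of "1/2 + z"] by (auto simp: f_def)

sublocale halfplane_nonvanishing f
  by unfold_locales (fact f_entire, fact f_nonzero)

text \<open>
  The Digamma arguments are shifted by \<open>1\<close> so that they keep real part at least \<open>3/4\<close> up to
  \<open>Re z = 0\<close>; the price is the sum over \<open>j\<close> in \<open>polar\<close>, which may have poles with \<open>Re z > 0\<close>
  when \<open>Re \<mu>\<^sub>j < -1/2\<close>.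
\<close>

definition arch_logd :: "complex \<Rightarrow> complex" where
  "arch_logd z = of_real (ln (real N) / 2 - real m * (ln pi / 2)) + (\<Sum>j=1..m. Digamma ((1/2 + z + \<mu> j) / 2 + 1) / 2)"

definition polar :: "complex \<Rightarrow> complex" where
  "polar z = of_nat r * (1 / (z + 1/2)) + of_nat r * (1 / (z + (- 1/2))) - (\<Sum>j=1..m. 1 / (z + (1/2 + \<mu> j)))"

lemma logd_eq:
  assumes z: "Re z > 7/2"
  shows "logd z = arch_logd z + polar z + L_logd (1/2 + z)"
proof -
  define s where "s = 1/2 + z"
  have s: "Re s > 4" using z by (simp add: s_def)
  have op: "open {s. Re s > 4}" by (simp add: open_halfspace_Re_gt)
  define G where "G = of_nat r * (1 / s + 1 / (s - 1)) + (of_real (ln (real N) / 2) + (\<Sum>j=1..m. - of_real (ln pi / 2) + Digamma ((s + \<mu> j) / 2) / 2)) + L_logd s"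
  have pow: "logderiv_at (\<lambda>s. (s * (s - 1)) ^ r) s (of_nat r * (1 / s + 1 / (s - 1)))"
  proof (intro logderiv_at_power logderiv_at_mult)
    have "s \<noteq> 0" "s \<noteq> 1" using s by auto
    thus "logderiv_at (\<lambda>s. s) s (1 / s)" "logderiv_at (\<lambda>s. s - 1) s (1 / (s - 1))"
      unfolding logderiv_at_def by (auto intro!: derivative_eq_intros)
  qed
  have con: "logderiv_at (\<lambda>s. of_nat N powr (s / 2)) s (of_real (ln (real N) / 2))"
  proof -
    have "((\<lambda>s. s / 2 * of_real (ln (real N))) has_field_derivative (of_real (ln (real N) / 2))) (at s)"
      by (auto intro!: derivative_eq_intros)
    from logderiv_at_exp[OF this] show ?thesis using N_pos by (simp add: powr_def Ln_of_nat)
  qed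
  have gam: "logderiv_at (\<lambda>s. \<Prod>j=1..m. Gamma_R (s + \<mu> j)) s (\<Sum>j=1..m. - of_real (ln pi / 2) + Digamma ((s + \<mu> j) / 2) / 2)"
  proof (intro logderiv_at_prod logderiv_at_Gamma_R)
    fix j assume "j \<in> {1..m}"
    thus "Re (s + \<mu> j) > 0" using Re_spectral[of j] s by simp
  qed
  have "logderiv_at (\<lambda>s. (s * (s - 1)) ^ r * (L_infinity L s) * L_series L s) s G"
    unfolding G_def L_infinity_def
    by (intro logderiv_at_mult[of "\<lambda>s. _ s * _ s"] logderiv_at_mult pow con gam L_series_logderiv(2) s)
  hence "logderiv_at F s G"
  proof (rule logderiv_at_cong)
    have "eventually (\<lambda>z. z \<in> {s. Re s > 4}) (nhds s)" using s by (intro eventually_nhds_in_open op) auto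
    thus "eventually (\<lambda>z. F z = (z * (z - 1)) ^ r * (L_infinity L z) * L_series L z) (nhds s)"
    proof eventually_elim
      case (elim z)
      hence "z \<noteq> 0" "z \<noteq> 1" by auto
      thus ?case using completed_eq[of z] elim by (simp add: F_def)
    qed
  qed
  hence "(F has_field_derivative F (1/2 + z) * G) (at (1/2 + z))" by (simp add: logderiv_at_def s_def)
  hence "((\<lambda>z. F (1/2 + z)) has_field_derivative F (1/2 + z) * G * 1) (at z)"
  proof (rule DERIV_chain2[of F])
    show "((\<lambda>z. 1/2 + z) has_field_derivative 1) (at z)" by (auto intro!: derivative_eq_intros)
  qed
  hence "deriv f z = f z * G" by (intro DERIV_imp_deriv) (simp add: f_def[abs_def])
  hence L: "logd z = G" using f_nonzero[of z] z by (simp add: logd_def)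
  \<comment> \<open>\<open>Digamma (x + 1) = Digamma x + 1 / x\<close> at
    \<open>x = (s + \<mu> j) / 2\<close>; half of \<open>1 / x\<close> is the term
    \<open>1 / (s + \<mu> j)\<close> collected in \<open>polar\<close>.\<close>
  have S1: "(\<Sum>j=1..m. - of_real (ln pi / 2) + Digamma ((s + \<mu> j) / 2) / 2) =
     (\<Sum>j=1..m. - of_real (ln pi / 2) + (Digamma ((1/2 + z + \<mu> j) / 2 + 1) / 2 - 1 / (z + (1/2 + \<mu> j))))"
  proof (intro sum.cong refl)
    fix j assume j: "j \<in> {1..m}"
    have "(s + \<mu> j) / 2 \<noteq> 0" using Re_spectral[OF j] s by (auto simp: complex_eq_iff)
    from Digamma_plus1[OF this]
    show "- of_real (ln pi / 2) + Digamma ((s + \<mu> j) / 2) / 2 = 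
        - of_real (ln pi / 2) + (Digamma ((1/2 + z + \<mu> j) / 2 + 1) / 2 - 1 / (z + (1/2 + \<mu> j)))"
      by (simp add: s_def add_ac add_divide_distrib)
  qed
  have S2: "(\<Sum>j=1..m. - complex_of_real (ln pi / 2) + (Digamma ((1/2 + z + \<mu> j) / 2 + 1) / 2 - 1 / (z + (1/2 + \<mu> j))))
     = - of_real (real m * (ln pi / 2)) + (\<Sum>j=1..m. Digamma ((1/2 + z + \<mu> j) / 2 + 1) / 2) - (\<Sum>j=1..m. 1 / (z + (1/2 + \<mu> j)))"
    by (simp add: sum.distrib sum_subtractf)
  show ?thesis
    unfolding L G_def S1 S2 unfolding arch_logd_def polar_def s_def
    by (simp add: algebra_simps)
qed

lemma Re_digamma_arg: "Re ((1/2 + z + w) / 2 + 1) = (1/2 + Re z + Re w) / 2 + 1"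
  by simp

lemma arch_logd_arg: 
  assumes "Re z \<ge> 0" "j \<in> {1..m}"
  shows "Re ((1/2 + z + \<mu> j) / 2 + 1) \<ge> 3/4"
  using Re_spectral[OF assms(2)] assms(1) unfolding Re_digamma_arg by argo

lemma arch_logd_arg_half: 
  assumes "Re z \<ge> 0" "j \<in> {1..m}"
  shows "Re ((1/2 + z + \<mu> j) / 2 + 1) \<ge> 1/2"
  using arch_logd_arg[OF assms] by linarith

lemma arch_logd_holomorphic: "arch_logd holomorphic_on {z. Re z > - 1}"
proof -
  have "(1/2 + z + \<mu> j) / 2 + 1 \<notin> \<int>\<^sub>\<le>\<^sub>0" if "Re z > - 1" "j \<in> {1..m}" for z j
  proof
    assume "(1/2 + z + \<mu> j) / 2 + 1 \<in> \<int>\<^sub>\<le>\<^sub>0"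
    then obtain n where n: "(1/2 + z + \<mu> j) / 2 + 1 = of_int n" "n \<le> 0" by (auto elim!: nonpos_Ints_cases)
    have "Re ((1/2 + z + \<mu> j) / 2 + 1) \<le> 0" unfolding n(1) using n(2) by simp
    thus False using Re_spectral[OF that(2)] that(1) unfolding Re_digamma_arg by argo
  qed
  hence "(\<lambda>z. Digamma ((1/2 + z + \<mu> j) / 2 + 1)) holomorphic_on {z. Re z > - 1}" if "j \<in> {1..m}" for j
    using that by (intro holomorphic_on_compose_gen[OF _ holomorphic_on_Polygamma[of "- \<int>\<^sub>\<le>\<^sub>0"], unfolded o_def] holomorphic_intros) auto
  thus ?thesis unfolding arch_logd_def by (intro holomorphic_intros) auto
qed

text \<open>\<open>K\<close> depends on the L-function. This is admissible, because the bound serves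
  only to verify \<open>right_bound\<close> and to discard horizontal edges as \<open>Y\<close>
  tends to infinity.\<close>

lemma arch_logd_linear_bound:
  "\<exists>K. \<forall>z. 0 \<le> Re z \<and> Re z \<le> c \<longrightarrow> norm (arch_logd z) \<le> K * (1 + \<bar>Im z\<bar>)"
proof -
  define K0 where "K0 = \<bar>ln (real N) / 2 - real m * (ln pi / 2)\<bar>"
  define K1 where "K1 j = digamma_bound + 6 + (1/2 + \<bar>c\<bar> + 1 + norm (\<mu> j))+1" for j
  show ?thesis
  proof (intro exI allI impI, elim conjE)
    fix z assume z: "0 \<le> Re z" "Re z \<le> c"
    have nz: "norm z \<le> \<bar>c\<bar> + \<bar>Im z\<bar>" using cmod_le[of z] z by linarith
    have "norm (Digamma ((1/2 + z + \<mu> j) / 2 + 1) / 2) \<le> K1 j * (1 + \<bar>Im z\<bar>)" if j: "j \<in> {1..m}" for j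
    proof -
      define w where "w = (1/2 + z + \<mu> j) / 2 + 1"
      have "norm w \<le> norm ((1/2 + z + \<mu> j) / 2) + 1" unfolding w_def by (rule norm_triangle_le) simp
      also have "norm (1/2 + z + \<mu> j) \<le> 1/2 + norm z + norm (\<mu> j)"
        by (rule norm_triangle_le, rule add_right_mono, rule norm_triangle_le) simp
      hence "norm ((1/2 + z + \<mu> j) / 2) \<le> 1/2 + norm z + norm (\<mu> j)"
        using norm_ge_zero[of z] norm_ge_zero[of "\<mu> j"] unfolding norm_divide norm_numeral by linarith
      finally have w: "norm w \<le> 1/2 + \<bar>c\<bar> + 1 + norm (\<mu> j) + \<bar>Im z\<bar>" using nz by linarith
      have "norm (Digamma w / 2) \<le> norm (Digamma w)" by (simp add: norm_divide)
      also have "\<dots> \<le> digamma_bound + norm w + 6"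
        unfolding w_def by (rule norm_Digamma_le[OF arch_logd_arg_half[OF z(1) j]])
      also have "\<dots> \<le> K1 j * 1 + 1 * \<bar>Im z\<bar>" using w by (simp add: K1_def)
      also have "\<dots> \<le> K1 j * 1 + K1 j * \<bar>Im z\<bar>"
      proof (intro add_left_mono mult_right_mono)
        show "1 \<le> K1 j" unfolding K1_def using digamma_bound_nonneg norm_ge_zero[of "\<mu> j"] by linarith
      qed auto
      finally show ?thesis by (simp add: w_def algebra_simps)
    qed
    hence "norm (\<Sum>j=1..m. Digamma ((1/2 + z + \<mu> j) / 2 + 1) / 2) \<le> (\<Sum>j=1..m. K1 j * (1 + \<bar>Im z\<bar>))"
      by (intro sum_norm_le) auto
    moreover have "norm (complex_of_real (ln (real N) / 2 - real m * (ln pi / 2))) \<le> K0 * (1 + \<bar>Im z\<bar>)"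
      unfolding norm_of_real K0_def by (simp add: algebra_simps)
    ultimately have "norm (arch_logd z) \<le> K0 * (1 + \<bar>Im z\<bar>) + (\<Sum>j=1..m. K1 j * (1 + \<bar>Im z\<bar>))"
      unfolding arch_logd_def by (intro norm_triangle_le add_mono)
    thus "norm (arch_logd z) \<le> (K0 + (\<Sum>j=1..m. K1 j)) * (1 + \<bar>Im z\<bar>)"
      by (simp add: distrib_right sum_distrib_right)
  qed
qed

text \<open>Uniform in the spectral parameters, by \<open>norm w \<ge> Re w\<close> and
  \<open>Re (\<mu> j) > -1\<close>. The logarithm grows with \<open>Re z\<close>, so far to the
  right the Gamma factors outweigh poles and primes.\<close>

lemma Re_arch_logd_lower:
  assumes z: "Re z \<ge> 0"
  shows "Re (arch_logd z) \<ge> real m * ((ln ((Re z + 1/2) / 2) - digamma_bound) / 2 - ln pi / 2)"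
proof -
  have "Re (Digamma ((1/2 + z + \<mu> j) / 2 + 1) / 2) \<ge> (ln ((Re z + 1/2) / 2) - digamma_bound) / 2" if j: "j \<in> {1..m}" for j
  proof -
    define w where "w = (1/2 + z + \<mu> j) / 2 + 1"
    have "(Re z + 1/2) / 2 \<le> Re w" using Re_spectral[OF j] unfolding w_def Re_digamma_arg by argo
    also have "\<dots> \<le> norm w" by (rule complex_Re_le_cmod)
    finally have "ln ((Re z + 1/2) / 2) \<le> ln (norm w)" using z by (intro ln_mono) auto
    moreover have "Re (Digamma w) \<ge> ln (norm w) - digamma_bound"
      using Re_Digamma_bounds[OF arch_logd_arg_half[OF z j]] unfolding w_def by linarith
    ultimately show ?thesis by (simp add: w_def)
  qed
  hence "(\<Sum>j=1..m. (ln ((Re z + 1/2) / 2) - digamma_bound) / 2) \<le> (\<Sum>j=1..m. Re (Digamma ((1/2 + z + \<mu> j) / 2 + 1) / 2))"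
    by (intro sum_mono) auto
  moreover have "ln (real N) / 2 \<ge> 0" using N_pos by simp
  ultimately show ?thesis unfolding arch_logd_def by (simp add: Re_sum right_diff_distrib) 
qed

lemma norm_inverse_le_1: "Re z \<ge> 1 \<Longrightarrow> norm (1 / z) \<le> 1"
  using complex_Re_le_cmod[of z] by (subst norm_divide) (auto simp: divide_le_eq)

lemma norm_polar_le:
  assumes "Re z \<ge> 2"
  shows "norm (polar z) \<le> 3 * real m"
proof -
  have "norm (of_nat r * (1 / (z + 1/2))) \<le> real m * 1"
    unfolding norm_mult using norm_inverse_le_1[of "z + 1/2"] r_le assms by (intro mult_mono) auto
  moreover have "norm (of_nat r * (1 / (z + (- 1/2)))) \<le> real m * 1"
    unfolding norm_mult using norm_inverse_le_1[of "z + (- 1/2)"] r_le assms by (intro mult_mono) auto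
  moreover have "norm (\<Sum>j=1..m. 1 / (z + (1/2 + \<mu> j))) \<le> (\<Sum>j=1..m. 1)"
  proof (rule sum_norm_le)
    fix j assume "j \<in> {1..m}"
    thus "norm (1 / (z + (1/2 + \<mu> j))) \<le> 1" using Re_spectral[of j] assms by (intro norm_inverse_le_1) auto
  qed
  ultimately have "norm (polar z) \<le> (real m * 1 + real m * 1) + real m"
    unfolding polar_def by (intro order_trans[OF norm_triangle_ineq4] add_mono order_trans[OF norm_triangle_ineq]) auto
  thus ?thesis by simp
qed

lemma symmetric: "\<exists>C R0. symmetric_halfplane f (root_number L) C R0"
proof -
  obtain C where C: "C \<ge> 0" "\<And>z. norm (f z) \<le> exp (C * (1 + (norm z)\<^sup>2))" using f_growth by blast
  define S where "S = (\<Sum>p. 1 / (real p)\<^sup>2)"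
  have S0: "S \<ge> 0" unfolding S_def by (intro suminf_nonneg summable_inverse_square) auto
  \<comment> \<open>Beyond \<open>R0\<close> the lower bound for \<open>Re arch_logd\<close> is at
    least \<open>m (3 + 2 S)\<close>, where 3 pays for \<open>polar\<close> and \<open>2 S\<close>
    for the primes.\<close>
  define R0 where "R0 = max 4 (2 * exp (digamma_bound + ln pi + 6 + 4 * S))"
  have R04: "R0 \<ge> 4" by (simp add: R0_def)
  have "symmetric_halfplane f (root_number L) C R0"
  proof unfold_locales
    fix z
    show "f z = root_number L * cnj (f (- cnj z))"
      unfolding f_def using F_sym[of "1/2 + z"] by (simp add: algebra_simps)
    show "norm (f z) \<le> exp (C * (1 + (norm z)\<^sup>2))" by (rule C(2))
  next
    fix z assume z: "R0 \<le> Re z"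
    have z4: "Re z \<ge> 4" using z R04 by simp
    have "2 * exp (digamma_bound + ln pi + 6 + 4 * S) \<le> Re z" using z by (simp add: R0_def)
    hence "exp (digamma_bound + ln pi + 6 + 4 * S) \<le> (Re z + 1/2) / 2" by simp
    hence "digamma_bound + ln pi + 6 + 4 * S \<le> ln ((Re z + 1/2) / 2)" using z4 by (subst ln_ge_iff) auto
    hence "3 + 2 * S \<le> (ln ((Re z + 1/2) / 2) - digamma_bound) / 2 - ln pi / 2" by argo
    hence "real m * (3 + 2 * S) \<le> real m * ((ln ((Re z + 1/2) / 2) - digamma_bound) / 2 - ln pi / 2)"
      by (intro mult_left_mono) auto
    also have "\<dots> \<le> Re (arch_logd z)" using z4 by (intro Re_arch_logd_lower) simp
    finally have b: "real m * (3 + 2 * S) \<le> Re (arch_logd z)" .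
    have p: "\<bar>Re (polar z)\<bar> \<le> 3 * real m"
      using order_trans[OF abs_Re_le_cmod norm_polar_le, of z] z4 by simp
    have d: "\<bar>Re (L_logd (1/2 + z))\<bar> \<le> 2 * real m * S"
      using order_trans[OF abs_Re_le_cmod norm_L_logd_le, of "1/2 + z"] z4 by (simp add: S_def)
    have "Re (logd z) = Re (arch_logd z) + Re (polar z) + Re (L_logd (1/2 + z))" using logd_eq[of z] z4 by simp
    thus "0 \<le> Re (logd z)" using b p d by (simp add: algebra_simps abs_le_iff)
  next
    fix c assume c: "R0 \<le> c"
    obtain K where K: "\<And>z. 0 \<le> Re z \<Longrightarrow> Re z \<le> c \<Longrightarrow> norm (arch_logd z) \<le> K * (1 + \<bar>Im z\<bar>)"
      using arch_logd_linear_bound by blast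
    show "\<exists>M. \<forall>t. norm (logd (Complex c t)) \<le> M * (1 + \<bar>t\<bar>)"
    proof (intro exI allI)
      fix t
      define z where "z = Complex c t"
      have z4: "Re z \<ge> 4" using c R04 by (simp add: z_def)
      have "norm (logd z) \<le> norm (arch_logd z) + norm (polar z) + norm (L_logd (1/2 + z))"
      proof -
        have eq: "logd z = arch_logd z + polar z + L_logd (1/2 + z)" using z4 by (intro logd_eq) linarith
        show ?thesis
          unfolding eq using norm_triangle_ineq[of "arch_logd z + polar z" "L_logd (1/2 + z)"] norm_triangle_ineq[of "arch_logd z" "polar z"] by linarith
      qed
      also have "\<dots> \<le> K * (1 + \<bar>t\<bar>) + (3 * real m) * (1 + \<bar>t\<bar>) + (2 * real m * \<bar>S\<bar>) * (1 + \<bar>t\<bar>)"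
      proof (intro add_mono)
        show "norm (arch_logd z) \<le> K * (1 + \<bar>t\<bar>)" using K[of z] z4 by (simp add: z_def)
        have "norm (polar z) \<le> (3 * real m) * 1" using norm_polar_le[of z] z4 by simp
        also have "\<dots> \<le> (3 * real m) * (1 + \<bar>t\<bar>)" by (intro mult_left_mono) auto
        finally show "norm (polar z) \<le> (3 * real m) * (1 + \<bar>t\<bar>)" .
        have "norm (L_logd (1/2 + z)) \<le> (2 * real m * S) * 1" using norm_L_logd_le[of "1/2 + z"] z4 by (simp add: S_def)
        also have "\<dots> \<le> (2 * real m * \<bar>S\<bar>) * (1 + \<bar>t\<bar>)" using S0 by (intro mult_mono) auto
        finally show "norm (L_logd (1/2 + z)) \<le> (2 * real m * \<bar>S\<bar>) * (1 + \<bar>t\<bar>)" .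
      qed
      also have "\<dots> = (K + 3 * real m + 2 * real m * \<bar>S\<bar>) * (1 + \<bar>t\<bar>)" by (simp only: distrib_right)
      finally show "norm (logd (Complex c t)) \<le> (K + 3 * real m + 2 * real m * \<bar>S\<bar>) * (1 + \<bar>t\<bar>)"
        by (simp only: z_def)
    qed
  qed (use norm_root_number C in auto)
  thus ?thesis by (intro exI[of _ C] exI[of _ R0]) auto
qed

end

section \<open>Integrals against the test function\<close>

text \<open>This encodes \<open>limsup \<bar>h Y\<bar> \<le> E\<close> as \<open>Y\<close> tends to infinity.\<close>

definition asym_le :: "(real \<Rightarrow> complex) \<Rightarrow> real \<Rightarrow> bool" where
  "asym_le h E \<longleftrightarrow> (\<forall>\<epsilon>>0. eventually (\<lambda>Y. norm (h Y) \<le> E + \<epsilon>) at_top)"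

lemma asym_le_mono:
  assumes "asym_le h E" "E \<le> E'"
  shows "asym_le h E'"
  unfolding asym_le_def
proof (intro allI impI)
  fix \<epsilon> :: real assume "\<epsilon> > 0"
  hence "eventually (\<lambda>Y. norm (h Y) \<le> E + \<epsilon>) at_top" using assms(1) unfolding asym_le_def by blast
  thus "eventually (\<lambda>Y. norm (h Y) \<le> E' + \<epsilon>) at_top"
    by (rule eventually_mono) (use assms(2) in linarith)
qed

lemma asym_le_I:
  assumes "\<And>Y. Y \<ge> 1 \<Longrightarrow> norm (h Y) \<le> E + C / Y"
  shows "asym_le h E"
  unfolding asym_le_def
proof (intro allI impI)
  fix \<epsilon> :: real assume e: "\<epsilon> > 0"
  have "eventually (\<lambda>Y. Y \<ge> max 1 (\<bar>C\<bar> / \<epsilon>)) at_top" by (rule eventually_ge_at_top)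
  thus "eventually (\<lambda>Y. norm (h Y) \<le> E + \<epsilon>) at_top"
  proof eventually_elim
    case (elim Y)
    hence Y: "Y \<ge> 1" "\<bar>C\<bar> / \<epsilon> \<le> Y" by auto
    hence "\<bar>C\<bar> \<le> \<epsilon> * Y" using e by (simp add: field_simps)
    hence "C / Y \<le> \<epsilon>" using Y by (simp add: divide_le_eq)
    thus ?case using assms[OF Y(1)] by linarith
  qed
qed

lemma asym_le_add:
  assumes "asym_le h E" "asym_le h' E'"
  shows "asym_le (\<lambda>Y. h Y + h' Y) (E + E')"
  unfolding asym_le_def
proof (intro allI impI)
  fix \<epsilon> :: real assume "\<epsilon> > 0"
  hence e: "\<epsilon> / 2 > 0" by simp
  have "eventually (\<lambda>Y. norm (h Y) \<le> E + \<epsilon> / 2) at_top" "eventually (\<lambda>Y. norm (h' Y) \<le> E' + \<epsilon> / 2) at_top"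
    using assms e unfolding asym_le_def by blast+
  thus "eventually (\<lambda>Y. norm (h Y + h' Y) \<le> E + E' + \<epsilon>) at_top"
  proof eventually_elim
    case (elim Y)
    have "norm (h Y + h' Y) \<le> norm (h Y) + norm (h' Y)" by (rule norm_triangle_ineq)
    also have "\<dots> \<le> (E + \<epsilon> / 2) + (E' + \<epsilon> / 2)" using elim by (rule add_mono)
    finally show ?case by simp
  qed
qed

lemma asym_le_zero: "0 \<le> E \<Longrightarrow> asym_le (\<lambda>_. 0) E"
  by (simp add: asym_le_def)

lemma asym_le_sum:
  assumes "\<And>i. i \<in> I \<Longrightarrow> asym_le (h i) (E i)"
  shows "asym_le (\<lambda>Y. \<Sum>i\<in>I. h i Y) (\<Sum>i\<in>I. E i)"
  using assms by (induction I rule: infinite_finite_induct) (auto intro: asym_le_add asym_le_zero)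

lemma asym_le_cmult:
  assumes "asym_le h E"
  shows "asym_le (\<lambda>Y. c * h Y) (norm c * E)"
proof (cases "c = 0")
  case False
  show ?thesis unfolding asym_le_def
  proof (intro allI impI)
    fix \<epsilon> :: real assume "\<epsilon> > 0"
    hence "\<epsilon> / norm c > 0" using False by simp
    hence "eventually (\<lambda>Y. norm (h Y) \<le> E + \<epsilon> / norm c) at_top" using assms unfolding asym_le_def by blast
    thus "eventually (\<lambda>Y. norm (c * h Y) \<le> norm c * E + \<epsilon>) at_top"
    proof eventually_elim
      case (elim Y)
      have "norm (c * h Y) \<le> norm c * (E + \<epsilon> / norm c)" unfolding norm_mult using elim by (intro mult_left_mono) auto
      thus ?case using False by (simp add: distrib_left)
    qed
  qed
qed (simp add: asym_le_zero)

lemma asym_le_close: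
  assumes "asym_le h E" and "\<And>Y. Y \<ge> 1 \<Longrightarrow> norm (h' Y - h Y) \<le> C / Y"
  shows "asym_le h' E"
proof -
  have "asym_le (\<lambda>Y. h' Y - h Y) 0" by (rule asym_le_I[of _ 0 C]) (use assms(2) in auto)
  from asym_le_add[OF assms(1) this] show ?thesis by simp
qed

locale kernel =
  fixes V :: real
  assumes V: "V \<ge> 2 * pi"
begin

lemma V6: "V \<ge> 6" using V pi_gt3 by linarith

definition J :: "real \<Rightarrow> (complex \<Rightarrow> complex) \<Rightarrow> real \<Rightarrow> complex" where
  "J c G Y = vint c Y (\<lambda>z. testfun V z * G z)"

lemma testfun_continuous: "continuous_on A (testfun V)"
  by (intro holomorphic_on_imp_continuous_on testfun_holomorphic)

lemma J_line_bound:
  assumes "continuous_on S G" "\<And>t. Complex c t \<in> S" "Y \<ge> 1" "c \<ge> 0"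
    and G: "\<And>t. norm (G (Complex c t)) \<le> M * (1 + \<bar>t\<bar>) powr (1/2)"
  shows "norm (J c G Y) \<le> 64 * V ^ 4 * exp (V * c) * M"
proof -
  have M0: "M \<ge> 0" using order_trans[OF norm_ge_zero G[of 0]] by simp
  have "norm (J c G Y) \<le> (16 * V ^ 4 * exp (V * c) * M) * (4 - 4 * (1 + Y) powr (-1/2))"
    unfolding J_def
  proof (rule vint_norm_bound)
    show "continuous_on S (\<lambda>z. testfun V z * G z)"
      by (intro continuous_intros testfun_continuous assms)
    show "((\<lambda>t. (16 * V ^ 4 * exp (V * c) * M) * (1 + \<bar>t\<bar>) powr (-3/2)) has_integral 
        (16 * V ^ 4 * exp (V * c) * M) * (4 - 4 * (1 + Y) powr (-1/2))) {-Y..Y}"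
      using assms(3) by (intro has_integral_mult_right has_integral_decay) simp
  next
    fix t
    have "norm (testfun V (Complex c t) * G (Complex c t)) \<le> (16 * V ^ 4 * exp (V * c) / (1 + \<bar>t\<bar>)\<^sup>2) * (M * (1 + \<bar>t\<bar>) powr (1/2))"
      unfolding norm_mult using norm_testfun_le[OF V, of "Complex c t"] assms(4) G by (intro mult_mono) auto
    also have "\<dots> = (16 * V ^ 4 * exp (V * c) * M) * ((1 + \<bar>t\<bar>) powr (1/2) / (1 + \<bar>t\<bar>)\<^sup>2)" by simp
    also have "(1 + \<bar>t\<bar>)\<^sup>2 = (1 + \<bar>t\<bar>) powr 2" by (simp add: powr_numeral)
    also have "(1 + \<bar>t\<bar>) powr (1/2) / (1 + \<bar>t\<bar>) powr 2 = (1 + \<bar>t\<bar>) powr (-3/2)" by (simp only: powr_diff[symmetric]) simp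
    finally show "norm (testfun V (Complex c t) * G (Complex c t)) \<le> (16 * V ^ 4 * exp (V * c) * M) * (1 + \<bar>t\<bar>) powr (-3/2)" .
  qed (use assms in auto)
  also have "\<dots> \<le> (16 * V ^ 4 * exp (V * c) * M) * 4" using V6 M0 by (intro mult_left_mono) auto
  finally show ?thesis by simp
qed

lemma J_add:
  assumes "continuous_on S G" "continuous_on S G'" "\<And>t. Complex c t \<in> S"
  shows "J c (\<lambda>z. G z + G' z) Y = J c G Y + J c G' Y"
proof -
  have "(\<lambda>t. testfun V (Complex c t) * G (Complex c t)) integrable_on {-Y..Y}"
    "(\<lambda>t. testfun V (Complex c t) * G' (Complex c t)) integrable_on {-Y..Y}"
    by (rule vint_integrable[of S]; intro continuous_intros testfun_continuous assms)+
  thus ?thesis unfolding J_def vint_def by (simp add: distrib_left integral_add)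
qed

lemma J_cmult: "J c (\<lambda>z. k * G z) Y = k * J c G Y"
  unfolding J_def vint_def by (simp add: mult.left_commute[of _ k])

lemma J_diff:
  assumes "continuous_on S G" "continuous_on S G'" "\<And>t. Complex c t \<in> S"
  shows "J c (\<lambda>z. G z - G' z) Y = J c G Y - J c G' Y"
  using J_add[of S G "\<lambda>z. (- 1) * G' z" c Y, unfolded J_cmult] assms by (auto intro: continuous_intros)

lemma J_sum:
  assumes "finite I" "\<And>i. i \<in> I \<Longrightarrow> continuous_on S (G i)" "\<And>t. Complex c t \<in> S"
  shows "J c (\<lambda>z. \<Sum>i\<in>I. G i z) Y = (\<Sum>i\<in>I. J c (G i) Y)"
  using assms(1,2)
proof (induction I rule: finite_induct)
  case empty
  thus ?case by (simp add: J_def vint_def)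
next
  case (insert i I)
  have "J c (\<lambda>z. G i z + (\<Sum>i\<in>I. G i z)) Y = J c (G i) Y + J c (\<lambda>z. \<Sum>i\<in>I. G i z) Y"
    using insert by (intro J_add[of S] assms(3) continuous_intros) auto
  thus ?case using insert by simp
qed

text \<open>On the horizontal edges the linear growth of \<open>G\<close> meets the quadratic decay
  of the test function, which leaves \<open>O(1 / Y)\<close>.\<close>

lemma J_shift:
  assumes holo: "G holomorphic_on {z. Re z > d}" and c: "d < c1" "0 \<le> c1" "c1 \<le> c2" and Y: "Y \<ge> 1"
    and G: "\<And>z. c1 \<le> Re z \<Longrightarrow> Re z \<le> c2 \<Longrightarrow> norm (G z) \<le> M * (1 + \<bar>Im z\<bar>)"
  shows "norm (J c1 G Y - J c2 G Y) \<le> (2 * (c2 - c1) * (16 * V ^ 4 * exp (V * c2) * M)) / Y"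
proof -
  have "norm (G (of_real c1)) \<le> M * (1 + \<bar>Im (of_real c1)\<bar>)" using c by (intro G) auto
  hence M0: "M \<ge> 0" using order_trans[OF norm_ge_zero] by fastforce
  have "norm (J c1 G Y - J c2 G Y) \<le> 2 * (c2 - c1) * (16 * V ^ 4 * exp (V * c2) * M / Y)"
    unfolding J_def
  proof (rule vint_shift_bound[of _ d])
    show "(\<lambda>z. testfun V z * G z) holomorphic_on {z. Re z > d}"
      by (intro holomorphic_intros testfun_holomorphic holo)
    fix z assume z: "c1 \<le> Re z" "Re z \<le> c2" "\<bar>Im z\<bar> = Y"
    have Vn: "V \<ge> 0" using V6 by simp
    have "norm (testfun V z * G z) \<le> (16 * V ^ 4 * exp (V * Re z) / (1 + \<bar>Im z\<bar>)\<^sup>2) * (M * (1 + \<bar>Im z\<bar>))"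
      unfolding norm_mult using norm_testfun_le[OF V, of z] z c G by (intro mult_mono) auto
    also have "\<dots> = 16 * V ^ 4 * exp (V * Re z) * M / (1 + Y)"
      using Y by (simp add: z power2_eq_square)
    also have "\<dots> \<le> 16 * V ^ 4 * exp (V * c2) * M / Y"
      using Y z Vn M0 by (intro frac_le mult_mono) (auto intro!: mult_left_mono)
    finally show "norm (testfun V z * G z) \<le> 16 * V ^ 4 * exp (V * c2) * M / Y" .
  qed (use c Y in auto)
  thus ?thesis by simp
qed

text \<open>The integral is estimated on a line further left: the exponential cost is then
  \<open>exp (V c)\<close>, with \<open>c\<close> as small as the singularities of \<open>G\<close>
  permit, instead of \<open>exp (4 V)\<close>.\<close>

lemma J_move:
  assumes hol: "G holomorphic_on {z. Re z > d}" and c: "d < c" "0 \<le> c" "c \<le> 4"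
    and G: "\<And>z. c \<le> Re z \<Longrightarrow> norm (G z) \<le> M"
  shows "asym_le (J 4 G) (64 * V ^ 4 * exp (V * c) * M)"
proof -
  have M0: "M \<ge> 0" using order_trans[OF norm_ge_zero G[of "of_real c"]] by simp
  have "asym_le (J c G) (64 * V ^ 4 * exp (V * c) * M)"
  proof (rule asym_le_I[of _ _ 0])
    fix Y :: real assume Y: "Y \<ge> 1"
    have "norm (J c G Y) \<le> 64 * V ^ 4 * exp (V * c) * M"
    proof (rule J_line_bound[OF holomorphic_on_imp_continuous_on[OF hol]])
      fix t :: real
      have "norm (G (Complex c t)) \<le> M * 1" using G[of "Complex c t"] by simp
      also have "\<dots> \<le> M * (1 + \<bar>t\<bar>) powr (1/2)" using M0 by (intro mult_left_mono ge_one_powr_ge_zero) auto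
      finally show "norm (G (Complex c t)) \<le> M * (1 + \<bar>t\<bar>) powr (1/2)" .
    qed (use c Y in auto)
    thus "norm (J c G Y) \<le> 64 * V ^ 4 * exp (V * c) * M + 0 / Y" by simp
  qed
  moreover have "norm (J 4 G Y - J c G Y) \<le> (2 * (4 - c) * (16 * V ^ 4 * exp (V * 4) * M)) / Y" if "Y \<ge> 1" for Y
    unfolding norm_minus_commute[of "J 4 G Y"]
  proof (rule J_shift[OF hol c that])
    fix z assume z: "c \<le> Re z"
    have "norm (G z) \<le> M * 1" using G[OF z] by simp
    also have "\<dots> \<le> M * (1 + \<bar>Im z\<bar>)" using M0 by (intro mult_left_mono) auto
    finally show "norm (G z) \<le> M * (1 + \<bar>Im z\<bar>)" .
  qed
  ultimately show ?thesis by (rule asym_le_close)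
qed

text \<open>The pole has real part at most 1/2. On the line at distance \<open>1/V\<close> to the
  right of 1/2 the function is at most \<open>V\<close>, while \<open>exp (V c)\<close> is only
  \<open>exp 1 \<le> 3\<close> times \<open>exp (V/2)\<close>; hence
  \<open>192 = 64 * 3\<close>.\<close>

lemma J_simple_pole:
  assumes b: "Re b \<ge> - 1/2"
  shows "asym_le (J 4 (\<lambda>z. 1 / (z + b))) (192 * V ^ 5 * exp (V / 2))"
proof -
  define c where "c = 1/2 + 1 / V"
  have V0: "V > 0" using V6 by simp
  have iV: "0 < 1 / V" "1 / V \<le> 1" using V6 by auto
  have c: "1/2 < c" "0 \<le> c" "c \<le> 4" using iV unfolding c_def by argo+
  have "asym_le (J 4 (\<lambda>z. 1 / (z + b))) (64 * V ^ 4 * exp (V * c) * V)"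
  proof (rule J_move[OF _ c])
    have "z + b \<noteq> 0" if "Re z > 1/2" for z
      using that b by (auto simp: complex_eq_iff)
    thus "(\<lambda>z. 1 / (z + b)) holomorphic_on {z. Re z > 1/2}" by (intro holomorphic_intros) auto
    fix z assume "c \<le> Re z"
    hence "1 / V \<le> Re (z + b)" using b unfolding c_def plus_complex.sel by argo
    also have "\<dots> \<le> norm (z + b)" by (rule complex_Re_le_cmod)
    finally have le: "1 / V \<le> norm (z + b)" .
    hence "0 < norm (z + b)" using iV by linarith
    hence "1 / norm (z + b) \<le> 1 / (1 / V)" using le iV by (intro divide_left_mono mult_pos_pos) auto
    thus "norm (1 / (z + b)) \<le> V" by (simp add: norm_divide)
  qed
  moreover have "64 * V ^ 4 * exp (V * c) * V \<le> 192 * V ^ 5 * exp (V / 2)"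
  proof -
    have "V * c = V / 2 + 1" using V0 by (simp add: c_def distrib_left)
    hence "exp (V * c) = exp (V / 2) * exp 1" by (simp add: exp_add)
    also have "\<dots> \<le> exp (V / 2) * 3" using exp_le by (intro mult_left_mono) auto
    finally have "64 * V ^ 5 * exp (V * c) \<le> 64 * V ^ 5 * (exp (V / 2) * 3)" using V0 by (intro mult_left_mono) auto
    moreover have eq: "64 * V ^ 4 * exp (V * c) * V = 64 * V ^ 5 * exp (V * c)" by (simp add: eval_nat_numeral mult_ac)
    ultimately show ?thesis unfolding eq by simp
  qed
  ultimately show ?thesis by (rule asym_le_mono)
qed

text \<open>A Paley-Wiener argument: the test function has exponential type \<open>V\<close>, so for
  \<open>v \<ge> V\<close> the integrand is \<open>O(1 / (norm z)\<^sup>2)\<close> to the right and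
  the contour closes there. This removes all prime powers from \<open>exp V\<close> on.\<close>

lemma J_exp_large:
  assumes "v \<ge> V"
  shows "asym_le (J 4 (\<lambda>z. exp (- of_real v * z))) 0"
proof (rule asym_le_I[of _ _ 16])
  fix Y :: real assume Y: "Y \<ge> 1"
  have "norm (J 4 (\<lambda>z. exp (- of_real v * z)) Y) \<le> 4 * 4 / Y"
    unfolding J_def
  proof (rule vint_right_box[of _ 0])
    show "(\<lambda>z. testfun V z * exp (- of_real v * z)) holomorphic_on {z. Re z > 0}"
      by (intro holomorphic_intros testfun_holomorphic)
    fix z assume z: "4 \<le> Re z" "Y \<le> norm z"
    have "norm (testfun V z * exp (- of_real v * z)) \<le> (4 * exp (V * Re z) / (norm z)\<^sup>2) * exp (- (v * Re z))"
      unfolding norm_mult using norm_testfun_le'[OF V, of z] z Y by (intro mult_mono) auto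
    also have "\<dots> = 4 * exp ((V - v) * Re z) / (norm z)\<^sup>2"
      by (simp add: exp_diff exp_minus field_simps)
    also have "\<dots> \<le> 4 * 1 / (norm z)\<^sup>2"
      using assms z by (intro divide_right_mono mult_left_mono) (auto intro!: mult_nonpos_nonneg)
    finally show "norm (testfun V z * exp (- of_real v * z)) \<le> 4 / (norm z)\<^sup>2" by simp
  qed (use Y in auto)
  thus "norm (J 4 (\<lambda>z. exp (- of_real v * z)) Y) \<le> 0 + 16 / Y" by simp
qed

text \<open>The exponential is entire and bounded by 1 for \<open>Re z \<ge> 0\<close>, so the line
  may be moved to \<open>c = 0\<close>, where \<open>exp (V c)\<close> costs nothing.\<close>

lemma J_exp:
  assumes "v \<ge> 0"
  shows "asym_le (J 4 (\<lambda>z. exp (- of_real v * z))) (64 * V ^ 4)"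
proof -
  have "asym_le (J 4 (\<lambda>z. exp (- of_real v * z))) (64 * V ^ 4 * exp (V * 0) * 1)"
    by (rule J_move[of _ "-1"]) (use assms in \<open>auto intro!: holomorphic_intros\<close>)
  thus ?thesis by simp
qed

text \<open>On the fixed line \<open>Re z = 4\<close> the integral is at most \<open>Q\<close> times
  the supremum of \<open>G\<close>. The factor \<open>exp (4 V)\<close> in \<open>Q\<close> does no
  harm, since the approximation can be made correspondingly fine.\<close>

lemma J_uniform_limit:
  assumes cont: "continuous_on S G" "\<And>t. Complex 4 t \<in> S"
    and approx: "\<And>\<epsilon>. \<epsilon> > 0 \<Longrightarrow> \<exists>G'. continuous_on S G' \<and> asym_le (J 4 G') E \<and> (\<forall>t. norm (G (Complex 4 t) - G' (Complex 4 t)) \<le> \<epsilon>)"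
  shows "asym_le (J 4 G) E"
  unfolding asym_le_def
proof (intro allI impI)
  fix \<epsilon> :: real assume e: "\<epsilon> > 0"
  define Q where "Q = 64 * V ^ 4 * exp (V * 4)"
  have Q: "Q > 0" using V6 by (simp add: Q_def)
  have e2: "\<epsilon> / (2 * Q) > 0" using Q e by simp
  obtain G' where G': "continuous_on S G'" "asym_le (J 4 G') E" "\<And>t. norm (G (Complex 4 t) - G' (Complex 4 t)) \<le> \<epsilon> / (2 * Q)"
    using approx[OF e2] by blast
  have "\<epsilon> / 2 > 0" using e by simp
  hence "eventually (\<lambda>Y. norm (J 4 G' Y) \<le> E + \<epsilon> / 2) at_top" using G'(2) unfolding asym_le_def by blast
  moreover have "eventually (\<lambda>Y::real. Y \<ge> 1) at_top" by (rule eventually_ge_at_top)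
  ultimately show "eventually (\<lambda>Y. norm (J 4 G Y) \<le> E + \<epsilon>) at_top"
  proof eventually_elim
    case (elim Y)
    have "norm (J 4 (\<lambda>z. G z - G' z) Y) \<le> 64 * V ^ 4 * exp (V * 4) * (\<epsilon> / (2 * Q))"
    proof (rule J_line_bound)
      show "continuous_on S (\<lambda>z. G z - G' z)" by (intro continuous_intros cont G')
      fix t :: real
      have "norm (G (Complex 4 t) - G' (Complex 4 t)) \<le> \<epsilon> / (2 * Q) * 1" using G'(3) by simp
      also have "\<dots> \<le> \<epsilon> / (2 * Q) * (1 + \<bar>t\<bar>) powr (1/2)" using e2 by (intro mult_left_mono ge_one_powr_ge_zero) auto
      finally show "norm (G (Complex 4 t) - G' (Complex 4 t)) \<le> \<epsilon> / (2 * Q) * (1 + \<bar>t\<bar>) powr (1/2)" .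
    qed (use cont elim in auto)
    also have "\<dots> = \<epsilon> / 2" unfolding Q_def[symmetric] using Q by simp
    finally have "norm (J 4 G Y - J 4 G' Y) \<le> \<epsilon> / 2" using J_diff[OF cont(1) G'(1) cont(2)] by simp
    moreover have "norm (J 4 G Y) \<le> norm (J 4 G' Y) + norm (J 4 G Y - J 4 G' Y)"
      using norm_triangle_ineq[of "J 4 G' Y" "J 4 G Y - J 4 G' Y"] by simp
    ultimately show ?case using elim by argo
  qed
qed

end

section \<open>The contribution of the primes and poles\<close>

lemma sum_inverse_sqrt_le: "(\<Sum>n=1..k. 1 / sqrt (real n)) \<le> 2 * sqrt (real k)"
proof (induction k)
  case (Suc k)
  have "1 / sqrt (real (Suc k)) \<le> 2 * (sqrt (real (Suc k)) - sqrt (real k))"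
  proof -
    have s: "sqrt (real k) \<le> sqrt (real (Suc k))" "0 < sqrt (real (Suc k))" by auto
    have "1 = (sqrt (real (Suc k)) - sqrt (real k)) * (sqrt (real (Suc k)) + sqrt (real k))"
      by (simp add: algebra_simps)
    also have "\<dots> \<le> (sqrt (real (Suc k)) - sqrt (real k)) * (2 * sqrt (real (Suc k)))"
      using s by (intro mult_left_mono) auto
    finally have "1 \<le> 2 * (sqrt (real (Suc k)) - sqrt (real k)) * sqrt (real (Suc k))" by (simp only: mult_ac)
    thus ?thesis by (subst pos_divide_le_eq[OF s(2)])
  qed
  thus ?case using Suc by simp
qed simp

lemma geometric_remainder:
  fixes x :: complex
  assumes "norm x \<le> 1 / 8"
  shows "norm (x / (1 - x) - (\<Sum>k=1..n. x ^ k)) \<le> (1 / 8) ^ n"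
proof -
  have nz: "1 - x \<noteq> 0" using assms by auto
  have "(\<Sum>k=1..n. x ^ k) * (1 - x) = x - x ^ Suc n"
  proof (induction n)
    case (Suc n)
    have "(\<Sum>k=1..Suc n. x ^ k) * (1 - x) = (\<Sum>k=1..n. x ^ k) * (1 - x) + x ^ Suc n * (1 - x)"
      by (simp add: distrib_right)
    also have "\<dots> = x - x ^ Suc (Suc n)" unfolding Suc by (simp add: algebra_simps)
    finally show ?case .
  qed simp
  hence "(\<Sum>k=1..n. x ^ k) = (x - x ^ Suc n) / (1 - x)" using nz by (simp add: eq_divide_eq)
  hence "x / (1 - x) - (\<Sum>k=1..n. x ^ k) = x ^ Suc n / (1 - x)" by (simp add: diff_divide_distrib)
  hence "norm (x / (1 - x) - (\<Sum>k=1..n. x ^ k)) = norm x ^ Suc n / norm (1 - x)" by (simp add: norm_divide norm_mult norm_power)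
  also have "\<dots> \<le> (1 / 8) ^ Suc n / (1 / 2)"
  proof (rule frac_le)
    show "1 / 2 \<le> norm (1 - x)" using assms norm_triangle_ineq2[of 1 x] by simp
  qed (use assms in \<open>auto intro!: power_mono simp del: power_Suc\<close>)
  also have "\<dots> \<le> (1 / 8) ^ n" by simp
  finally show ?thesis .
qed

context L_fun
begin

lemma euler_root_exp:
  assumes "p > 0"
  shows "euler_root p j s = local_root L j p * exp (- s * of_real (ln (real p)))"
  using assms by (simp add: euler_root_def powr_def exp_minus divide_inverse Ln_of_nat)

text \<open>Isolates the dependence on \<open>z\<close>: the frequency \<open>k ln p\<close> decides
  between \<open>J_exp\<close> and \<open>J_exp_large\<close>.\<close>

lemma euler_root_power:
  assumes "p > 0"
  shows "euler_root p j (w + z) ^ k = euler_root p j w ^ k * exp (- of_real (real k * ln (real p)) * z)"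
proof -
  have "euler_root p j (w + z) = euler_root p j w * exp (- of_real (ln (real p)) * z)"
  proof -
    have "- (w + z) * of_real (ln (real p)) = - w * of_real (ln (real p)) + - of_real (ln (real p)) * z"
      by (simp add: algebra_simps)
    thus ?thesis unfolding euler_root_exp[OF assms] by (simp only: exp_add mult.assoc)
  qed
  hence "euler_root p j (w + z) ^ k = euler_root p j w ^ k * exp (- of_real (ln (real p)) * z) ^ k" by (simp only: power_mult_distrib)
  also have "exp (- of_real (ln (real p)) * z) ^ k = exp (of_nat k * (- of_real (ln (real p)) * z))"
    by (rule exp_of_nat_mult[symmetric])
  also have "of_nat k * (- of_real (ln (real p)) * z) = - of_real (real k * ln (real p)) * z" by simp
  finally show ?thesis .
qed

end

section \<open>The arithmetic side at a fixed distance \<open>u\<close> from the critical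
  line\<close>

locale L_fun_kernel = L_fun + kernel +
  fixes u :: real
  assumes u: "0 < u" "u \<le> 1"
begin

definition w :: complex where "w = of_real (1/2 + u)"

lemma Re_w: "Re w = 1/2 + u"
  by (simp add: w_def)

text \<open>Below the cutoff \<open>(p powr \<theta>) ^ k \<le> exp (V \<theta>)\<close>, and of the
  decay \<open>p powr (- k / 2)\<close> only \<open>1 / sqrt p\<close> is kept, so that the bound no
  longer depends on \<open>k\<close>.\<close>

lemma prime_power_term:
  assumes p: "prime p" and j: "j \<in> {1..m}" and k: "k \<ge> 1"
  shows "asym_le (J 4 (\<lambda>z. euler_root p j (w + z) ^ k))
     (if real k * ln (real p) < V then exp (V * \<theta>) / sqrt (real p) * (64 * V ^ 4) else 0)"
proof -
  have p2: "p \<ge> 2" using p prime_ge_2_nat by blast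
  hence p0: "p > 0" by simp
  have lp: "ln (real p) > 0" using p2 by simp
  have eq: "J 4 (\<lambda>z. euler_root p j (w + z) ^ k) = (\<lambda>Y. euler_root p j w ^ k * J 4 (\<lambda>z. exp (- of_real (real k * ln (real p)) * z)) Y)"
    unfolding euler_root_power[OF p0] J_cmult ..
  show ?thesis
  proof (cases "real k * ln (real p) < V")
    case True
    have "norm (euler_root p j w ^ k) \<le> (real p powr (\<theta> - Re w)) ^ k"
      unfolding norm_power by (intro power_mono norm_euler_root_le p j) auto
    also have "\<dots> \<le> (real p powr (\<theta> - 1/2)) ^ k"
      using p2 u by (intro power_mono powr_mono) (auto simp: Re_w)
    also have "\<dots> = (real p powr \<theta>) ^ k * (real p powr (- (1/2))) ^ k"
      by (simp only: power_mult_distrib[symmetric] powr_add[symmetric]) simp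
    also have "\<dots> \<le> exp (V * \<theta>) * (real p powr (- (1/2))) ^ 1"
    proof (rule mult_mono)
      have "(real p powr \<theta>) ^ k = exp (\<theta> * (real k * ln (real p)))"
      proof -
        have "(real p powr \<theta>) ^ k = exp (\<theta> * ln (real p)) ^ k" using p0 by (simp add: powr_def)
        also have "\<dots> = exp (real k * (\<theta> * ln (real p)))" by (rule exp_of_nat_mult[symmetric])
        also have "real k * (\<theta> * ln (real p)) = \<theta> * (real k * ln (real p))" by simp
        finally show ?thesis .
      qed
      also have "\<dots> \<le> exp (\<theta> * V)" using True theta by (simp add: mult_left_mono)
      finally show "(real p powr \<theta>) ^ k \<le> exp (V * \<theta>)" by (simp add: mult.commute)
      have "real p powr (- (1/2)) \<le> real p powr 0" using p2 by (intro powr_mono) auto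
      thus "(real p powr (- (1/2))) ^ k \<le> (real p powr (- (1/2))) ^ 1"
        using k p2 by (intro power_decreasing) auto
    qed auto
    also have "(real p powr (- (1/2))) ^ 1 = 1 / sqrt (real p)"
      unfolding powr_minus by (simp add: powr_half_sqrt inverse_eq_divide)
    finally have c: "norm (euler_root p j w ^ k) \<le> exp (V * \<theta>) / sqrt (real p)" by simp
    have "asym_le (J 4 (\<lambda>z. euler_root p j (w + z) ^ k)) (norm (euler_root p j w ^ k) * (64 * V ^ 4))"
      unfolding eq using lp by (intro asym_le_cmult J_exp) auto
    moreover have "norm (euler_root p j w ^ k) * (64 * V ^ 4) \<le> exp (V * \<theta>) / sqrt (real p) * (64 * V ^ 4)"
      using c V6 by (intro mult_right_mono) auto
    ultimately show ?thesis using True by (simp only: if_True) (rule asym_le_mono)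
  next
    case False
    have "asym_le (J 4 (\<lambda>z. euler_root p j (w + z) ^ k)) (norm (euler_root p j w ^ k) * 0)"
      unfolding eq using False by (intro asym_le_cmult J_exp_large) auto
    thus ?thesis using False by simp
  qed
qed

text \<open>\<open>ln p \<ge> 2/3 > 1/2\<close> allows at most \<open>2 V\<close> exponents below
  the cutoff, and none if \<open>p\<close> itself is beyond it.\<close>

lemma card_prime_powers:
  assumes p: "prime p" and c: "c \<ge> 0"
  shows "(\<Sum>k=1..n. if real k * ln (real p) < V then c else 0) \<le> (if ln (real p) < V then 2 * V * c else 0)"
proof (cases "ln (real p) < V")
  case True
  have p2: "real p \<ge> 2" using p prime_ge_2_nat by auto
  have "2 / 3 \<le> ln (2 :: real)" by (rule ln2_ge_two_thirds)
  also have "\<dots> \<le> ln (real p)" using p2 by simp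
  finally have lp: "2 / 3 \<le> ln (real p)" .
  have "{k \<in> {1..n}. real k * ln (real p) < V} \<subseteq> {1..nat \<lfloor>2 * V\<rfloor>}"
  proof
    fix k assume "k \<in> {k \<in> {1..n}. real k * ln (real p) < V}"
    hence k: "k \<ge> 1" "real k * ln (real p) < V" by auto
    have "real k * (1 / 2) \<le> real k * ln (real p)" using lp by (intro mult_left_mono) auto
    hence "real k \<le> 2 * V" using k by argo
    thus "k \<in> {1..nat \<lfloor>2 * V\<rfloor>}" using k(1) by (simp add: le_nat_floor)
  qed
  hence "card {k \<in> {1..n}. real k * ln (real p) < V} \<le> card {1..nat \<lfloor>2 * V\<rfloor>}" by (intro card_mono) auto
  hence "real (card {k \<in> {1..n}. real k * ln (real p) < V}) \<le> real (nat \<lfloor>2 * V\<rfloor>)" by simp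
  also have "\<dots> \<le> 2 * V" using V6 by simp
  finally have "real (card {k \<in> {1..n}. real k * ln (real p) < V}) * c \<le> 2 * V * c"
    using c by (intro mult_right_mono) auto
  moreover have "(\<Sum>k=1..n. if real k * ln (real p) < V then c else 0) = (\<Sum>k \<in> {k \<in> {1..n}. real k * ln (real p) < V}. c)"
    by (subst sum.inter_filter) auto
  ultimately show ?thesis using True by simp
next
  case False
  have p2: "real p \<ge> 2" using p prime_ge_2_nat by auto
  have "\<not> real k * ln (real p) < V" if "k \<in> {1..n}" for k
  proof -
    have "1 * ln (real p) \<le> real k * ln (real p)" using that p2 by (intro mult_right_mono) auto
    thus ?thesis using False by simp
  qed
  thus ?thesis using False by simp
qed

text \<open>A truncation of \<open>L'/L\<close> at \<open>w + z\<close> to a finite sum of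
  exponentials, so that each term can be moved to its own line; the resulting bound depends on
  neither \<open>M\<close> nor \<open>n\<close>.\<close>

definition prime_poly :: "nat \<Rightarrow> nat \<Rightarrow> complex \<Rightarrow> complex" where
  "prime_poly M n z = (\<Sum>p | prime p \<and> p < M. - of_real (ln (real p)) * (\<Sum>j=1..m. \<Sum>k=1..n. euler_root p j (w + z) ^ k))"

lemma euler_root_continuous:
  assumes "prime p"
  shows "continuous_on A (\<lambda>z. euler_root p j (w + z))"
proof -
  have "p > 0" using assms prime_gt_0_nat by blast
  thus ?thesis unfolding euler_root_exp[OF \<open>p > 0\<close>] by (intro continuous_intros)
qed

lemma prime_poly_continuous: "continuous_on A (prime_poly M n)"
  unfolding prime_poly_def[abs_def] by (intro continuous_intros euler_root_continuous) auto

text \<open>Four powers of \<open>V\<close> come from the test function, one from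
  \<open>ln p < V\<close> and one from the number of exponents. The primes are majorised by all
  integers up to \<open>exp V\<close>, for which \<open>1 / sqrt n\<close> sums to at most
  \<open>2 exp (V/2)\<close>; hence \<open>256 = 64 * 2 * 2\<close>.\<close>

lemma J_prime_poly:
  "asym_le (J 4 (prime_poly M n)) (256 * real m * V ^ 6 * exp (V * (1/2 + \<theta>)))"
proof -
  define c where "c p = exp (V * \<theta>) / sqrt (real p) * (64 * V ^ 4)" for p :: nat
  have c0: "c p \<ge> 0" for p using V6 by (simp add: c_def)
  define P where "P = {p. prime p \<and> p < M}"
  have fP: "finite P" by (simp add: P_def)
  have V0: "V > 0" using V6 by simp
  have one: "asym_le (J 4 (\<lambda>z. - of_real (ln (real p)) * (\<Sum>j=1..m. \<Sum>k=1..n. euler_root p j (w + z) ^ k)))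
     (if ln (real p) < V then 128 * real m * V ^ 6 * exp (V * \<theta>) * (1 / sqrt (real p)) else 0)" if p: "p \<in> P" for p
  proof -
    have pr: "prime p" using p by (simp add: P_def)
    have lp: "ln (real p) \<ge> 0" using prime_ge_2_nat[OF pr] by simp
    have cont: "continuous_on UNIV (\<lambda>z. euler_root p j (w + z) ^ k)" for j k
      by (intro continuous_intros euler_root_continuous pr)
    have jj: "asym_le (J 4 (\<lambda>z. \<Sum>k=1..n. euler_root p j (w + z) ^ k)) (if ln (real p) < V then 2 * V * c p else 0)"
      if j: "j \<in> {1..m}" for j
    proof (rule asym_le_mono[OF _ card_prime_powers[OF pr c0]])
      have "J 4 (\<lambda>z. \<Sum>k=1..n. euler_root p j (w + z) ^ k) = (\<lambda>Y. \<Sum>k=1..n. J 4 (\<lambda>z. euler_root p j (w + z) ^ k) Y)"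
        by (rule ext) (rule J_sum[of _ UNIV]; use cont in auto)
      thus "asym_le (J 4 (\<lambda>z. \<Sum>k=1..n. euler_root p j (w + z) ^ k)) (\<Sum>k=1..n. if real k * ln (real p) < V then c p else 0)"
        unfolding c_def using prime_power_term[OF pr j] by (simp only:) (intro asym_le_sum, auto)
    qed
    have "J 4 (\<lambda>z. - of_real (ln (real p)) * (\<Sum>j=1..m. \<Sum>k=1..n. euler_root p j (w + z) ^ k))
      = (\<lambda>Y. - of_real (ln (real p)) * (\<Sum>j=1..m. J 4 (\<lambda>z. \<Sum>k=1..n. euler_root p j (w + z) ^ k) Y))"
      unfolding J_cmult
      by (rule ext) (rule arg_cong[where f = "\<lambda>y. _ * y"], rule J_sum[of _ UNIV], auto intro!: continuous_intros cont)
    hence "asym_le (J 4 (\<lambda>z. - of_real (ln (real p)) * (\<Sum>j=1..m. \<Sum>k=1..n. euler_root p j (w + z) ^ k)))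
      (norm (- complex_of_real (ln (real p))) * (\<Sum>j=1..m. if ln (real p) < V then 2 * V * c p else 0))"
      by (simp only:) (intro asym_le_cmult asym_le_sum jj)
    moreover have "norm (- complex_of_real (ln (real p))) * (\<Sum>j=1..m. if ln (real p) < V then 2 * V * c p else 0)
      \<le> (if ln (real p) < V then 128 * real m * V ^ 6 * exp (V * \<theta>) * (1 / sqrt (real p)) else 0)"
    proof (cases "ln (real p) < V")
      case True
      have "ln (real p) * (real m * (2 * V * c p)) \<le> V * (real m * (2 * V * c p))"
        using True V0 c0 by (intro mult_right_mono) auto
      also have "\<dots> = 128 * real m * V ^ 6 * exp (V * \<theta>) * (1 / sqrt (real p))"
        by (simp add: c_def eval_nat_numeral)
      finally show ?thesis using True lp by simp
    qed simp
    ultimately show ?thesis by (rule asym_le_mono)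
  qed
  have "J 4 (prime_poly M n) = (\<lambda>Y. \<Sum>p\<in>P. J 4 (\<lambda>z. - of_real (ln (real p)) * (\<Sum>j=1..m. \<Sum>k=1..n. euler_root p j (w + z) ^ k)) Y)"
    unfolding prime_poly_def[abs_def] P_def[symmetric]
    by (rule ext) (rule J_sum[of _ UNIV], use fP in \<open>auto intro!: continuous_intros euler_root_continuous simp: P_def\<close>)
  hence "asym_le (J 4 (prime_poly M n)) (\<Sum>p\<in>P. if ln (real p) < V then 128 * real m * V ^ 6 * exp (V * \<theta>) * (1 / sqrt (real p)) else 0)"
    by (simp only:) (intro asym_le_sum one)
  moreover have "(\<Sum>p\<in>P. if ln (real p) < V then 128 * real m * V ^ 6 * exp (V * \<theta>) * (1 / sqrt (real p)) else 0)
     \<le> 256 * real m * V ^ 6 * exp (V * (1/2 + \<theta>))"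
  proof -
    define q where "q = 128 * real m * V ^ 6 * exp (V * \<theta>)"
    have q0: "q \<ge> 0" using V0 by (simp add: q_def)
    have "(\<Sum>p\<in>P. if ln (real p) < V then q * (1 / sqrt (real p)) else 0) = (\<Sum>p\<in>{p \<in> P. ln (real p) < V}. q * (1 / sqrt (real p)))"
      using fP by (subst sum.inter_filter) auto
    also have "\<dots> \<le> (\<Sum>p\<in>{1..nat \<lfloor>exp V\<rfloor>}. q * (1 / sqrt (real p)))"
    proof (rule sum_mono2)
      show "{p \<in> P. ln (real p) < V} \<subseteq> {1..nat \<lfloor>exp V\<rfloor>}"
      proof
        fix p assume p: "p \<in> {p \<in> P. ln (real p) < V}"
        hence p2: "p \<ge> 2" using prime_ge_2_nat by (auto simp: P_def)
        have "real p = exp (ln (real p))" using p2 by simp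
        also have "\<dots> \<le> exp V" using p by (subst exp_le_cancel_iff) auto
        finally show "p \<in> {1..nat \<lfloor>exp V\<rfloor>}" using p2 by (simp add: le_nat_floor)
      qed
    qed (use q0 in auto)
    also have "\<dots> = q * (\<Sum>p\<in>{1..nat \<lfloor>exp V\<rfloor>}. 1 / sqrt (real p))" by (simp only: sum_distrib_left)
    also have "\<dots> \<le> q * (2 * sqrt (real (nat \<lfloor>exp V\<rfloor>)))" by (intro mult_left_mono sum_inverse_sqrt_le q0)
    also have "sqrt (real (nat \<lfloor>exp V\<rfloor>)) \<le> exp (V / 2)"
    proof -
      have "real (nat \<lfloor>exp V\<rfloor>) \<le> exp V" by (simp add: of_nat_floor)
      also have "\<dots> = (exp (V / 2))\<^sup>2" by (simp add: exp_double[symmetric])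
      finally show ?thesis by (simp add: real_le_lsqrt)
    qed
    hence "q * (2 * sqrt (real (nat \<lfloor>exp V\<rfloor>))) \<le> q * (2 * exp (V / 2))" using q0 by (intro mult_left_mono) auto
    also have "q * (2 * exp (V / 2)) = 256 * real m * V ^ 6 * exp (V * (1/2 + \<theta>))"
      by (simp add: q_def distrib_left exp_add)
    finally show ?thesis unfolding q_def by simp
  qed
  ultimately show ?thesis by (rule asym_le_mono)
qed

text \<open>\<open>M\<close> controls the tail over the primes and \<open>n\<close> the geometric
  remainders, each up to \<open>\<epsilon> / 2\<close> and uniformly on the line.\<close>

lemma L_logd_approx:
  assumes e: "\<epsilon> > 0"
  shows "\<exists>M n. \<forall>t. norm (L_logd (w + Complex 4 t) - prime_poly M n (Complex 4 t)) \<le> \<epsilon>"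
proof -
  have "\<epsilon> / 2 > 0" using e by simp
  from suminf_exist_split[OF this summable_prime_logd_bound] obtain M where
    M: "norm (\<Sum>p. 2 * real m * (1 / (real (p + M))\<^sup>2)) < \<epsilon> / 2" by blast
  define K where "K = (\<Sum>p | prime p \<and> p < M. \<bar>ln (real p)\<bar> * real m)"
  have K0: "K \<ge> 0" unfolding K_def by (intro sum_nonneg) auto
  have "\<epsilon> / (2 * (K + 1)) > 0" using e K0 by simp
  then obtain n where n: "(1 / 8 :: real) ^ n < \<epsilon> / (2 * (K + 1))" using real_arch_pow_inv[of _ "1/8"] by auto
  show ?thesis
  proof (intro exI allI)
    fix t
    define s where "s = w + Complex 4 t"
    have s: "Re s \<ge> 4" using u by (simp add: s_def Re_w)
    have 1: "norm (L_logd s - (\<Sum>p<M. prime_logd p s)) \<le> \<epsilon> / 2" using norm_L_logd_tail[OF s, of M] M by simp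
    have "(\<Sum>p<M. prime_logd p s) = (\<Sum>p | prime p \<and> p < M. prime_logd p s)"
      by (rule sum.mono_neutral_right) (auto simp: prime_logd_def)
    hence eq: "(\<Sum>p<M. prime_logd p s) - prime_poly M n (Complex 4 t) = 
      (\<Sum>p | prime p \<and> p < M. prime_logd p s - (- of_real (ln (real p)) * (\<Sum>j=1..m. \<Sum>k=1..n. euler_root p j s ^ k)))"
      unfolding prime_poly_def s_def[symmetric] sum_subtractf by simp
    note eq
    also have "norm \<dots> \<le> (\<Sum>p | prime p \<and> p < M. \<bar>ln (real p)\<bar> * real m * (1 / 8) ^ n)"
    proof (rule sum_norm_le)
      fix p assume "p \<in> {p. prime p \<and> p < M}"
      hence p: "prime p" by simp
      have "prime_logd p s - (- of_real (ln (real p)) * (\<Sum>j=1..m. \<Sum>k=1..n. euler_root p j s ^ k))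
        = - of_real (ln (real p)) * (\<Sum>j=1..m. euler_root p j s / (1 - euler_root p j s) - (\<Sum>k=1..n. euler_root p j s ^ k))"
        using p by (simp only: prime_logd_def if_True sum_subtractf right_diff_distrib)
      also have "norm \<dots> = \<bar>ln (real p)\<bar> * norm (\<Sum>j=1..m. euler_root p j s / (1 - euler_root p j s) - (\<Sum>k=1..n. euler_root p j s ^ k))"
        by (simp add: norm_mult)
      also have "\<dots> \<le> \<bar>ln (real p)\<bar> * (\<Sum>j=1..m. (1 / 8) ^ n)"
        by (intro mult_left_mono sum_norm_le geometric_remainder norm_euler_root_le_eighth p s) auto
      finally show "norm (prime_logd p s - (- of_real (ln (real p)) * (\<Sum>j=1..m. \<Sum>k=1..n. euler_root p j s ^ k))) \<le> \<bar>ln (real p)\<bar> * real m * (1 / 8) ^ n"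
        by simp
    qed
    also have "\<dots> = K * (1 / 8) ^ n" by (simp add: K_def sum_distrib_right)
    also have "\<dots> \<le> (K + 1) * (\<epsilon> / (2 * (K + 1)))" using n K0 by (intro mult_mono) auto
    also have "\<dots> = \<epsilon> / 2"
    proof -
      have "K + 1 \<noteq> 0" using K0 by simp
      thus ?thesis by (metis divide_divide_eq_left mult.commute nonzero_mult_div_cancel_left times_divide_eq_right)
    qed
    finally have 2: "norm ((\<Sum>p<M. prime_logd p s) - prime_poly M n (Complex 4 t)) \<le> \<epsilon> / 2" .
    have "norm (L_logd s - prime_poly M n (Complex 4 t)) \<le> norm (L_logd s - (\<Sum>p<M. prime_logd p s)) + norm ((\<Sum>p<M. prime_logd p s) - prime_poly M n (Complex 4 t))"
      using norm_triangle_ineq[of "L_logd s - (\<Sum>p<M. prime_logd p s)" "(\<Sum>p<M. prime_logd p s) - prime_poly M n (Complex 4 t)"] by simp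
    thus "norm (L_logd (w + Complex 4 t) - prime_poly M n (Complex 4 t)) \<le> \<epsilon>" using 1 2 unfolding s_def by argo
  qed
qed

text \<open>Defined by subtraction, so that it is holomorphic for \<open>Re z > - u\<close>; its
  splitting into poles and primes is used only to the right, for \<open>Re z > 7/2\<close>.\<close>

definition arith_logd :: "complex \<Rightarrow> complex" where "arith_logd z = logd (of_real u + z) - arch_logd (of_real u + z)"

lemma shift_holomorphic:
  assumes "g holomorphic_on {z. Re z > a}"
  shows "(\<lambda>z. g (of_real u + z)) holomorphic_on {z. Re z > a - u}"
  by (intro holomorphic_on_compose_gen[OF _ assms, unfolded o_def] holomorphic_intros) auto

lemma logd_holomorphic_right: "logd holomorphic_on {z. Re z > 0}"
  using f_nonzero by (intro logd_holomorphic) auto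

lemma arith_logd_holomorphic: "arith_logd holomorphic_on {z. Re z > - u}"
  unfolding arith_logd_def[abs_def] using shift_holomorphic[OF logd_holomorphic_right] shift_holomorphic[OF arch_logd_holomorphic]
  by (intro holomorphic_intros) (auto intro: holomorphic_on_subset)

lemma polar_holomorphic: "polar holomorphic_on {z. Re z > 1/2}"
proof -
  have "z + 1/2 \<noteq> 0" "z + (- 1/2) \<noteq> 0" if "Re z > 1/2" for z
    using that by (auto simp: complex_eq_iff)
  moreover have "z + (1/2 + \<mu> j) \<noteq> 0" if "Re z > 1/2" "j \<in> {1..m}" for z j
    using that Re_spectral[of j] by (auto simp: complex_eq_iff)
  ultimately show ?thesis unfolding polar_def[abs_def] by (intro holomorphic_intros) auto
qed

lemma arith_logd_eq:
  assumes "Re z > 7/2"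
  shows "arith_logd z = polar (of_real u + z) + L_logd (w + z)"
proof -
  have eq: "w + z = 1/2 + (of_real u + z)" by (simp add: w_def)
  have "Re (of_real u + z) > 7/2" using assms u by simp
  from logd_eq[OF this] show ?thesis unfolding arith_logd_def eq by simp
qed

lemma J_polar: "asym_le (J 4 (\<lambda>z. polar (of_real u + z))) (576 * real m * V ^ 5 * exp (V / 2))"
proof -
  define q where "q = 192 * V ^ 5 * exp (V / 2)"
  define P where "P b z = 1 / (z + (b + of_real u))" for b z :: complex
  have q0: "q \<ge> 0" using V6 by (simp add: q_def)
  define S where "S = {z. Re z > 1/2}"
  have cont: "continuous_on S (P b)" if "Re b \<ge> - 1/2" for b
  proof -
    have "z + (b + of_real u) \<noteq> 0" if "Re z > 1/2" for z
      using that \<open>Re b \<ge> - 1/2\<close> u by (auto simp: complex_eq_iff)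
    thus ?thesis unfolding P_def[abs_def] S_def by (intro continuous_intros) auto
  qed
  have le: "asym_le (J 4 (P b)) q" if "Re b \<ge> - 1/2" for b
    unfolding P_def[abs_def] q_def using that u by (intro J_simple_pole) auto
  have b: "Re (1/2) \<ge> - 1/2" "Re (- 1/2) \<ge> - 1/2" "j \<in> {1..m} \<Longrightarrow> Re (1/2 + \<mu> j) \<ge> - 1/2" for j
    using Re_spectral[of j] by auto
  have pol: "(\<lambda>z. polar (of_real u + z)) = (\<lambda>z. (of_nat r * P (1/2) z + of_nat r * P (- 1/2) z) + (- 1) * (\<Sum>j=1..m. P (1/2 + \<mu> j) z))"
    by (auto simp: polar_def P_def fun_eq_iff add_ac)
  have line: "Complex 4 t \<in> S" for t by (simp add: S_def)
  have "J 4 (\<lambda>z. polar (of_real u + z)) = 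
    (\<lambda>Y. (of_nat r * J 4 (P (1/2)) Y + of_nat r * J 4 (P (- 1/2)) Y) + (- 1) * (\<Sum>j=1..m. J 4 (P (1/2 + \<mu> j)) Y))"
  proof
    fix Y
    have 1: "J 4 (\<lambda>z. (of_nat r * P (1/2) z + of_nat r * P (- 1/2) z) + (- 1) * (\<Sum>j=1..m. P (1/2 + \<mu> j) z)) Y =
      J 4 (\<lambda>z. of_nat r * P (1/2) z + of_nat r * P (- 1/2) z) Y + J 4 (\<lambda>z. (- 1) * (\<Sum>j=1..m. P (1/2 + \<mu> j) z)) Y"
      by (rule J_add[of S]) (auto intro!: continuous_intros cont b line)
    have 2: "J 4 (\<lambda>z. of_nat r * P (1/2) z + of_nat r * P (- 1/2) z) Y = J 4 (\<lambda>z. of_nat r * P (1/2) z) Y + J 4 (\<lambda>z. of_nat r * P (- 1/2) z) Y"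
      by (rule J_add[of S]) (auto intro!: continuous_intros cont b line)
    have 3: "J 4 (\<lambda>z. \<Sum>j=1..m. P (1/2 + \<mu> j) z) Y = (\<Sum>j=1..m. J 4 (P (1/2 + \<mu> j)) Y)"
      by (rule J_sum[of _ S]) (auto intro!: cont b line)
    show "J 4 (\<lambda>z. polar (of_real u + z)) Y = (of_nat r * J 4 (P (1/2)) Y + of_nat r * J 4 (P (- 1/2)) Y) + (- 1) * (\<Sum>j=1..m. J 4 (P (1/2 + \<mu> j)) Y)"
      unfolding pol 1 2 J_cmult 3 ..
  qed
  hence "asym_le (J 4 (\<lambda>z. polar (of_real u + z))) ((norm (of_nat r :: complex) * q + norm (of_nat r :: complex) * q) + norm (- 1 :: complex) * (\<Sum>j=1..m. q))"
    by (simp only:) (intro asym_le_add asym_le_cmult asym_le_sum le b)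
  moreover have "(norm (of_nat r :: complex) * q + norm (of_nat r :: complex) * q) + norm (- 1 :: complex) * (\<Sum>j=1..m. q) \<le> 576 * real m * V ^ 5 * exp (V / 2)"
  proof -
    have "real r * q \<le> real m * q" using r_le q0 by (intro mult_right_mono) auto
    hence "(real r * q + real r * q) + real m * q \<le> 3 * (real m * q)" by linarith
    thus ?thesis by (simp add: q_def mult_ac)
  qed
  ultimately show ?thesis by (rule asym_le_mono)
qed

lemma J_arith_logd: "asym_le (J 0 arith_logd) (832 * real m * V ^ 6 * exp (V * (1/2 + \<theta>)))"
proof -
  define S where "S = {z. Re z > 7/2}"
  have line: "Complex 4 t \<in> S" for t by (simp add: S_def)
  have cp: "continuous_on S (\<lambda>z. polar (of_real u + z))"
  proof (rule holomorphic_on_imp_continuous_on, rule holomorphic_on_subset[OF shift_holomorphic[OF polar_holomorphic]])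
    show "S \<subseteq> {z. Re z > 1/2 - u}" using u by (auto simp: S_def)
  qed
  have cA: "continuous_on S arith_logd"
  proof (rule holomorphic_on_imp_continuous_on, rule holomorphic_on_subset[OF arith_logd_holomorphic])
    show "S \<subseteq> {z. Re z > - u}" using u by (auto simp: S_def)
  qed
  have cD: "continuous_on S (\<lambda>z. L_logd (w + z))"
  proof -
    have "continuous_on S (\<lambda>z. arith_logd z - polar (of_real u + z))" by (intro continuous_intros cA cp)
    moreover have "arith_logd z - polar (of_real u + z) = L_logd (w + z)" if "z \<in> S" for z
      using arith_logd_eq[of z] that by (simp add: S_def)
    ultimately show ?thesis by (subst (asm) continuous_on_cong[OF refl]) auto
  qed
  have "asym_le (J 4 (\<lambda>z. L_logd (w + z))) (256 * real m * V ^ 6 * exp (V * (1/2 + \<theta>)))"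
  proof (rule J_uniform_limit[OF cD line])
    fix \<epsilon> :: real assume "\<epsilon> > 0"
    then obtain M n where "\<forall>t. norm (L_logd (w + Complex 4 t) - prime_poly M n (Complex 4 t)) \<le> \<epsilon>" using L_logd_approx by blast
    thus "\<exists>G'. continuous_on S G' \<and> asym_le (J 4 G') (256 * real m * V ^ 6 * exp (V * (1/2 + \<theta>)))
        \<and> (\<forall>t. norm (L_logd (w + Complex 4 t) - G' (Complex 4 t)) \<le> \<epsilon>)"
      using prime_poly_continuous J_prime_poly by blast
  qed
  from asym_le_add[OF J_polar this]
  have "asym_le (\<lambda>Y. J 4 (\<lambda>z. polar (of_real u + z)) Y + J 4 (\<lambda>z. L_logd (w + z)) Y)
    (576 * real m * V ^ 5 * exp (V / 2) + 256 * real m * V ^ 6 * exp (V * (1/2 + \<theta>)))" .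
  also have "(\<lambda>Y. J 4 (\<lambda>z. polar (of_real u + z)) Y + J 4 (\<lambda>z. L_logd (w + z)) Y) = J 4 arith_logd"
  proof
    fix Y
    have "J 4 (\<lambda>z. polar (of_real u + z) + L_logd (w + z)) Y = J 4 (\<lambda>z. polar (of_real u + z)) Y + J 4 (\<lambda>z. L_logd (w + z)) Y"
      by (rule J_add[OF cp cD line])
    moreover have "J 4 (\<lambda>z. polar (of_real u + z) + L_logd (w + z)) Y = J 4 arith_logd Y"
      unfolding J_def vint_def by (simp add: arith_logd_eq)
    ultimately show "J 4 (\<lambda>z. polar (of_real u + z)) Y + J 4 (\<lambda>z. L_logd (w + z)) Y = J 4 arith_logd Y" by simp
  qed
  finally have J4: "asym_le (J 4 arith_logd) (576 * real m * V ^ 5 * exp (V / 2) + 256 * real m * V ^ 6 * exp (V * (1/2 + \<theta>)))" .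
  obtain C R0 where "symmetric_halfplane f (root_number L) C R0" using symmetric by blast
  then interpret symmetric_halfplane f "root_number L" C R0 .
  \<comment> \<open>At least 5, so that \<open>u + Re z \<le> c\<close> whenever
    \<open>Re z \<le> 4\<close>.\<close>
  define c where "c = max (max R0 5) 5"
  obtain K1 where K1: "\<And>z. u \<le> Re z \<Longrightarrow> Re z \<le> c \<Longrightarrow> norm (logd z) \<le> K1 * (1 + \<bar>Im z\<bar>)"
  proof -
    have "u \<le> c" "R0 \<le> c" unfolding c_def using u by auto
    from logd_strip_bound[OF u(1) this(2,1)] show ?thesis using that by blast
  qed
  obtain K2 where K2: "\<And>z. 0 \<le> Re z \<Longrightarrow> Re z \<le> c \<Longrightarrow> norm (arch_logd z) \<le> K2 * (1 + \<bar>Im z\<bar>)"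
    using arch_logd_linear_bound by blast
  have bd: "norm (arith_logd z) \<le> (K1 + K2) * (1 + \<bar>Im z\<bar>)" if z: "0 \<le> Re z" "Re z \<le> 4" for z
  proof -
    have "norm (arith_logd z) \<le> norm (logd (of_real u + z)) + norm (arch_logd (of_real u + z))" unfolding arith_logd_def by (rule norm_triangle_ineq4)
    also have "\<dots> \<le> K1 * (1 + \<bar>Im (of_real u + z)\<bar>) + K2 * (1 + \<bar>Im (of_real u + z)\<bar>)"
      using z u by (intro add_mono K1 K2) (auto simp: c_def)
    finally show ?thesis by (simp add: distrib_right)
  qed
  have "asym_le (J 0 arith_logd) (576 * real m * V ^ 5 * exp (V / 2) + 256 * real m * V ^ 6 * exp (V * (1/2 + \<theta>)))"
    by (rule asym_le_close[OF J4], rule J_shift[OF arith_logd_holomorphic]) (use u bd in auto)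
  moreover have "576 * real m * V ^ 5 * exp (V / 2) \<le> 576 * real m * V ^ 6 * exp (V * (1/2 + \<theta>))"
    using V6 theta by (intro mult_mono) (auto intro!: power_increasing mult_nonneg_nonneg)
  ultimately show ?thesis by (elim asym_le_mono) linarith
qed

end

section \<open>The conductor and the lowest zero\<close>

lemma Re_vint:
  assumes "continuous_on S g" "\<And>t. Complex c t \<in> S"
  shows "Re (vint c Y g) = integral {-Y..Y} (\<lambda>t. Re (g (Complex c t)))"
    and "(\<lambda>t. Re (g (Complex c t))) integrable_on {-Y..Y}"
proof -
  note i = vint_integrable[OF assms, of Y]
  show "Re (vint c Y g) = integral {-Y..Y} (\<lambda>t. Re (g (Complex c t)))"
    unfolding vint_def using integral_linear[OF i bounded_linear_Re] by (simp add: o_def)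
  show "(\<lambda>t. Re (g (Complex c t))) integrable_on {-Y..Y}"
    using integrable_linear[OF i bounded_linear_Re] by (simp add: o_def)
qed

context L_fun
begin

lemma conductor_pos: "analytic_conductor L > 0"
  unfolding analytic_conductor_def using N_pos by (intro mult_pos_pos prod_pos) (auto intro: add_nonneg_pos)

lemma ln_conductor: "ln (analytic_conductor L) = ln (real N) + (\<Sum>j=1..m. ln (norm (\<mu> j) + 3))"
proof -
  have pos: "norm (\<mu> j) + 3 > 0" for j by (rule add_nonneg_pos) auto
  have "(\<Prod>j=1..m. norm (\<mu> j) + 3) > 0" using pos by (intro prod_pos) auto
  hence "ln (analytic_conductor L) = ln (real N) + ln (\<Prod>j=1..m. norm (\<mu> j) + 3)"
    unfolding analytic_conductor_def using N_pos by (intro ln_mult_pos) auto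
  also have "ln (\<Prod>j=1..m. norm (\<mu> j) + 3) = (\<Sum>j=1..m. ln (norm (\<mu> j) + 3))"
    by (intro ln_prod) (auto simp: add_nonneg_eq_0_iff)
  finally show ?thesis .
qed

lemma ln_conductor_nonneg: "ln (analytic_conductor L) \<ge> 0"
proof -
  have "ln (norm (\<mu> j) + 3) \<ge> 0" for j by (intro ln_ge_zero) (use norm_ge_zero[of "\<mu> j"] in linarith)
  thus ?thesis unfolding ln_conductor using N_pos by (intro add_nonneg_nonneg sum_nonneg) auto
qed

text \<open>Stirling in the form \<open>Re (Digamma w) = ln (norm w) + O(1)\<close>, combined with
  \<open>norm w \<le> a (1 + t)\<close> and \<open>a \<le> 11 norm w (1 + t)\<close>. The loss
  \<open>ln (1 + t)\<close> goes into the square root, and the constant is free of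
  \<open>\<mu> j\<close>.\<close>

lemma digamma_spectral_bound:
  assumes z: "0 \<le> Re z" "Re z \<le> 1" and j: "j \<in> {1..m}"
  shows "\<bar>Re (Digamma ((1/2 + z + \<mu> j) / 2 + 1) / 2) - ln pi / 2 - ln (norm (\<mu> j) + 3) / 2\<bar>
    \<le> (digamma_bound + 10) * (1 + \<bar>Im z\<bar>) powr (1/2)"
proof -
  define w a t where "w = (1/2 + z + \<mu> j) / 2 + 1" and "a = norm (\<mu> j) + 3" and "t = \<bar>Im z\<bar>"
  define q where "q = (1 + t) powr (1/2)"
  have t: "t \<ge> 0" by (simp add: t_def)
  have q1: "q \<ge> 1" unfolding q_def using t by (intro ge_one_powr_ge_zero) auto
  have a3: "a \<ge> 3" by (simp add: a_def)
  have nz: "norm z \<le> 1 + t" using cmod_le[of z] z by (simp add: t_def)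
  have "norm (1/2 + z) \<le> 1/2 + norm z" using norm_triangle_ineq[of "1/2" z] by simp
  hence n1: "norm (1/2 + z + \<mu> j) \<le> 1/2 + (1 + t) + (a - 3)"
    using nz norm_triangle_ineq[of "1/2 + z" "\<mu> j"] unfolding a_def by argo
  have "norm w \<le> norm ((1/2 + z + \<mu> j) / 2) + norm (1 :: complex)" unfolding w_def by (rule norm_triangle_ineq)
  also have "\<dots> = norm (1/2 + z + \<mu> j) / 2 + 1" by (simp add: norm_divide)
  finally have "norm w \<le> a + a * t"
  proof -
    assume h: "norm w \<le> norm (1/2 + z + \<mu> j) / 2 + 1"
    have "1 * t \<le> a * t" using a3 t by (intro mult_right_mono) auto
    thus ?thesis using h n1 a3 t by argo
  qed
  hence up: "norm w \<le> a * (1 + t)" by (simp add: distrib_left)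
  have wh: "norm w \<ge> 3/4"
    using arch_logd_arg[OF z(1) j] complex_Re_le_cmod[of w] unfolding w_def by linarith
  have "\<mu> j = 2 * w - (2 + 1/2 + z)" by (simp add: w_def field_simps)
  hence "norm (\<mu> j) \<le> norm (2 * w) + norm (2 + 1/2 + z)" by (metis norm_triangle_ineq4)
  moreover have "norm (2 * w) = 2 * norm w" by (simp add: norm_mult)
  moreover have "norm (2 + 1/2 + z) \<le> 5/2 + norm z" using norm_triangle_ineq[of "2 + 1/2" z] by simp
  ultimately have "a \<le> 2 * norm w + 13/2 + t" using nz unfolding a_def by argo
  \<comment> \<open>By \<open>norm w \<ge> 3/4\<close>, both \<open>9 norm w \<ge> 13/2\<close> and
    \<open>11 norm w \<ge> 1\<close>.\<close>
  also have "\<dots> \<le> 11 * norm w + 11 * norm w * t"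
  proof -
    have "11 * (3/4) * t \<le> 11 * norm w * t" using wh t by (intro mult_right_mono) auto
    thus ?thesis using wh t by argo
  qed
  finally have low: "a \<le> 11 * (norm w * (1 + t))" by (simp add: distrib_left)
  have w0: "norm w > 0" using wh by linarith
  have "ln (norm w) \<le> ln (a * (1 + t))" using up w0 by (intro ln_mono) auto
  also have "\<dots> = ln a + ln (1 + t)" using a3 t by (intro ln_mult_pos) auto
  finally have u1: "ln (norm w) \<le> ln a + ln (1 + t)" .
  have "ln a \<le> ln (11 * (norm w * (1 + t)))" using low a3 by (intro ln_mono) auto
  also have "\<dots> = ln 11 + (ln (norm w) + ln (1 + t))"
    using w0 t by (subst ln_mult_pos; simp?; subst ln_mult_pos; simp)
  finally have u2: "ln a \<le> ln 11 + (ln (norm w) + ln (1 + t))" .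
  have l11: "ln 11 \<le> (10 :: real)" using ln_le_minus_one[of "11 :: real"] by simp
  have lpi: "0 \<le> ln pi" "ln pi \<le> 3" using ln_le_minus_one[of pi] pi_less_4 pi_gt3 by auto
  have l1t: "ln (1 + t) \<le> 2 * q" using ln_le_sqrt[of "Im z"] by (simp add: t_def q_def)
  have d: "\<bar>Re (Digamma w) - ln (norm w)\<bar> \<le> digamma_bound"
    unfolding w_def by (rule Re_Digamma_bounds[OF arch_logd_arg_half[OF z(1) j]])
  have d1: "Re (Digamma w) - ln (norm w) \<le> digamma_bound" "ln (norm w) - Re (Digamma w) \<le> digamma_bound"
    using d by (simp_all add: abs_le_iff)
  have dq: "digamma_bound * 1 \<le> digamma_bound * q" using q1 digamma_bound_nonneg by (intro mult_left_mono) auto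
  have "Re (Digamma w) / 2 - ln pi / 2 - ln a / 2 \<le> digamma_bound + q"
    using d1 u1 l1t lpi digamma_bound_nonneg by argo
  moreover have "- (Re (Digamma w) / 2 - ln pi / 2 - ln a / 2) \<le> digamma_bound + q + 7"
    using d1 u2 l11 l1t lpi digamma_bound_nonneg by argo
  ultimately have "\<bar>Re (Digamma w) / 2 - ln pi / 2 - ln a / 2\<bar> \<le> digamma_bound + q + 7" by linarith
  also have "\<dots> \<le> (digamma_bound + 10) * q" using dq q1 by (simp add: distrib_right)
  finally show ?thesis by (simp add: w_def a_def q_def t_def)
qed

lemma Re_arch_logd_approx:
  assumes z: "0 \<le> Re z" "Re z \<le> 1"
  shows "\<bar>Re (arch_logd z) - ln (analytic_conductor L) / 2\<bar> \<le> real m * (digamma_bound + 10) * (1 + \<bar>Im z\<bar>) powr (1/2)"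
proof -
  have "Re (arch_logd z) - ln (analytic_conductor L) / 2 =
    (\<Sum>j=1..m. Re (Digamma ((1/2 + z + \<mu> j) / 2 + 1) / 2) - ln pi / 2 - ln (norm (\<mu> j) + 3) / 2)"
    unfolding arch_logd_def ln_conductor by (simp add: Re_sum sum_subtractf sum_divide_distrib add_divide_distrib)
  also have "\<bar>\<dots>\<bar> \<le> (\<Sum>j=1..m. (digamma_bound + 10) * (1 + \<bar>Im z\<bar>) powr (1/2))"
    by (rule order_trans[OF sum_abs sum_mono]) (rule digamma_spectral_bound[OF z])
  finally show ?thesis by simp
qed

end

context L_fun_kernel
begin

lemma testfun_line: "testfun V (Complex 0 t) = of_real (Re (testfun V (Complex 0 t)))"
proof -
  have "Complex 0 t = \<i> * of_real t" by (simp add: complex_eq_iff)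
  thus ?thesis using testfun_imaginary[of V t] by (metis Re_complex_of_real)
qed

text \<open>Against a real test function only \<open>Re arch_logd\<close> counts, and it is half the
  logarithm of the conductor up to an error of square root growth in \<open>t\<close>. That
  logarithm is nonnegative, so the lower bound for the integral of the test function may be
  multiplied by it.\<close>

lemma J_arch_logd:
  assumes Y: "Y \<ge> 1"
  shows "Re (J 0 (\<lambda>z. arch_logd (of_real u + z)) Y) \<ge>
    ln (analytic_conductor L) / 2 * (1 / (2 * pi) - 6 / Y) - 64 * V ^ 4 * (real m * (digamma_bound + 10))"
proof -
  define S where "S = {z. Re z > - 1 - u}"
  define l where "l = ln (analytic_conductor L) / 2"
  \<comment> \<open>Not holomorphic, but its integral is estimated on the line itself and never
    moved.\<close>
  define G where "G z = complex_of_real (Re (arch_logd (of_real u + z)) - l)" for z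
  have line: "Complex 0 t \<in> S" for t using u by (simp add: S_def)
  have cB: "continuous_on S (\<lambda>z. arch_logd (of_real u + z))"
    unfolding S_def by (rule holomorphic_on_imp_continuous_on[OF shift_holomorphic[OF arch_logd_holomorphic]])
  have cG: "continuous_on S G" unfolding G_def by (intro continuous_intros cB)
  have "norm (J 0 G Y) \<le> 64 * V ^ 4 * exp (V * 0) * (real m * (digamma_bound + 10))"
  proof (rule J_line_bound[OF cG line Y])
    fix t :: real
    have "\<bar>Re (arch_logd (of_real u + Complex 0 t)) - l\<bar> \<le> real m * (digamma_bound + 10) * (1 + \<bar>Im (of_real u + Complex 0 t)\<bar>) powr (1/2)"
      unfolding l_def by (rule Re_arch_logd_approx) (use u in auto)
    thus "norm (G (Complex 0 t)) \<le> real m * (digamma_bound + 10) * (1 + \<bar>t\<bar>) powr (1/2)"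
      unfolding G_def norm_of_real by simp
  qed simp
  hence G: "Re (J 0 G Y) \<ge> - (64 * V ^ 4 * (real m * (digamma_bound + 10)))"
    using abs_Re_le_cmod[of "J 0 G Y"] by simp
  have cont: "continuous_on S (\<lambda>z. testfun V z * g z)" if "continuous_on S g" for g
    by (intro continuous_intros testfun_continuous that)
  have pt: "Re (testfun V (Complex 0 t) * arch_logd (of_real u + Complex 0 t)) = 
      Re (testfun V (Complex 0 t) * G (Complex 0 t)) + l * Re (testfun V (Complex 0 t))" for t
    by (subst (1 2) testfun_line) (simp add: G_def algebra_simps)
  have r: "Re (vint 0 Y (testfun V)) = integral {-Y..Y} (\<lambda>t. Re (testfun V (Complex 0 t)))"
    by (rule Re_vint(1)[OF testfun_continuous UNIV_I])
  have i: "(\<lambda>t. Re (testfun V (Complex 0 t))) integrable_on {-Y..Y}"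
    by (rule Re_vint(2)[OF testfun_continuous UNIV_I])
  have "Re (J 0 (\<lambda>z. arch_logd (of_real u + z)) Y) = integral {-Y..Y} (\<lambda>t. Re (testfun V (Complex 0 t) * G (Complex 0 t)) + l * Re (testfun V (Complex 0 t)))"
    unfolding J_def Re_vint(1)[OF cont[OF cB] line] pt ..
  also have "\<dots> = integral {-Y..Y} (\<lambda>t. Re (testfun V (Complex 0 t) * G (Complex 0 t))) + integral {-Y..Y} (\<lambda>t. l * Re (testfun V (Complex 0 t)))"
    by (intro integral_add Re_vint(2)[OF cont[OF cG] line] integrable_on_mult_right i)
  also have "\<dots> = Re (J 0 G Y) + l * Re (vint 0 Y (testfun V))"
    unfolding J_def Re_vint(1)[OF cont[OF cG] line] r by simp
  finally have "Re (J 0 (\<lambda>z. arch_logd (of_real u + z)) Y) = Re (J 0 G Y) + l * Re (vint 0 Y (testfun V))" .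
  moreover have "l * (1 / (2 * pi) - 6 / Y) \<le> l * Re (vint 0 Y (testfun V))"
    using ln_conductor_nonneg testfun_integral_lower_bound[OF V Y] by (intro mult_left_mono) (auto simp: l_def)
  ultimately show ?thesis using G unfolding l_def by linarith
qed

text \<open>For \<open>t\<close> above the threshold the test function is nonpositive and
  \<open>Re logd\<close> nonnegative, so that range, which may contain zeros, contributes nothing
  positive; below it the size is at most \<open>\<eta>\<close>.\<close>

lemma J_logd_upper:
  assumes \<eta>: "\<eta> \<ge> 0" and small: "\<And>t. t\<^sup>2 \<le> (pi / V)\<^sup>2 * (1 + 1 / V) \<Longrightarrow> \<bar>Re (logd (Complex u t))\<bar> \<le> \<eta>" and Y: "Y \<ge> 1"
  shows "Re (J 0 (\<lambda>z. logd (of_real u + z)) Y) \<le> 64 * V ^ 4 * \<eta>"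
proof -
  obtain C R0 where "symmetric_halfplane f (root_number L) C R0" using symmetric by blast
  then interpret symmetric_halfplane f "root_number L" C R0 .
  define S where "S = {z. Re z > 0 - u}"
  have line: "Complex 0 t \<in> S" for t using u by (simp add: S_def)
  have c: "continuous_on S (\<lambda>z. logd (of_real u + z))"
    unfolding S_def by (rule holomorphic_on_imp_continuous_on[OF shift_holomorphic[OF logd_holomorphic_right]])
  have c': "continuous_on S (\<lambda>z. testfun V z * logd (of_real u + z))" by (intro continuous_intros testfun_continuous c)
  have le: "Re (testfun V (Complex 0 t) * logd (of_real u + Complex 0 t)) \<le> 16 * V ^ 4 * \<eta> * (1 + \<bar>t\<bar>) powr (-3/2)" for t
  proof -
    define h where "h = Re (testfun V (Complex 0 t))"
    have it: "Complex 0 t = \<i> * of_real t" by (simp add: complex_eq_iff)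
    have ut: "of_real u + Complex 0 t = Complex u t" by (simp add: complex_eq_iff)
    have e: "Re (testfun V (Complex 0 t) * logd (of_real u + Complex 0 t)) = h * Re (logd (Complex u t))"
      unfolding ut by (subst testfun_line) (simp add: h_def)
    have R: "16 * V ^ 4 * \<eta> * (1 + \<bar>t\<bar>) powr (-3/2) \<ge> 0" using \<eta> V6 by (intro mult_nonneg_nonneg) auto
    show ?thesis
    proof (cases "t\<^sup>2 \<le> (pi / V)\<^sup>2 * (1 + 1 / V)")
      case True
      have "h * Re (logd (Complex u t)) \<le> \<bar>h\<bar> * \<bar>Re (logd (Complex u t))\<bar>" by (simp add: abs_mult[symmetric])
      also have "\<dots> \<le> (16 * V ^ 4 / (1 + \<bar>t\<bar>)\<^sup>2) * \<eta>"
      proof (rule mult_mono[OF _ small[OF True]])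
        show "\<bar>h\<bar> \<le> 16 * V ^ 4 / (1 + \<bar>t\<bar>)\<^sup>2"
          using order_trans[OF abs_Re_le_cmod norm_testfun_le[OF V, of "Complex 0 t"]] by (simp add: h_def)
      qed (use V6 in auto)
      also have "\<dots> = 16 * V ^ 4 * \<eta> * (1 / (1 + \<bar>t\<bar>)\<^sup>2)" by simp
      also have "\<dots> \<le> 16 * V ^ 4 * \<eta> * (1 + \<bar>t\<bar>) powr (-3/2)"
      proof (rule mult_left_mono)
        have "1 / (1 + \<bar>t\<bar>)\<^sup>2 = (1 + \<bar>t\<bar>) powr (-2)" by (simp add: powr_minus powr_numeral inverse_eq_divide)
        also have "\<dots> \<le> (1 + \<bar>t\<bar>) powr (-3/2)" by (intro powr_mono) auto
        finally show "1 / (1 + \<bar>t\<bar>)\<^sup>2 \<le> (1 + \<bar>t\<bar>) powr (-3/2)" .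
      qed (use \<eta> V6 in auto)
      finally show ?thesis unfolding e .
    next
      case False
      have "h = ((pi / V)\<^sup>2 * (1 + 1 / V) - t\<^sup>2) * (Re (ker V (\<i> * of_real t)))\<^sup>2"
        unfolding h_def it testfun_imaginary by (rule Re_complex_of_real)
      hence "h \<le> 0" using False by (simp add: mult_nonpos_nonneg)
      moreover have "Re (logd (Complex u t)) \<ge> 0" using u by (intro logd_nonneg) simp
      ultimately have "h * Re (logd (Complex u t)) \<le> 0" by (rule mult_nonpos_nonneg)
      thus ?thesis unfolding e using R by linarith
    qed
  qed
  have dec: "((\<lambda>t. 16 * V ^ 4 * \<eta> * (1 + \<bar>t\<bar>) powr (-3/2)) has_integral 16 * V ^ 4 * \<eta> * (4 - 4 * (1 + Y) powr (-1/2))) {-Y..Y}"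
    using Y by (intro has_integral_mult_right has_integral_decay) simp
  have "Re (J 0 (\<lambda>z. logd (of_real u + z)) Y) = integral {-Y..Y} (\<lambda>t. Re (testfun V (Complex 0 t) * logd (of_real u + Complex 0 t)))"
    unfolding J_def by (rule Re_vint(1)[OF c' line])
  also have "\<dots> \<le> 16 * V ^ 4 * \<eta> * (4 - 4 * (1 + Y) powr (-1/2))"
    by (rule has_integral_le[OF integrable_integral[OF Re_vint(2)[OF c' line]] dec]) (rule le)
  also have "\<dots> \<le> 16 * V ^ 4 * \<eta> * 4" using \<eta> V6 by (intro mult_left_mono) auto
  finally show ?thesis by simp
qed

lemma conductor_bound_shifted:
  assumes \<eta>: "\<eta> \<ge> 0" and small: "\<And>t. t\<^sup>2 \<le> (pi / V)\<^sup>2 * (1 + 1 / V) \<Longrightarrow> \<bar>Re (logd (Complex u t))\<bar> \<le> \<eta>"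
  shows "ln (analytic_conductor L) / (4 * pi) \<le> 
    64 * V ^ 4 * (real m * (digamma_bound + 10)) + 832 * real m * V ^ 6 * exp (V * (1/2 + \<theta>)) + 1 + 64 * V ^ 4 * \<eta>"
proof -
  define l where "l = ln (analytic_conductor L)"
  have "eventually (\<lambda>Y. norm (J 0 arith_logd Y) \<le> 832 * real m * V ^ 6 * exp (V * (1/2 + \<theta>)) + 1/2) at_top"
    using J_arith_logd unfolding asym_le_def by (elim allE[of _ "1/2"]) auto
  \<comment> \<open>This makes \<open>3 l / Y\<close> at most 1/2; with the 1/2 above it accounts
    for the summand 1 in the claim.\<close>
  moreover have "eventually (\<lambda>Y. Y \<ge> max 1 (6 * \<bar>l\<bar>)) at_top" by (rule eventually_ge_at_top)
  ultimately have "eventually (\<lambda>Y. norm (J 0 arith_logd Y) \<le> 832 * real m * V ^ 6 * exp (V * (1/2 + \<theta>)) + 1/2 \<and> Y \<ge> max 1 (6 * \<bar>l\<bar>)) at_top"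
    by (rule eventually_conj)
  then obtain Y where YA: "norm (J 0 arith_logd Y) \<le> 832 * real m * V ^ 6 * exp (V * (1/2 + \<theta>)) + 1/2" and "Y \<ge> max 1 (6 * \<bar>l\<bar>)"
    using eventually_happens'[OF trivial_limit_at_top_linorder] by blast
  hence Y: "Y \<ge> 1" "6 * l \<le> Y" by auto
  define S where "S = {z. Re z > - u}"
  have line: "Complex 0 t \<in> S" for t using u by (simp add: S_def)
  have cA: "continuous_on S arith_logd" unfolding S_def by (rule holomorphic_on_imp_continuous_on[OF arith_logd_holomorphic])
  have cB: "continuous_on S (\<lambda>z. arch_logd (of_real u + z))"
    by (rule holomorphic_on_imp_continuous_on, rule holomorphic_on_subset[OF shift_holomorphic[OF arch_logd_holomorphic]]) (auto simp: S_def)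
  have "J 0 (\<lambda>z. logd (of_real u + z)) Y = J 0 (\<lambda>z. arch_logd (of_real u + z) + arith_logd z) Y" by (simp add: arith_logd_def)
  also have "\<dots> = J 0 (\<lambda>z. arch_logd (of_real u + z)) Y + J 0 arith_logd Y" by (rule J_add[OF cB cA line])
  finally have "Re (J 0 (\<lambda>z. logd (of_real u + z)) Y) = Re (J 0 (\<lambda>z. arch_logd (of_real u + z)) Y) + Re (J 0 arith_logd Y)" by simp
  moreover have "Re (J 0 (\<lambda>z. logd (of_real u + z)) Y) \<le> 64 * V ^ 4 * \<eta>" by (rule J_logd_upper[OF \<eta> small Y(1)])
  moreover have "l / 2 * (1 / (2 * pi) - 6 / Y) - 64 * V ^ 4 * (real m * (digamma_bound + 10)) \<le> Re (J 0 (\<lambda>z. arch_logd (of_real u + z)) Y)"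
    unfolding l_def by (rule J_arch_logd[OF Y(1)])
  moreover have "- Re (J 0 arith_logd Y) \<le> norm (J 0 arith_logd Y)" using abs_Re_le_cmod[of "J 0 arith_logd Y"] by linarith
  moreover have "l / 2 * (1 / (2 * pi) - 6 / Y) = l / (4 * pi) - 3 * l / Y" by (simp add: algebra_simps)
  moreover have "3 * l / Y \<le> 1 / 2" using Y by (simp add: divide_le_eq)
  ultimately show ?thesis using YA unfolding l_def by argo
qed

end

context L_fun
begin

text \<open>On the compact zero-free box \<open>K\<close> the function \<open>logd\<close> is
  uniformly continuous, and its real part vanishes on the left edge. A small \<open>u\<close> thus
  makes \<open>\<bar>Re logd\<bar> \<le> \<eta>\<close> on the needed range.\<close>

lemma conductor_bound:
  assumes V: "V \<ge> 2 * pi" and no_zero: "\<And>t. t\<^sup>2 \<le> (pi / V)\<^sup>2 * (1 + 1 / V) \<Longrightarrow> f (Complex 0 t) \<noteq> 0"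
  shows "ln (analytic_conductor L) / (4 * pi) \<le> 
    64 * V ^ 4 * (real m * (digamma_bound + 10)) + 832 * real m * V ^ 6 * exp (V * (1/2 + \<theta>)) + 1"
proof (rule ccontr)
  assume neg: "\<not> ?thesis"
  define E where "E = ln (analytic_conductor L) / (4 * pi) - (64 * V ^ 4 * (real m * (digamma_bound + 10)) + 832 * real m * V ^ 6 * exp (V * (1/2 + \<theta>)) + 1)"
  have E: "E > 0" using neg by (simp add: E_def)
  have V0: "V > 0" using V pi_gt_zero by linarith
  \<comment> \<open>The error term \<open>64 V ^ 4 \<eta>\<close> becomes \<open>E / 2\<close>, half
    of the supposed excess.\<close>
  define \<eta> where "\<eta> = E / (128 * V ^ 4)"
  have \<eta>: "\<eta> > 0" using E V0 by (simp add: \<eta>_def)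
  define T where "T = sqrt ((pi / V)\<^sup>2 * (1 + 1 / V))"
  have T2: "T\<^sup>2 = (pi / V)\<^sup>2 * (1 + 1 / V)" and T0: "T \<ge> 0" using V0 by (simp_all add: T_def)
  have abs: "t\<^sup>2 \<le> (pi / V)\<^sup>2 * (1 + 1 / V) \<longleftrightarrow> \<bar>t\<bar> \<le> T" for t
    unfolding T2[symmetric] using T0 abs_le_square_iff[of t T] by simp
  define K where "K = cbox (Complex 0 (- T)) (Complex 1 T)"
  have K: "z \<in> K \<longleftrightarrow> 0 \<le> Re z \<and> Re z \<le> 1 \<and> \<bar>Im z\<bar> \<le> T" for z
    by (auto simp: K_def in_cbox_complex_iff)
  have nz: "f z \<noteq> 0" if "z \<in> K" for z
  proof (cases "Re z > 0")
    case False
    hence "z = Complex 0 (Im z)" using that K by (auto simp: complex_eq_iff)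
    thus ?thesis using no_zero[of "Im z"] that abs[of "Im z"] K[of z] by simp
  qed (rule f_nonzero)
  have "continuous_on K logd" by (intro holomorphic_on_imp_continuous_on logd_holomorphic nz)
  hence "uniformly_continuous_on K logd" by (rule compact_uniformly_continuous) (simp add: K_def)
  then obtain \<delta> where \<delta>: "\<delta> > 0" "\<And>z z'. z \<in> K \<Longrightarrow> z' \<in> K \<Longrightarrow> dist z' z < \<delta> \<Longrightarrow> dist (logd z') (logd z) < \<eta>"
    using \<eta> unfolding uniformly_continuous_on_def by meson
  define u where "u = min (\<delta> / 2) 1"
  have u_bounds: "0 < u" "u \<le> 1" "u < \<delta>" using \<delta>(1) by (auto simp: u_def)
  obtain C R0 where "symmetric_halfplane f (root_number L) C R0" using symmetric by blast
  then interpret symmetric_halfplane f "root_number L" C R0 .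
  interpret L_fun_kernel \<theta> L V u by unfold_locales (use V u_bounds in auto)
  have "ln (analytic_conductor L) / (4 * pi) \<le> 
    64 * V ^ 4 * (real m * (digamma_bound + 10)) + 832 * real m * V ^ 6 * exp (V * (1/2 + \<theta>)) + 1 + 64 * V ^ 4 * \<eta>"
  proof (rule conductor_bound_shifted)
    fix t assume t: "t\<^sup>2 \<le> (pi / V)\<^sup>2 * (1 + 1 / V)"
    have "Complex u t - Complex 0 t = of_real u" by (simp add: complex_eq_iff)
    hence "dist (Complex u t) (Complex 0 t) = norm (of_real u :: complex)" by (simp only: dist_norm)
    hence "dist (Complex u t) (Complex 0 t) < \<delta>" using u_bounds by simp
    hence "dist (logd (Complex u t)) (logd (Complex 0 t)) < \<eta>"
      using t u abs[of t] by (intro \<delta>(2)) (auto simp: K)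
    hence "norm (logd (Complex u t) - logd (Complex 0 t)) < \<eta>" by (simp only: dist_norm)
    moreover have "Re (logd (Complex 0 t)) = 0" by (rule logd_imaginary[OF no_zero[OF t]])
    ultimately show "\<bar>Re (logd (Complex u t))\<bar> \<le> \<eta>"
      using abs_Re_le_cmod[of "logd (Complex u t) - logd (Complex 0 t)"] by simp
  qed (use \<eta> in simp)
  moreover have "64 * V ^ 4 * \<eta> = E / 2" using V0 by (simp add: \<eta>_def)
  moreover have "ln (analytic_conductor L) / (4 * pi) = E + (64 * V ^ 4 * (real m * (digamma_bound + 10)) + 832 * real m * V ^ 6 * exp (V * (1/2 + \<theta>)) + 1)"
    by (simp add: E_def)
  ultimately show False using E by argo
qed

text \<open>The contrapositive of \<open>conductor_bound\<close>. In \<open>c\<close> the number 833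
  is \<open>832 + 1\<close>, the 1 being absorbed by
  \<open>m V ^ 6 exp (V (1/2 + \<theta>)) \<ge> 1\<close>; 16 bounds \<open>4 pi\<close>, and
  \<open>1 + 1/V\<close> bounds its own square root.\<close>

lemma low_zero:
  assumes V: "V \<ge> 2 * pi"
    and c: "c = 64 * (digamma_bound + 10) + 833"
    and large: "ln (analytic_conductor L) > 16 * c * real m * V ^ 6 * exp (V * (1/2 + \<theta>))"
  obtains \<gamma> where "isolated_zero \<Lambda> (Complex (1/2) \<gamma>)" "\<bar>\<gamma>\<bar> \<le> pi / V * (1 + 1 / V)"
proof -
  have V1: "V \<ge> 1" using V pi_gt3 by linarith
  have "\<not> (\<forall>t. t\<^sup>2 \<le> (pi / V)\<^sup>2 * (1 + 1 / V) \<longrightarrow> f (Complex 0 t) \<noteq> 0)"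
  proof
    assume *: "\<forall>t. t\<^sup>2 \<le> (pi / V)\<^sup>2 * (1 + 1 / V) \<longrightarrow> f (Complex 0 t) \<noteq> 0"
    define q where "q = V ^ 6 * exp (V * (1/2 + \<theta>))"
    have e1: "1 \<le> exp (V * (1/2 + \<theta>))" using V1 theta by simp
    have q: "V ^ 4 \<le> q" "1 \<le> q"
    proof -
      have "V ^ 4 * 1 \<le> V ^ 6 * exp (V * (1/2 + \<theta>))" using e1 V1 by (intro mult_mono power_increasing) auto
      thus "V ^ 4 \<le> q" by (simp add: q_def)
      moreover have "1 \<le> V ^ 4" using V1 by simp
      ultimately show "1 \<le> q" by linarith
    qed
    have d: "digamma_bound + 10 \<ge> 0" using digamma_bound_nonneg by simp
    have mm: "1 \<le> real m" using m_pos by simp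
    have "ln (analytic_conductor L) / (4 * pi) \<le> 64 * V ^ 4 * (real m * (digamma_bound + 10)) + 832 * real m * V ^ 6 * exp (V * (1/2 + \<theta>)) + 1"
      using conductor_bound[OF V] * by blast
    also have "\<dots> \<le> 64 * q * (real m * (digamma_bound + 10)) + 832 * real m * q + real m * q"
    proof (intro add_mono)
      show "64 * V ^ 4 * (real m * (digamma_bound + 10)) \<le> 64 * q * (real m * (digamma_bound + 10))"
        using q d by (intro mult_right_mono) auto
      show "832 * real m * V ^ 6 * exp (V * (1/2 + \<theta>)) \<le> 832 * real m * q" by (simp add: q_def)
      show "1 \<le> real m * q" using mult_mono[OF mm q(2)] by simp
    qed
    also have "\<dots> = c * real m * q" by (simp add: c algebra_simps)
    finally have le: "ln (analytic_conductor L) / (4 * pi) \<le> c * real m * q" .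
    have "c \<ge> 0" using d by (simp add: c)
    hence nn: "0 \<le> c * real m * q" using q by (intro mult_nonneg_nonneg) auto
    have "ln (analytic_conductor L) = (4 * pi) * (ln (analytic_conductor L) / (4 * pi))" by simp
    also have "\<dots> \<le> (4 * pi) * (c * real m * q)" using le by (intro mult_left_mono) auto
    also have "\<dots> \<le> 16 * (c * real m * q)" using nn pi_less_4 by (intro mult_right_mono) auto
    finally show False using large by (simp add: q_def mult_ac)
  qed
  then obtain t where t: "t\<^sup>2 \<le> (pi / V)\<^sup>2 * (1 + 1 / V)" "f (Complex 0 t) = 0" by blast
  have "1/2 + Complex 0 t = Complex (1/2) t" by (simp add: complex_eq_iff)
  hence "F (Complex (1/2) t) = 0" using t(2) unfolding f_def by simp
  hence z: "isolated_zero \<Lambda> (Complex (1/2) t)" by (rule F_zero_imp(1))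
  have "(pi / V)\<^sup>2 * (1 + 1 / V) \<le> (pi / V)\<^sup>2 * (1 + 1 / V)\<^sup>2"
  proof (rule mult_left_mono)
    have "(1 + 1 / V) ^ 1 \<le> (1 + 1 / V) ^ 2" using V1 by (intro power_increasing) auto
    thus "1 + 1 / V \<le> (1 + 1 / V)\<^sup>2" by simp
  qed simp
  hence "t\<^sup>2 \<le> (pi / V * (1 + 1 / V))\<^sup>2" using t(1) unfolding power_mult_distrib by linarith
  hence "\<bar>t\<bar> \<le> \<bar>pi / V * (1 + 1 / V)\<bar>" by (simp only: abs_le_square_iff)
  also have "\<dots> = pi / V * (1 + 1 / V)" using V1 by (intro abs_of_nonneg mult_nonneg_nonneg) auto
  finally show ?thesis using that z by blast
qed

end

theorem theorem7:
  shows "\<exists>K>0. \<exists>X\<^sub>0::real. \<forall>(\<theta>::real) (L::lfun).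
    L_function \<theta> L \<longrightarrow> GRH L \<longrightarrow>
    (let X = analytic_conductor L powr (3 / real (deg_L L)) in
      X > X\<^sub>0 \<longrightarrow>
      (\<exists>\<gamma>::real. isolated_zero (completed L) (Complex (1 / 2) \<gamma>) \<and>
        \<bar>\<gamma>\<bar> \<le> (1 / 2 + \<theta>) * (pi / ln (ln X)) + K * (ln (ln (ln X)) / (ln (ln X))\<^sup>2)))"
proof -
  define K1 where "K1 = 64 * (digamma_bound + 10) + 833"
  have K1: "K1 > 0" using digamma_bound_nonneg by (simp add: K1_def)
  \<comment> \<open>\<open>3072 = 3 * 16 * 64\<close>: 3 from the power \<open>3/m\<close>, 16 from
    \<open>low_zero\<close>, 64 from \<open>V ^ 6 \<le> (2 l) ^ 6\<close>. The bound 30 ensures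
    \<open>V \<ge> l / 3 \<ge> 10 > 2 pi\<close>.\<close>
  have "eventually (\<lambda>X::real. X > 0) at_top" "eventually (\<lambda>X::real. ln X > 0) at_top"
    "eventually (\<lambda>X::real. ln (ln X) > 3072 * K1) at_top" "eventually (\<lambda>X::real. ln (ln X) \<ge> 30) at_top"
    "eventually (\<lambda>X::real. 7 * ln (ln (ln X)) \<le> ln (ln X) / 2) at_top" "eventually (\<lambda>X::real. ln (ln (ln X)) \<ge> 1) at_top"
    by real_asymp+
  hence "eventually (\<lambda>X::real. X > 0 \<and> ln X > 0 \<and> ln (ln X) > 3072 * K1 \<and> ln (ln X) \<ge> 30 \<and>
     7 * ln (ln (ln X)) \<le> ln (ln X) / 2 \<and> ln (ln (ln X)) \<ge> 1) at_top"
    by (intro eventually_conj)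
  then obtain X0 where X0: "\<And>X::real. X \<ge> X0 \<Longrightarrow> X > 0 \<and> ln X > 0 \<and> ln (ln X) > 3072 * K1 \<and> ln (ln X) \<ge> 30 \<and>
     7 * ln (ln (ln X)) \<le> ln (ln X) / 2 \<and> ln (ln (ln X)) \<ge> 1"
    unfolding eventually_at_top_linorder by blast
  show ?thesis
  \<comment> \<open>\<open>120 = 84 + 36\<close>: with \<open>pi \<alpha> \<le> 6\<close>, the
    expansion of \<open>pi / V\<close> contributes \<open>6 * 14\<close>, and
    \<open>pi / V\<^sup>2\<close> contributes \<open>4 * 3 * 3\<close>.\<close>
  proof (rule exI[of _ 120], rule conjI, simp, rule exI[of _ X0], intro allI impI)
    fix \<theta> :: real and L :: lfun
    assume "L_function \<theta> L" "GRH L"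
    then interpret L_fun \<theta> L by unfold_locales
    define X where "X = analytic_conductor L powr (3 / real m)"
    have "\<exists>\<gamma>. isolated_zero \<Lambda> (Complex (1 / 2) \<gamma>) \<and>
        \<bar>\<gamma>\<bar> \<le> (1 / 2 + \<theta>) * (pi / ln (ln X)) + 120 * (ln (ln (ln X)) / (ln (ln X))\<^sup>2)" if "X > X0"
    proof -
      have "X \<ge> X0" using that by simp
      define l k where "l = ln (ln X)" and "k = ln l"
      from X0[OF \<open>X \<ge> X0\<close>] have X: "ln X > 0" "l > 3072 * K1" "l \<ge> 30" "7 * k \<le> l / 2" "k \<ge> 1"
        by (auto simp: l_def k_def)
      define \<alpha> where "\<alpha> = 1/2 + \<theta>"
      have \<alpha>: "1/2 \<le> \<alpha>" "\<alpha> \<le> 3/2" using theta by (auto simp: \<alpha>_def)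
      have d: "l - 7 * k \<ge> l / 2" using X by argo
      have d0: "l - 7 * k > 0" using d X by argo
      \<comment> \<open>Then \<open>exp (V \<alpha>) = ln X / l ^ 7\<close>: six powers of
        \<open>l\<close> cancel \<open>V ^ 6\<close>, and the seventh beats the constant.\<close>
      define V where "V = (l - 7 * k) / \<alpha>"
      have V\<alpha>: "V * \<alpha> = l - 7 * k" using \<alpha> by (simp add: V_def)
      have Vl: "V \<le> 2 * l"
      proof -
        have "V \<le> (l - 7 * k) / (1/2)" unfolding V_def using \<alpha> d0 by (intro divide_left_mono) auto
        thus ?thesis using X by simp
      qed
      have Vlow: "V \<ge> (l / 2) / (3/2)" unfolding V_def using \<alpha> d X by (intro frac_le) auto
      have "V \<ge> 2 * pi" using Vlow X pi_less_4 by argo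
      have "ln (analytic_conductor L) = real m * ln X / 3"
        using m_pos conductor_pos by (simp add: X_def ln_powr)
      moreover have "ln X > 48 * K1 * V ^ 6 * exp (V * \<alpha>)"
      proof -
        have eX: "exp l = ln X" using X by (simp add: l_def)
        have "exp (7 * k) = l ^ 7"
        proof -
          have "l > 0" using X by linarith
          hence "exp k = l" by (simp add: k_def)
          thus ?thesis using exp_of_nat_mult[of 7 k] by simp
        qed
        hence e: "exp (V * \<alpha>) = ln X / l ^ 7" unfolding V\<alpha> by (simp add: exp_diff eX)
        have "V ^ 6 \<le> (2 * l) ^ 6" using Vl V_def d0 \<alpha> by (intro power_mono) auto
        hence "48 * K1 * V ^ 6 * exp (V * \<alpha>) \<le> 48 * K1 * (2 * l) ^ 6 * exp (V * \<alpha>)"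
          using K1 by (intro mult_right_mono mult_left_mono) auto
        also have "\<dots> = 3072 * K1 * ln X / l"
          unfolding e using X by (simp add: power_mult_distrib eval_nat_numeral field_simps)
        also have "\<dots> < l * ln X / l" using X by (intro divide_strict_right_mono mult_strict_right_mono) auto
        also have "\<dots> = ln X" using X by simp
        finally show ?thesis .
      qed
      hence "real m * (48 * K1 * V ^ 6 * exp (V * \<alpha>)) < real m * ln X"
        using m_pos by (intro mult_strict_left_mono) auto
      moreover have "real m * (48 * K1 * V ^ 6 * exp (V * \<alpha>)) = 3 * (16 * K1 * real m * V ^ 6 * exp (V * \<alpha>))" by simp
      ultimately have "ln (analytic_conductor L) > 16 * K1 * real m * V ^ 6 * exp (V * \<alpha>)" by argo
      from low_zero[OF \<open>V \<ge> 2 * pi\<close> K1_def this[unfolded \<alpha>_def]]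
      obtain \<gamma> where \<gamma>: "isolated_zero \<Lambda> (Complex (1/2) \<gamma>)" "\<bar>\<gamma>\<bar> \<le> pi / V * (1 + 1 / V)" by blast
      have "pi / V * (1 + 1 / V) \<le> \<alpha> * (pi / l) + 120 * (k / l\<^sup>2)"
      proof -
        \<comment> \<open>Amounts to \<open>l\<^sup>2 \<le> (l + 14 k) (l - 7 k)\<close>, that is
          \<open>14 k \<le> l\<close>.\<close>
        have inv: "1 / (l - 7 * k) \<le> 1 / l + 14 * k / l\<^sup>2"
        proof -
          have "1 * l\<^sup>2 \<le> (l + 14 * k) * (l - 7 * k)"
            using mult_left_mono[OF X(4), of "14 * k"] X by (simp add: power2_eq_square algebra_simps)
          hence "1 / (l - 7 * k) \<le> (l + 14 * k) / l\<^sup>2" using d0 X by (simp add: frac_le_eq divide_le_eq pos_le_divide_eq mult_ac)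
          also have "\<dots> = 1 / l + 14 * k / l\<^sup>2" using X by (simp add: field_simps power2_eq_square)
          finally show ?thesis .
        qed
        have p4: "pi * \<alpha> \<le> 4 * (3/2)" using pi_less_4 \<alpha> by (intro mult_mono) auto
        have "pi / V = pi * \<alpha> * (1 / (l - 7 * k))" by (simp add: V_def)
        also have "\<dots> \<le> pi * \<alpha> * (1 / l + 14 * k / l\<^sup>2)" using inv \<alpha> by (intro mult_left_mono) auto
        also have "\<dots> = \<alpha> * (pi / l) + pi * \<alpha> * (14 * k / l\<^sup>2)" by (simp add: algebra_simps)
        also have "pi * \<alpha> * (14 * k / l\<^sup>2) \<le> 4 * (3/2) * (14 * k / l\<^sup>2)" using p4 X by (intro mult_right_mono) auto
        finally have 1: "pi / V \<le> \<alpha> * (pi / l) + 84 * (k / l\<^sup>2)" by simp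
        have V3: "1 / V \<le> 3 / l"
        proof -
          have "1 / V \<le> 1 / ((l / 2) / (3/2))" using Vlow X by (intro divide_left_mono mult_pos_pos) auto
          thus ?thesis by simp
        qed
        have "pi / V * (1 / V) \<le> (4 * (3 / l)) * (3 / l)"
        proof -
          have V0: "V > 0" using \<open>V \<ge> 2 * pi\<close> pi_gt_zero by linarith
          have l0: "l > 0" using X by linarith
          have "pi * (1 / V) \<le> 4 * (3 / l)"
            by (intro mult_mono V3) (use V0 pi_less_4 in auto)
          hence "pi / V \<le> 4 * (3 / l)" by simp
          thus ?thesis by (intro mult_mono V3) (use V0 l0 in auto)
        qed
        also have "\<dots> = 36 * (1 / l\<^sup>2)" by (simp add: power2_eq_square)
        also have "\<dots> \<le> 36 * (k / l\<^sup>2)" using X by (intro mult_left_mono divide_right_mono) auto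
        finally have 2: "pi / V * (1 / V) \<le> 36 * (k / l\<^sup>2)" .
        have "pi / V * (1 + 1 / V) = pi / V + pi / V * (1 / V)" by (simp only: distrib_left mult_1_right)
        thus ?thesis using 1 2 by linarith
      qed
      hence "\<bar>\<gamma>\<bar> \<le> (1/2 + \<theta>) * (pi / ln (ln X)) + 120 * (ln (ln (ln X)) / (ln (ln X))\<^sup>2)"
        using \<gamma>(2) unfolding \<alpha>_def k_def l_def by linarith
      thus ?thesis using \<gamma>(1) by blast
    qed
    thus "let X = analytic_conductor L powr (3 / real m) in X > X0 \<longrightarrow> (\<exists>\<gamma>. isolated_zero \<Lambda> (Complex (1 / 2) \<gamma>) \<and>
        \<bar>\<gamma>\<bar> \<le> (1 / 2 + \<theta>) * (pi / ln (ln X)) + 120 * (ln (ln (ln X)) / (ln (ln X))\<^sup>2))"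
      by (simp add: Let_def X_def)
  qed
qed

end
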